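(* Let $k$ be a field, let $H$ be a cosemisimple Hopf algebra over $k$ and let $A\subseteq H$ be a Hopf subalgebra. Then the quotient coalgebra $C=H/HA^+$ is cosemisimple.
   Context: Here $A^+=\ker(\varepsilon_H)\cap A$ is the kernel of the counit of $A$, and $HA^+$ is the left ideal of $H$ generated by $A^+$. It is a coideal, so that $C=H/HA^+$ is a quotient coalgebra (and a quotient left $H$-module coalgebra) of $H$. A coalgebra (in particular a Hopf algebra) is cosemisimple if it is the direct sum of its simple subcoalgebras. *)

theory Defs
  imports "HOL-Algebra.Module" "HOL-Algebra.Subrings"
begin

section \<open>Linear algebra\<close>

text \<open>As in \<^theory>\<open>HOL-Algebra.Module\<close>, modules are records extending rings; their
  multiplicative components are ignored and left undefined in the constructions below.\<close>

definition linear_maps ::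
    "('a, 'i) ring_scheme \<Rightarrow> ('a, 'b, 'j) module_scheme \<Rightarrow> ('a, 'c, 'l) module_scheme
      \<Rightarrow> ('b \<Rightarrow> 'c) set" where
  "linear_maps K M N = {f \<in> carrier M \<rightarrow> carrier N.
     (\<forall>x\<in>carrier M. \<forall>y\<in>carrier M. f (x \<oplus>\<^bsub>M\<^esub> y) = f x \<oplus>\<^bsub>N\<^esub> f y) \<and>
     (\<forall>a\<in>carrier K. \<forall>x\<in>carrier M. f (a \<odot>\<^bsub>M\<^esub> x) = a \<odot>\<^bsub>N\<^esub> f x)}"

definition self_module :: "('a, 'i) ring_scheme \<Rightarrow> ('a, 'a) module" where
  "self_module K = \<lparr>carrier = carrier K, mult = mult K, one = one K, zero = zero K, add = add K,
     smult = mult K\<rparr>"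

definition module_span ::
    "('a, 'i) ring_scheme \<Rightarrow> ('a, 'b, 'j) module_scheme \<Rightarrow> 'b set \<Rightarrow> 'b set" where
  "module_span K M S = \<Inter>{N. submodule N K M \<and> S \<subseteq> N}"

definition quotient_module ::
    "('a, 'i) ring_scheme \<Rightarrow> ('a, 'b, 'j) module_scheme \<Rightarrow> 'b set \<Rightarrow> ('a, 'b set) module" where
  "quotient_module K M N = \<lparr>carrier = a_rcosets\<^bsub>M\<^esub> N, mult = undefined, one = undefined,
     zero = N, add = set_add M,
     smult = (\<lambda>a X. the_elem ((\<lambda>x. N +>\<^bsub>M\<^esub> (a \<odot>\<^bsub>M\<^esub> x)) ` X))\<rparr>"

text \<open>\<open>is_direct_sum M \<S>\<close>: the module \<open>M\<close> is the internal direct sum of the family \<open>\<S>\<close> of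
  submodules, indexed by itself.\<close>

definition is_direct_sum :: "('b, 'j) ring_scheme \<Rightarrow> 'b set set \<Rightarrow> bool" where
  "is_direct_sum M \<S> \<longleftrightarrow> (\<forall>x\<in>carrier M. \<exists>!f.
     f \<in> (\<Pi>\<^sub>E D\<in>\<S>. D) \<and> finite {D \<in> \<S>. f D \<noteq> \<zero>\<^bsub>M\<^esub>} \<and>
     x = (\<Oplus>\<^bsub>M\<^esub>D\<in>{D \<in> \<S>. f D \<noteq> \<zero>\<^bsub>M\<^esub>}. f D))"


section \<open>Tensor products\<close>

definition free_module :: "('a, 'i) ring_scheme \<Rightarrow> 'x set \<Rightarrow> ('a, 'x \<Rightarrow> 'a) module" where
  "free_module K X = \<lparr>
     carrier = {f. (\<forall>x. f x \<in> carrier K) \<and> {x. f x \<noteq> \<zero>\<^bsub>K\<^esub>} \<subseteq> X \<and> finite {x. f x \<noteq> \<zero>\<^bsub>K\<^esub>}},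
     mult = undefined, one = undefined,
     zero = (\<lambda>_. \<zero>\<^bsub>K\<^esub>), add = (\<lambda>f g x. f x \<oplus>\<^bsub>K\<^esub> g x), smult = (\<lambda>a f x. a \<otimes>\<^bsub>K\<^esub> f x)\<rparr>"

definition free_gen :: "('a, 'i) ring_scheme \<Rightarrow> 'x \<Rightarrow> 'x \<Rightarrow> 'a" where
  "free_gen K x = (\<lambda>y. if y = x then \<one>\<^bsub>K\<^esub> else \<zero>\<^bsub>K\<^esub>)"

definition tensor_relations ::
    "('a, 'i) ring_scheme \<Rightarrow> ('a, 'b, 'j) module_scheme \<Rightarrow> ('a, 'c, 'l) module_scheme
      \<Rightarrow> ('b \<times> 'c \<Rightarrow> 'a) set" where
  "tensor_relations K M N = (let F = free_module K (carrier M \<times> carrier N) in module_span K F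
     ({free_gen K (x \<oplus>\<^bsub>M\<^esub> x', y) \<ominus>\<^bsub>F\<^esub> (free_gen K (x, y) \<oplus>\<^bsub>F\<^esub> free_gen K (x', y)) | x x' y.
         x \<in> carrier M \<and> x' \<in> carrier M \<and> y \<in> carrier N} \<union>
      {free_gen K (x, y \<oplus>\<^bsub>N\<^esub> y') \<ominus>\<^bsub>F\<^esub> (free_gen K (x, y) \<oplus>\<^bsub>F\<^esub> free_gen K (x, y')) | x y y'.
         x \<in> carrier M \<and> y \<in> carrier N \<and> y' \<in> carrier N} \<union>
      {free_gen K (a \<odot>\<^bsub>M\<^esub> x, y) \<ominus>\<^bsub>F\<^esub> (a \<odot>\<^bsub>F\<^esub> free_gen K (x, y)) | a x y.
         a \<in> carrier K \<and> x \<in> carrier M \<and> y \<in> carrier N} \<union>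
      {free_gen K (x, a \<odot>\<^bsub>N\<^esub> y) \<ominus>\<^bsub>F\<^esub> (a \<odot>\<^bsub>F\<^esub> free_gen K (x, y)) | a x y.
         a \<in> carrier K \<and> x \<in> carrier M \<and> y \<in> carrier N}))"

definition tensor ::
    "('a, 'i) ring_scheme \<Rightarrow> ('a, 'b, 'j) module_scheme \<Rightarrow> ('a, 'c, 'l) module_scheme
      \<Rightarrow> ('a, ('b \<times> 'c \<Rightarrow> 'a) set) module" where
  "tensor K M N =
     quotient_module K (free_module K (carrier M \<times> carrier N)) (tensor_relations K M N)"

definition tensor_elem ::
    "('a, 'i) ring_scheme \<Rightarrow> ('a, 'b, 'j) module_scheme \<Rightarrow> ('a, 'c, 'l) module_scheme
      \<Rightarrow> 'b \<Rightarrow> 'c \<Rightarrow> ('b \<times> 'c \<Rightarrow> 'a) set" where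
  "tensor_elem K M N x y =
     tensor_relations K M N +>\<^bsub>free_module K (carrier M \<times> carrier N)\<^esub> free_gen K (x, y)"

text \<open>For bilinear \<open>\<beta> : M \<times> N \<rightarrow> P\<close>, the linear map \<open>M \<otimes> N \<rightarrow> P\<close> with
  \<open>x \<otimes> y \<mapsto> \<beta> x y\<close>: a coset \<open>T\<close> is sent to the common value on \<open>T\<close> of the linear extension
  of \<open>\<beta>\<close> to formal sums. For non-bilinear \<open>\<beta>\<close> the value is unspecified.\<close>

definition tensor_lift ::
    "('a, 'i) ring_scheme \<Rightarrow> ('a, 'd, 'p) module_scheme \<Rightarrow> ('b \<Rightarrow> 'c \<Rightarrow> 'd)
      \<Rightarrow> ('b \<times> 'c \<Rightarrow> 'a) set \<Rightarrow> 'd" where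
  "tensor_lift K P \<beta> T = the_elem
     ((\<lambda>t. \<Oplus>\<^bsub>P\<^esub>p\<in>{p. t p \<noteq> \<zero>\<^bsub>K\<^esub>}. t p \<odot>\<^bsub>P\<^esub> \<beta> (fst p) (snd p)) ` T)"


section \<open>Coalgebras\<close>

record ('a, 'b) coalgebra = "('a, 'b) module" +
  comult :: "'b \<Rightarrow> ('b \<times> 'b \<Rightarrow> 'a) set"
  counit :: "'b \<Rightarrow> 'a"

text \<open>Coassociativity is stated in \<open>C \<otimes> (C \<otimes> C)\<close>: its left-hand side is \<open>(\<Delta> \<otimes> id) \<Delta> c\<close> composed
  with the associator, i.e. \<open>\<Sum> c\<^sub>1\<^sub>1 \<otimes> (c\<^sub>1\<^sub>2 \<otimes> c\<^sub>2)\<close>. The counit axioms likewise contain the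
  identifications \<open>K \<otimes> C = C = C \<otimes> K\<close>.\<close>

locale coalgebra = Ring.field K + module K C
  for K :: "('a, 'i) ring_scheme" (structure) and C :: "('a, 'b, 'c) coalgebra_scheme" (structure) +
  assumes comult_linear: "comult C \<in> linear_maps K C (tensor K C C)"
    and counit_linear: "counit C \<in> linear_maps K C (self_module K)"
    and coassoc: "c \<in> carrier C \<Longrightarrow>
      tensor_lift K (tensor K C (tensor K C C))
        (\<lambda>x y. tensor_lift K (tensor K C (tensor K C C))
           (\<lambda>x1 x2. tensor_elem K C (tensor K C C) x1 (tensor_elem K C C x2 y)) (comult C x))
        (comult C c) =
      tensor_lift K (tensor K C (tensor K C C))
        (\<lambda>x y. tensor_elem K C (tensor K C C) x (comult C y)) (comult C c)"
    and counit_left: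
      "c \<in> carrier C \<Longrightarrow> tensor_lift K C (\<lambda>x y. counit C x \<odot>\<^bsub>C\<^esub> y) (comult C c) = c"
    and counit_right:
      "c \<in> carrier C \<Longrightarrow> tensor_lift K C (\<lambda>x y. counit C y \<odot>\<^bsub>C\<^esub> x) (comult C c) = c"

text \<open>The span below is the image of \<open>D \<otimes> D\<close> in \<open>C \<otimes> C\<close>.\<close>

definition subcoalgebra ::
    "('a, 'i) ring_scheme \<Rightarrow> ('a, 'b, 'c) coalgebra_scheme \<Rightarrow> 'b set \<Rightarrow> bool" where
  "subcoalgebra K C D \<longleftrightarrow> submodule D K C \<and>
     comult C ` D \<subseteq>
       module_span K (tensor K C C) {tensor_elem K C C x y | x y. x \<in> D \<and> y \<in> D}"

definition simple_subcoalgebra ::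
    "('a, 'i) ring_scheme \<Rightarrow> ('a, 'b, 'c) coalgebra_scheme \<Rightarrow> 'b set \<Rightarrow> bool" where
  "simple_subcoalgebra K C D \<longleftrightarrow> subcoalgebra K C D \<and> D \<noteq> {\<zero>\<^bsub>C\<^esub>} \<and>
     (\<forall>E. subcoalgebra K C E \<and> E \<subseteq> D \<longrightarrow> E = {\<zero>\<^bsub>C\<^esub>} \<or> E = D)"

definition cosemisimple ::
    "('a, 'i) ring_scheme \<Rightarrow> ('a, 'b, 'c) coalgebra_scheme \<Rightarrow> bool" where
  "cosemisimple K C \<longleftrightarrow> coalgebra K C \<and> is_direct_sum C {D. simple_subcoalgebra K C D}"

text \<open>The quotient coalgebra \<open>C/I\<close> for a coideal \<open>I\<close>, with \<open>\<Delta>(x + I) = (\<pi> \<otimes> \<pi>)(\<Delta> x)\<close> for the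
  projection \<open>\<pi>\<close>, and \<open>\<epsilon>(x + I) = \<epsilon> x\<close>; both are independent of the representative exactly because
  \<open>I\<close> is a coideal.\<close>

definition quotient_coalgebra ::
    "('a, 'i) ring_scheme \<Rightarrow> ('a, 'b, 'c) coalgebra_scheme \<Rightarrow> 'b set \<Rightarrow> ('a, 'b set) coalgebra"
  where
  "quotient_coalgebra K C I = (let Q = quotient_module K C I in
     \<lparr>carrier = carrier Q, mult = mult Q, one = one Q, zero = zero Q, add = add Q, smult = smult Q,
      comult = (\<lambda>X. the_elem ((\<lambda>x. tensor_lift K (tensor K Q Q)
        (\<lambda>y z. tensor_elem K Q Q (I +>\<^bsub>C\<^esub> y) (I +>\<^bsub>C\<^esub> z)) (comult C x)) ` X)),
      counit = (\<lambda>X. the_elem (counit C ` X))\<rparr>)"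


section \<open>Hopf algebras\<close>

text \<open>The library locale \<^locale>\<open>algebra\<close> covers commutative algebras only.\<close>

locale assoc_algebra = module K H + ring H
  for K :: "('a, 'i) ring_scheme" (structure) and H :: "('a, 'b, 'c) module_scheme" (structure) +
  assumes smult_mult_left: "\<lbrakk>a \<in> carrier K; x \<in> carrier H; y \<in> carrier H\<rbrakk> \<Longrightarrow>
      (a \<odot>\<^bsub>H\<^esub> x) \<otimes>\<^bsub>H\<^esub> y = a \<odot>\<^bsub>H\<^esub> (x \<otimes>\<^bsub>H\<^esub> y)"
    and smult_mult_right: "\<lbrakk>a \<in> carrier K; x \<in> carrier H; y \<in> carrier H\<rbrakk> \<Longrightarrow>
      x \<otimes>\<^bsub>H\<^esub> (a \<odot>\<^bsub>H\<^esub> y) = a \<odot>\<^bsub>H\<^esub> (x \<otimes>\<^bsub>H\<^esub> y)"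

text \<open>The product of the algebra \<open>H \<otimes> H\<close>, \<open>(x \<otimes> y) (x' \<otimes> y') = x x' \<otimes> y y'\<close>.\<close>

definition tensor_mult ::
    "('a, 'i) ring_scheme \<Rightarrow> ('a, 'b, 'j) module_scheme
      \<Rightarrow> ('b \<times> 'b \<Rightarrow> 'a) set \<Rightarrow> ('b \<times> 'b \<Rightarrow> 'a) set \<Rightarrow> ('b \<times> 'b \<Rightarrow> 'a) set" where
  "tensor_mult K H S T = tensor_lift K (tensor K H H)
     (\<lambda>x y. tensor_lift K (tensor K H H)
        (\<lambda>x' y'. tensor_elem K H H (x \<otimes>\<^bsub>H\<^esub> x') (y \<otimes>\<^bsub>H\<^esub> y')) T) S"

record ('a, 'b) hopf_algebra = "('a, 'b) coalgebra" +
  antipode :: "'b \<Rightarrow> 'b"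

locale hopf_algebra = assoc_algebra K H + coalgebra K H
  for K :: "('a, 'i) ring_scheme" (structure) and H :: "('a, 'b, 'c) hopf_algebra_scheme" (structure) +
  assumes comult_one: "comult H \<one>\<^bsub>H\<^esub> = tensor_elem K H H \<one>\<^bsub>H\<^esub> \<one>\<^bsub>H\<^esub>"
    and comult_mult: "\<lbrakk>x \<in> carrier H; y \<in> carrier H\<rbrakk> \<Longrightarrow>
      comult H (x \<otimes>\<^bsub>H\<^esub> y) = tensor_mult K H (comult H x) (comult H y)"
    and counit_one: "counit H \<one>\<^bsub>H\<^esub> = \<one>\<^bsub>K\<^esub>"
    and counit_mult: "\<lbrakk>x \<in> carrier H; y \<in> carrier H\<rbrakk> \<Longrightarrow>
      counit H (x \<otimes>\<^bsub>H\<^esub> y) = counit H x \<otimes>\<^bsub>K\<^esub> counit H y"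
    and antipode_linear: "antipode H \<in> linear_maps K H H"
    and antipode_left: "x \<in> carrier H \<Longrightarrow>
      tensor_lift K H (\<lambda>y z. antipode H y \<otimes>\<^bsub>H\<^esub> z) (comult H x) = counit H x \<odot>\<^bsub>H\<^esub> \<one>\<^bsub>H\<^esub>"
    and antipode_right: "x \<in> carrier H \<Longrightarrow>
      tensor_lift K H (\<lambda>y z. y \<otimes>\<^bsub>H\<^esub> antipode H z) (comult H x) = counit H x \<odot>\<^bsub>H\<^esub> \<one>\<^bsub>H\<^esub>"

definition hopf_subalgebra ::
    "('a, 'i) ring_scheme \<Rightarrow> ('a, 'b, 'c) hopf_algebra_scheme \<Rightarrow> 'b set \<Rightarrow> bool" where
  "hopf_subalgebra K H A \<longleftrightarrow> subring A H \<and> subcoalgebra K H A \<and> antipode H ` A \<subseteq> A"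

definition augmentation_part :: "('a, 'i) ring_scheme \<Rightarrow> ('a, 'b, 'c) coalgebra_scheme
      \<Rightarrow> 'b set \<Rightarrow> 'b set" where
  "augmentation_part K H A = {x \<in> carrier H. counit H x = \<zero>\<^bsub>K\<^esub>} \<inter> A"

definition left_ideal :: "'b set \<Rightarrow> ('b, 'j) ring_scheme \<Rightarrow> bool" where
  "left_ideal I R \<longleftrightarrow> additive_subgroup I R \<and> (\<forall>r\<in>carrier R. \<forall>x\<in>I. r \<otimes>\<^bsub>R\<^esub> x \<in> I)"

definition gen_left_ideal :: "('b, 'j) ring_scheme \<Rightarrow> 'b set \<Rightarrow> 'b set" where
  "gen_left_ideal R S = \<Inter>{I. left_ideal I R \<and> S \<subseteq> I}"

end

theory Submission
  imports Defs
begin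

text \<open>Write \<open>C = H/HA\<^sup>+\<close> with projection \<open>\<pi>\<close>. As \<open>H\<close> is cosemisimple, \<open>A\<close> has a complementary
  subcoalgebra \<open>B\<close>; let \<open>q\<close> be the functional equal to the counit on \<open>A\<close> and to zero on \<open>B\<close>. It
  satisfies \<open>q (a h) = \<epsilon> a q h\<close> and \<open>q (h a) = q h \<epsilon> a\<close> for \<open>a\<close> in \<open>A\<close>, so that
  \<open>\<tau> (\<pi> x) (\<pi> y) = q (S x y)\<close> is a well-defined bilinear form on \<open>C\<close>. This form satisfies
  \<open>\<Sum> \<tau> c\<^sub>1 c\<^sub>2 = \<epsilon> c\<close> and \<open>\<Sum> \<tau> c\<^sub>2 d c\<^sub>1 = \<Sum> \<tau> c d\<^sub>1 d\<^sub>2\<close>, i.e. it exhibits \<open>C\<close> as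
  coseparable. Averaging with \<open>\<tau>\<close> turns a linear projection onto a subcoalgebra of \<open>C\<close> into one whose
  kernel is a subcoalgebra; since therefore every subcoalgebra of \<open>C\<close> has a complement, \<open>C\<close> is the
  direct sum of its simple subcoalgebras, as for semisimple modules.\<close>

section \<open>Linear algebra over a field\<close>

text \<open>For A = k 1 the functional q is the Haar integral of H, and q (S x y) is the classical
  form by which a Hopf algebra with a normalized integral is coseparable; the construction here is
  its version relative to A. The obstacle is that B is obtained only as a subcoalgebra: the
  decomposition H = A + B says nothing about products, whereas the form on C has to ignore H A^+ in
  both arguments. The compatibility of q with multiplication by A on either side has to be extracted
  from the antipode. A second difficulty is that subcoalgebras are defined inside a tensor product.
  The dual of a coalgebra acts on it from two sides, and over a field the subcoalgebras are exactly
  the subspaces stable under both actions. This trades tensors for commuting linear maps: a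
  functional equal to the counit on one subcoalgebra and to zero on another acts as the identity on
  the first and as zero on the second.\<close>

definition lsum :: "('b, 'j) ring_scheme \<Rightarrow> 'b list \<Rightarrow> 'b" where
  "lsum M xs = foldr (add M) xs \<zero>\<^bsub>M\<^esub>"

lemma lsum_simps [simp]:
  "lsum M [] = \<zero>\<^bsub>M\<^esub>" "lsum M (x # xs) = x \<oplus>\<^bsub>M\<^esub> lsum M xs"
  by (simp_all add: lsum_def)

context abelian_monoid
begin

lemma lsum_closed [simp, intro]: "set xs \<subseteq> carrier G \<Longrightarrow> lsum G xs \<in> carrier G"
  by (induction xs) auto

lemma lsum_append:
  "\<lbrakk>set xs \<subseteq> carrier G; set ys \<subseteq> carrier G\<rbrakk> \<Longrightarrow> lsum G (xs @ ys) = lsum G xs \<oplus> lsum G ys"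
  by (induction xs) (auto simp: a_assoc)

lemma lsum_map_add:
  assumes "\<And>x. x \<in> set xs \<Longrightarrow> f x \<in> carrier G" "\<And>x. x \<in> set xs \<Longrightarrow> g x \<in> carrier G"
  shows "lsum G (map (\<lambda>x. f x \<oplus> g x) xs) = lsum G (map f xs) \<oplus> lsum G (map g xs)"
  using assms
proof (induction xs)
  case (Cons x xs)
  then have "lsum G (map f xs) \<in> carrier G" "lsum G (map g xs) \<in> carrier G"
    by (auto intro!: lsum_closed)
  with Cons show ?case by (simp add: a_ac)
qed simp

lemma lsum_map_zero:
  "(\<And>x. x \<in> set xs \<Longrightarrow> f x = \<zero>) \<Longrightarrow> lsum G (map f xs) = \<zero>"
  by (induction xs) auto

lemma lsum_swap:
  assumes "\<And>x y. x \<in> set xs \<Longrightarrow> y \<in> set ys \<Longrightarrow> f x y \<in> carrier G"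
  shows "lsum G (map (\<lambda>x. lsum G (map (f x) ys)) xs) = lsum G (map (\<lambda>y. lsum G (map (\<lambda>x. f x y) xs)) ys)"
  using assms
proof (induction xs)
  case Nil
  show ?case by (simp add: lsum_map_zero)
next
  case (Cons x xs)
  have "lsum G (map (\<lambda>y. f x y \<oplus> lsum G (map (\<lambda>x. f x y) xs)) ys)
      = lsum G (map (f x) ys) \<oplus> lsum G (map (\<lambda>y. lsum G (map (\<lambda>x. f x y) xs)) ys)"
    by (rule lsum_map_add) (use Cons.prems in \<open>auto intro!: lsum_closed\<close>)
  with Cons show ?case by simp
qed

end

section \<open>Submodules and spans\<close>

lemma submodule_lsum:
  assumes "module K M" "submodule N K M" "set xs \<subseteq> N"
  shows "lsum M xs \<in> N"
  using assms(3)
proof (induction xs)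
  case Nil
  interpret M: module K M by fact
  interpret N: submodule N K M by fact
  show ?case using N.one_closed by simp
next
  case (Cons x xs)
  interpret M: module K M by fact
  show ?case using Cons M.submoduleE(5)[OF assms(2)] by simp
qed

lemma submodule_zero: "submodule N K M \<Longrightarrow> \<zero>\<^bsub>M\<^esub> \<in> N"
  using subgroup.one_closed[OF submodule.axioms(1)] by fastforce

lemma submodule_add: "submodule N K M \<Longrightarrow> x \<in> N \<Longrightarrow> y \<in> N \<Longrightarrow> x \<oplus>\<^bsub>M\<^esub> y \<in> N"
  using subgroup.m_closed[OF submodule.axioms(1)] by fastforce

lemma submodule_smult: "submodule N K M \<Longrightarrow> a \<in> carrier K \<Longrightarrow> x \<in> N \<Longrightarrow> a \<odot>\<^bsub>M\<^esub> x \<in> N"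
  by (rule submodule.smult_closed)

lemma submodule_subset: "submodule N K M \<Longrightarrow> N \<subseteq> carrier M"
  using subgroup.subset[OF submodule.axioms(1)] by fastforce

lemma submodule_carrier: "submodule N K M \<Longrightarrow> x \<in> N \<Longrightarrow> x \<in> carrier M"
  using submodule_subset by fast

lemma submodule_neg: "module K M \<Longrightarrow> submodule N K M \<Longrightarrow> x \<in> N \<Longrightarrow> \<ominus>\<^bsub>M\<^esub> x \<in> N"
  by (rule module.submoduleE(3))

lemma submodule_minus:
  "module K M \<Longrightarrow> submodule N K M \<Longrightarrow> x \<in> N \<Longrightarrow> y \<in> N \<Longrightarrow> x \<ominus>\<^bsub>M\<^esub> y \<in> N"
  by (simp add: a_minus_def submodule_add submodule_neg)

lemma (in module) neg_smult: "x \<in> carrier M \<Longrightarrow> (\<ominus> \<one>) \<odot>\<^bsub>M\<^esub> x = \<ominus>\<^bsub>M\<^esub> x"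
  by (simp add: smult_l_minus)

text \<open>Negation is multiplication by the scalar -1 (\<open>neg_smult\<close>), so closure under
  inverses follows from closure under scalars.\<close>

lemma (in module) submoduleI':
  assumes "N \<subseteq> carrier M" "\<zero>\<^bsub>M\<^esub> \<in> N"
    and "\<And>x y. \<lbrakk>x \<in> N; y \<in> N\<rbrakk> \<Longrightarrow> x \<oplus>\<^bsub>M\<^esub> y \<in> N"
    and "\<And>a x. \<lbrakk>a \<in> carrier R; x \<in> N\<rbrakk> \<Longrightarrow> a \<odot>\<^bsub>M\<^esub> x \<in> N"
  shows "submodule N R M"
  using assms by (intro submoduleI) (auto simp flip: neg_smult)

lemma (in module) minus_eq_zero_iff:
  "\<lbrakk>x \<in> carrier M; y \<in> carrier M\<rbrakk> \<Longrightarrow> x \<ominus>\<^bsub>M\<^esub> y = \<zero>\<^bsub>M\<^esub> \<longleftrightarrow> x = y"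
  unfolding a_minus_def by (metis M.minus_equality M.minus_minus M.a_inv_closed M.r_neg)

lemma module_span_submodule:
  assumes "module K M" "S \<subseteq> carrier M"
  shows "submodule (module_span K M S) K M"
proof -
  interpret M: module K M by fact
  show ?thesis
    unfolding module_span_def
    by (rule M.submoduleI')
      (use M.carrier_is_submodule assms(2) in
        \<open>auto intro: submodule_zero submodule_add submodule_smult\<close>)
qed

lemma module_span_incl: "S \<subseteq> module_span K M S"
  by (auto simp: module_span_def)

lemma module_span_least: "submodule N K M \<Longrightarrow> S \<subseteq> N \<Longrightarrow> module_span K M S \<subseteq> N"
  by (auto simp: module_span_def)

subsection \<open>Linear and bilinear maps\<close>

lemma linear_mapsI:
  assumes "\<And>x. x \<in> carrier M \<Longrightarrow> f x \<in> carrier N"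
    and "\<And>x y. x \<in> carrier M \<Longrightarrow> y \<in> carrier M \<Longrightarrow> f (x \<oplus>\<^bsub>M\<^esub> y) = f x \<oplus>\<^bsub>N\<^esub> f y"
    and "\<And>a x. a \<in> carrier K \<Longrightarrow> x \<in> carrier M \<Longrightarrow> f (a \<odot>\<^bsub>M\<^esub> x) = a \<odot>\<^bsub>N\<^esub> f x"
  shows "f \<in> linear_maps K M N"
  using assms by (auto simp: linear_maps_def)

lemma linear_closed: "f \<in> linear_maps K M N \<Longrightarrow> x \<in> carrier M \<Longrightarrow> f x \<in> carrier N"
  by (auto simp: linear_maps_def)

lemma linear_add:
  "f \<in> linear_maps K M N \<Longrightarrow> x \<in> carrier M \<Longrightarrow> y \<in> carrier M \<Longrightarrow> f (x \<oplus>\<^bsub>M\<^esub> y) = f x \<oplus>\<^bsub>N\<^esub> f y"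
  by (auto simp: linear_maps_def)

lemma linear_smult:
  "f \<in> linear_maps K M N \<Longrightarrow> a \<in> carrier K \<Longrightarrow> x \<in> carrier M \<Longrightarrow> f (a \<odot>\<^bsub>M\<^esub> x) = a \<odot>\<^bsub>N\<^esub> f x"
  by (auto simp: linear_maps_def)

lemma linear_zero:
  assumes "module K M" "module K N" "f \<in> linear_maps K M N"
  shows "f \<zero>\<^bsub>M\<^esub> = \<zero>\<^bsub>N\<^esub>"
proof -
  interpret M: module K M by fact
  interpret N: module K N by fact
  have "f (\<zero>\<^bsub>K\<^esub> \<odot>\<^bsub>M\<^esub> \<zero>\<^bsub>M\<^esub>) = \<zero>\<^bsub>K\<^esub> \<odot>\<^bsub>N\<^esub> f \<zero>\<^bsub>M\<^esub>"
    by (rule linear_smult[OF assms(3)]) auto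
  then show ?thesis by (simp add: linear_closed[OF assms(3)])
qed

lemma linear_neg:
  assumes "module K M" "module K N" "f \<in> linear_maps K M N" "x \<in> carrier M"
  shows "f (\<ominus>\<^bsub>M\<^esub> x) = \<ominus>\<^bsub>N\<^esub> f x"
proof -
  interpret M: module K M by fact
  interpret N: module K N by fact
  show ?thesis
    using linear_smult[OF assms(3) _ assms(4), of "\<ominus>\<^bsub>K\<^esub> \<one>\<^bsub>K\<^esub>"] assms(4)
    by (simp add: M.neg_smult N.neg_smult linear_closed[OF assms(3)])
qed

lemma linear_minus:
  assumes "module K M" "module K N" "f \<in> linear_maps K M N" "x \<in> carrier M" "y \<in> carrier M"
  shows "f (x \<ominus>\<^bsub>M\<^esub> y) = f x \<ominus>\<^bsub>N\<^esub> f y"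
proof -
  interpret M: module K M by fact
  show ?thesis
    using assms by (simp add: a_minus_def linear_add linear_neg)
qed

lemma linear_lsum:
  assumes "module K M" "module K N" "f \<in> linear_maps K M N" "set xs \<subseteq> carrier M"
  shows "f (lsum M xs) = lsum N (map f xs)"
proof -
  interpret M: module K M by fact
  show ?thesis
    using assms(4) by (induction xs) (auto simp: linear_zero[OF assms(1-3)] linear_add[OF assms(3)])
qed

lemma linear_kernel_submodule:
  assumes "module K M" "module K N" "f \<in> linear_maps K M N" "submodule U K N"
  shows "submodule {x \<in> carrier M. f x \<in> U} K M"
proof -
  interpret M: module K M by fact
  show ?thesis
    by (rule M.submoduleI')
      (use assms in \<open>auto simp: linear_zero linear_add linear_smult
        intro: submodule_zero submodule_add submodule_smult\<close>)
qed

lemma zero_submodule: "module K M \<Longrightarrow> submodule {\<zero>\<^bsub>M\<^esub>} K M"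
proof -
  assume "module K M"
  then interpret M: module K M .
  show ?thesis by (rule M.submoduleI') auto
qed

lemma linear_id: "(\<lambda>x. x) \<in> linear_maps K M M"
  by (auto intro: linear_mapsI)

lemma linear_comp:
  "f \<in> linear_maps K M N \<Longrightarrow> g \<in> linear_maps K L M \<Longrightarrow> (\<lambda>x. f (g x)) \<in> linear_maps K L N"
  by (auto intro!: linear_mapsI simp: linear_closed linear_add linear_smult)

lemma linear_sum:
  assumes "module K N" "f \<in> linear_maps K M N" "g \<in> linear_maps K M N"
  shows "(\<lambda>x. f x \<oplus>\<^bsub>N\<^esub> g x) \<in> linear_maps K M N"
proof -
  interpret N: module K N by fact
  show ?thesis
    using assms(2,3)
    by (intro linear_mapsI)
      (auto simp: linear_maps_def Pi_def N.a_ac N.smult_r_distr)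
qed

lemma linear_const_zero: "module K N \<Longrightarrow> (\<lambda>x. \<zero>\<^bsub>N\<^esub>) \<in> linear_maps K M N"
proof -
  assume "module K N"
  then interpret N: module K N .
  show ?thesis by (auto intro: linear_mapsI)
qed

lemma linear_diff:
  assumes "module K M" "module K N" "f \<in> linear_maps K M N" "g \<in> linear_maps K M N"
  shows "(\<lambda>x. f x \<ominus>\<^bsub>N\<^esub> g x) \<in> linear_maps K M N"
proof -
  interpret N: module K N by fact
  show ?thesis
    using assms(3,4)
    by (intro linear_mapsI)
      (auto simp: linear_closed linear_add linear_smult a_minus_def N.minus_add N.a_ac
        N.smult_r_distr N.smult_r_minus)
qed

lemma linear_lsum_fun:
  assumes "module K N" "\<And>i. i \<in> set is \<Longrightarrow> f i \<in> linear_maps K M N"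
  shows "(\<lambda>x. lsum N (map (\<lambda>i. f i x) is)) \<in> linear_maps K M N"
  using assms(2)
  by (induction "is") (auto intro: linear_const_zero linear_sum assms(1))

lemma linear_cong:
  assumes "f \<in> linear_maps K M N" "module K M" "\<And>x. x \<in> carrier M \<Longrightarrow> g x = f x"
  shows "g \<in> linear_maps K M N"
proof -
  interpret M: module K M by fact
  show ?thesis using assms(1,3) by (auto simp: linear_maps_def)
qed

definition bilinear_maps ::
    "('a, 'i) ring_scheme \<Rightarrow> ('a, 'b, 'j) module_scheme \<Rightarrow> ('a, 'c, 'l) module_scheme
      \<Rightarrow> ('a, 'd, 'm) module_scheme \<Rightarrow> ('b \<Rightarrow> 'c \<Rightarrow> 'd) set" where
  "bilinear_maps K M N P = {\<beta>. (\<forall>x\<in>carrier M. (\<lambda>y. \<beta> x y) \<in> linear_maps K N P) \<and>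
     (\<forall>y\<in>carrier N. (\<lambda>x. \<beta> x y) \<in> linear_maps K M P)}"

lemma bilinear_mapsI:
  assumes "\<And>x. x \<in> carrier M \<Longrightarrow> (\<lambda>y. \<beta> x y) \<in> linear_maps K N P"
    and "\<And>y. y \<in> carrier N \<Longrightarrow> (\<lambda>x. \<beta> x y) \<in> linear_maps K M P"
  shows "\<beta> \<in> bilinear_maps K M N P"
  using assms by (auto simp: bilinear_maps_def)

text \<open>The inner map \<open>g\<close> makes this and \<open>bilinear_left\<close> usable as
  introduction rules: nested multilinear expressions are shown linear in one variable by peeling off
  one operation at a time.\<close>

lemma bilinear_right:
  "\<beta> \<in> bilinear_maps K M N P \<Longrightarrow> x \<in> carrier M \<Longrightarrow> g \<in> linear_maps K L N
    \<Longrightarrow> (\<lambda>y. \<beta> x (g y)) \<in> linear_maps K L P"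
  by (rule linear_comp[of "\<beta> x" K N P]) (auto simp: bilinear_maps_def)

lemma bilinear_left:
  "\<beta> \<in> bilinear_maps K M N P \<Longrightarrow> y \<in> carrier N \<Longrightarrow> g \<in> linear_maps K L M
    \<Longrightarrow> (\<lambda>x. \<beta> (g x) y) \<in> linear_maps K L P"
  by (rule linear_comp[of "\<lambda>x. \<beta> x y" K M P]) (auto simp: bilinear_maps_def)

lemma bilinear_closed:
  "\<beta> \<in> bilinear_maps K M N P \<Longrightarrow> x \<in> carrier M \<Longrightarrow> y \<in> carrier N \<Longrightarrow> \<beta> x y \<in> carrier P"
  by (auto simp: bilinear_maps_def dest: linear_closed)

lemma self_module_simps [simp]:
  "carrier (self_module K) = carrier K" "zero (self_module K) = zero K"
  "add (self_module K) = add K" "smult (self_module K) = mult K"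
  by (simp_all add: self_module_def)

lemma self_module_a_inv [simp]: "a_inv (self_module K) = a_inv K"
  by (rule ext) (simp add: a_inv_def m_inv_def)

lemma self_module_a_minus [simp]: "a_minus (self_module K) = a_minus K"
  by (intro ext) (simp add: a_minus_def)

lemma self_module_finsum [simp]: "finsum (self_module K) = finsum K"
  by (intro ext) (simp add: finsum_def finprod_def)

lemma self_module_lsum [simp]: "lsum (self_module K) = lsum K"
  by (intro ext) (simp add: lsum_def)

lemma (in cring) module_self: "module R (self_module R)"
proof (rule moduleI)
  show "abelian_group (self_module R)"
    by (rule abelian_groupI) (auto simp: a_ac intro!: bexI[of _ "\<ominus> x" for x] l_neg)
qed (auto simp: cring_axioms l_distr r_distr m_assoc)

lemma (in module) submodule_multiples:
  assumes "x \<in> carrier M"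
  shows "submodule {a \<odot>\<^bsub>M\<^esub> x | a. a \<in> carrier R} R M"
proof (rule submoduleI')
  show "{a \<odot>\<^bsub>M\<^esub> x | a. a \<in> carrier R} \<subseteq> carrier M" using assms by auto
  show "\<zero>\<^bsub>M\<^esub> \<in> {a \<odot>\<^bsub>M\<^esub> x | a. a \<in> carrier R}"
    using assms by (auto intro!: exI[of _ "\<zero>"])
next
  fix y z assume "y \<in> {a \<odot>\<^bsub>M\<^esub> x | a. a \<in> carrier R}" "z \<in> {a \<odot>\<^bsub>M\<^esub> x | a. a \<in> carrier R}"
  then show "y \<oplus>\<^bsub>M\<^esub> z \<in> {a \<odot>\<^bsub>M\<^esub> x | a. a \<in> carrier R}"
    using smult_l_distr[OF _ _ assms, symmetric] by blast
next
  fix a y assume "a \<in> carrier R" "y \<in> {a \<odot>\<^bsub>M\<^esub> x | a. a \<in> carrier R}"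
  then show "a \<odot>\<^bsub>M\<^esub> y \<in> {a \<odot>\<^bsub>M\<^esub> x | a. a \<in> carrier R}"
    using smult_assoc1[OF _ _ assms, symmetric] by blast
qed

text \<open>As \<open>S\<close> absorbs scalars, the sums of elements of \<open>S\<close> already
  form a submodule, so coefficients never appear. Both applications, to elementary tensors and to
  unions of submodules, have such an \<open>S\<close>.\<close>

lemma module_span_lsum:
  assumes M: "module K M" and S: "S \<subseteq> carrier M"
    and smult: "\<And>a x. a \<in> carrier K \<Longrightarrow> x \<in> S \<Longrightarrow> a \<odot>\<^bsub>M\<^esub> x \<in> S"
    and x: "x \<in> module_span K M S"
  shows "\<exists>xs. set xs \<subseteq> S \<and> x = lsum M xs"
proof -
  interpret M: module K M by (rule M)
  let ?N = "{lsum M xs | xs. set xs \<subseteq> S}"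
  have "submodule ?N K M"
  proof (rule M.submoduleI')
    show "?N \<subseteq> carrier M" using S by auto
    have "set [] \<subseteq> S" by simp
    then show "\<zero>\<^bsub>M\<^esub> \<in> ?N" by (metis (mono_tags, lifting) CollectI lsum_simps(1))
  next
    fix x y assume "x \<in> ?N" "y \<in> ?N"
    then obtain xs ys where *: "x = lsum M xs" "y = lsum M ys" "set xs \<subseteq> S" "set ys \<subseteq> S" by blast
    then have "x \<oplus>\<^bsub>M\<^esub> y = lsum M (xs @ ys)" using S M.lsum_append[of xs ys] by auto
    moreover have "set (xs @ ys) \<subseteq> S" using * by simp
    ultimately show "x \<oplus>\<^bsub>M\<^esub> y \<in> ?N" by blast
  next
    fix a x assume a: "a \<in> carrier K" and "x \<in> ?N"
    then obtain xs where *: "x = lsum M xs" "set xs \<subseteq> S" by blast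
    have "a \<odot>\<^bsub>M\<^esub> lsum M xs = lsum M (map (\<lambda>x. a \<odot>\<^bsub>M\<^esub> x) xs)"
      using *(2)
    proof (induction xs)
      case (Cons y ys)
      then have "y \<in> carrier M" "lsum M ys \<in> carrier M" using S by auto
      with Cons a show ?case by (simp add: M.smult_r_distr)
    qed (use a in simp)
    moreover have "set (map (\<lambda>x. a \<odot>\<^bsub>M\<^esub> x) xs) \<subseteq> S" using * smult[OF a] by auto
    ultimately show "a \<odot>\<^bsub>M\<^esub> x \<in> ?N" using * by blast
  qed
  moreover have "S \<subseteq> ?N"
  proof
    fix y assume "y \<in> S"
    then have "y = lsum M [y]" "set [y] \<subseteq> S" using S by auto
    then show "y \<in> ?N" by blast
  qed
  ultimately show ?thesis using module_span_least[of ?N K M S] x by blast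
qed

lemma linear_equalizer_submodule:
  assumes "module K M" "module K N" "f \<in> linear_maps K M N" "g \<in> linear_maps K M N"
  shows "submodule {x \<in> carrier M. f x = g x} K M"
proof -
  interpret M: module K M by fact
  show ?thesis
    by (rule M.submoduleI')
      (use assms in \<open>auto simp: linear_zero[OF assms(1,2)] linear_add[OF assms(3)] linear_add[OF assms(4)]
        linear_smult[OF assms(3)] linear_smult[OF assms(4)]\<close>)
qed

lemma smult_linear_right:
  assumes "module K P" "k \<in> carrier K" "g \<in> linear_maps K L P"
  shows "(\<lambda>x. k \<odot>\<^bsub>P\<^esub> g x) \<in> linear_maps K L P"
proof -
  interpret P: module K P by fact
  show ?thesis
    using assms(2,3)
    by (intro linear_mapsI)
      (auto simp: linear_closed linear_add linear_smult P.smult_r_distr P.R.m_comm simp flip: P.smult_assoc1)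
qed

lemma smult_linear_left:
  assumes "module K P" "v \<in> carrier P" "f \<in> linear_maps K L (self_module K)"
  shows "(\<lambda>x. f x \<odot>\<^bsub>P\<^esub> v) \<in> linear_maps K L P"
proof -
  interpret P: module K P by fact
  have "f x \<in> carrier K" if "x \<in> carrier L" for x using linear_closed[OF assms(3) that] by simp
  then show ?thesis
    using assms(2,3)
    by (intro linear_mapsI) (auto simp: linear_add linear_smult P.smult_l_distr P.smult_assoc1)
qed

lemma submodule_finsum:
  assumes "module K M" "submodule N K M" "finite F" "\<And>i. i \<in> F \<Longrightarrow> f i \<in> N"
  shows "(\<Oplus>\<^bsub>M\<^esub>i\<in>F. f i) \<in> N"
proof -
  interpret M: module K M by fact
  have Nc: "x \<in> carrier M" if "x \<in> N" for x by (rule submodule_carrier[OF assms(2) that])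
  show ?thesis
    using assms(3,4)
  proof (induction F)
    case empty
    show ?case using submodule_zero[OF assms(2)] by simp
  next
    case (insert i F)
    then have "f \<in> F \<rightarrow> carrier M" "f i \<in> carrier M" using Nc by auto
    with insert show ?case using submodule_add[OF assms(2)] by simp
  qed
qed

lemma linear_finsum:
  assumes "module K M" "module K N" "h \<in> linear_maps K M N" "finite F" "\<And>i. i \<in> F \<Longrightarrow> f i \<in> carrier M"
  shows "h (\<Oplus>\<^bsub>M\<^esub>i\<in>F. f i) = (\<Oplus>\<^bsub>N\<^esub>i\<in>F. h (f i))"
proof -
  interpret M: module K M by fact
  interpret N: module K N by fact
  show ?thesis
    using assms(4,5)
  proof (induction F)
    case empty
    show ?case using linear_zero[OF assms(1-3)] by simp
  next
    case (insert i F)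
    then have "f \<in> F \<rightarrow> carrier M" "f i \<in> carrier M" by auto
    moreover from this have "(\<lambda>i. h (f i)) \<in> F \<rightarrow> carrier N" "h (f i) \<in> carrier N"
      using linear_closed[OF assms(3)] by auto
    ultimately show ?case using insert by (simp add: linear_add[OF assms(3)])
  qed
qed

lemma submodule_Int:
  assumes "module K M" "submodule U K M" "submodule V K M"
  shows "submodule (U \<inter> V) K M"
proof -
  interpret M: module K M by fact
  show ?thesis
    by (rule M.submoduleI')
      (use submodule_carrier[OF assms(2)] in
        \<open>auto intro: submodule_zero[OF assms(2)] submodule_zero[OF assms(3)] submodule_add[OF assms(2)]
          submodule_add[OF assms(3)] submodule_smult[OF assms(2)] submodule_smult[OF assms(3)]\<close>)
qed

lemma submodule_sum:
  assumes "module K M" "submodule U K M" "submodule V K M"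
  shows "submodule {u \<oplus>\<^bsub>M\<^esub> v | u v. u \<in> U \<and> v \<in> V} K M"
proof -
  interpret M: module K M by fact
  have Uc: "x \<in> carrier M" if "x \<in> U" for x by (rule submodule_carrier[OF assms(2) that])
  have Vc: "x \<in> carrier M" if "x \<in> V" for x by (rule submodule_carrier[OF assms(3) that])
  let ?N = "{u \<oplus>\<^bsub>M\<^esub> v | u v. u \<in> U \<and> v \<in> V}"
  show ?thesis
  proof (rule M.submoduleI')
    show "?N \<subseteq> carrier M" using Uc Vc by auto
    have "\<zero>\<^bsub>M\<^esub> = \<zero>\<^bsub>M\<^esub> \<oplus>\<^bsub>M\<^esub> \<zero>\<^bsub>M\<^esub>" by simp
    then show "\<zero>\<^bsub>M\<^esub> \<in> ?N" using submodule_zero[OF assms(2)] submodule_zero[OF assms(3)] by blast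
  next
    fix x y assume "x \<in> ?N" "y \<in> ?N"
    then obtain u v u' v' where *: "x = u \<oplus>\<^bsub>M\<^esub> v" "y = u' \<oplus>\<^bsub>M\<^esub> v'" "u \<in> U" "u' \<in> U" "v \<in> V" "v' \<in> V"
      by blast
    then have "x \<oplus>\<^bsub>M\<^esub> y = (u \<oplus>\<^bsub>M\<^esub> u') \<oplus>\<^bsub>M\<^esub> (v \<oplus>\<^bsub>M\<^esub> v')" using Uc Vc by (simp add: M.a_ac)
    with submodule_add[OF assms(2) *(3,4)] submodule_add[OF assms(3) *(5,6)]
    show "x \<oplus>\<^bsub>M\<^esub> y \<in> ?N" by blast
  next
    fix a x assume a: "a \<in> carrier K" and "x \<in> ?N"
    then obtain u v where *: "x = u \<oplus>\<^bsub>M\<^esub> v" "u \<in> U" "v \<in> V" by blast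
    then have "a \<odot>\<^bsub>M\<^esub> x = a \<odot>\<^bsub>M\<^esub> u \<oplus>\<^bsub>M\<^esub> a \<odot>\<^bsub>M\<^esub> v" using a Uc Vc by (simp add: M.smult_r_distr)
    with submodule_smult[OF assms(2) a *(2)] submodule_smult[OF assms(3) a *(3)]
    show "a \<odot>\<^bsub>M\<^esub> x \<in> ?N" by blast
  qed
qed

lemma mult_linear_self:
  fixes K (structure)
  assumes "cring K" "k \<in> carrier K" "f \<in> linear_maps K L (self_module K)"
  shows "(\<lambda>x. f x \<otimes> k) \<in> linear_maps K L (self_module K)"
    and "(\<lambda>x. k \<otimes> f x) \<in> linear_maps K L (self_module K)"
  using smult_linear_left[OF cring.module_self[OF assms(1)], of k f L]
    smult_linear_right[OF cring.module_self[OF assms(1)], of k f L] assms(2,3) by simp_all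

subsection \<open>Extension of linear maps\<close>

text \<open>Zorn's lemma for graphs. A partial linear map is a set \<open>G\<close> of pairs closed
  under sums and multiples; for such a set single-valuedness amounts to the condition at zero in
  \<open>good\<close>, which survives unions of chains. A maximal graph has full domain.\<close>

lemma extend_linear_map:
  assumes "field K" and V: "module K V" and W: "module K W" and U: "submodule U K V"
    and f: "f \<in> linear_maps K (V\<lparr>carrier := U\<rparr>) W"
  shows "\<exists>g\<in>linear_maps K V W. \<forall>x\<in>U. g x = f x"
proof -
  interpret K: field K by fact
  interpret V: module K V by fact
  interpret W: module K W by fact
  have f_closed: "f x \<in> carrier W" if "x \<in> U" for x
    using linear_closed[OF f] that by simp
  have f_add: "f (x \<oplus>\<^bsub>V\<^esub> y) = f x \<oplus>\<^bsub>W\<^esub> f y" if "x \<in> U" "y \<in> U" for x y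
    using linear_add[OF f] that by simp
  have f_smult: "f (a \<odot>\<^bsub>V\<^esub> x) = a \<odot>\<^bsub>W\<^esub> f x" if "a \<in> carrier K" "x \<in> U" for a x
    using linear_smult[OF f] that by simp
  have U_carrier: "x \<in> carrier V" if "x \<in> U" for x
    using submodule_carrier[OF U that] .
  define good where "good G \<longleftrightarrow> G \<subseteq> carrier V \<times> carrier W \<and> (\<lambda>x. (x, f x)) ` U \<subseteq> G \<and>
      (\<forall>x w y z. (x, w) \<in> G \<longrightarrow> (y, z) \<in> G \<longrightarrow> (x \<oplus>\<^bsub>V\<^esub> y, w \<oplus>\<^bsub>W\<^esub> z) \<in> G) \<and>
      (\<forall>a x w. a \<in> carrier K \<longrightarrow> (x, w) \<in> G \<longrightarrow> (a \<odot>\<^bsub>V\<^esub> x, a \<odot>\<^bsub>W\<^esub> w) \<in> G) \<and>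
      (\<forall>w. (\<zero>\<^bsub>V\<^esub>, w) \<in> G \<longrightarrow> w = \<zero>\<^bsub>W\<^esub>)" for G
  have f_zero: "f \<zero>\<^bsub>V\<^esub> = \<zero>\<^bsub>W\<^esub>"
    using f_smult[of "\<zero>\<^bsub>K\<^esub>" "\<zero>\<^bsub>V\<^esub>"] f_closed submodule_zero[OF U] by simp
  have "good ((\<lambda>x. (x, f x)) ` U)"
    unfolding good_def
    using f_closed f_add f_smult U_carrier f_zero submodule_add[OF U] submodule_smult[OF U]
    by (auto simp: image_iff)
  then have "{G. good G} \<noteq> {}" by auto
  moreover have "\<Union>C \<in> {G. good G}" if "C \<noteq> {}" and C: "subset.chain {G. good G} C" for C
  proof -
    have good: "good G" if "G \<in> C" for G
      using C that by (auto simp: subset.chain_def)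
    have two: "\<exists>G\<in>C. p \<in> G \<and> q \<in> G" if "p \<in> \<Union>C" "q \<in> \<Union>C" for p q
      using C that unfolding subset_chain_def by blast
    have add: "(x \<oplus>\<^bsub>V\<^esub> y, w \<oplus>\<^bsub>W\<^esub> z) \<in> \<Union>C" if "(x, w) \<in> \<Union>C" "(y, z) \<in> \<Union>C" for x w y z
    proof -
      from two[OF that] obtain G where G: "G \<in> C" "(x, w) \<in> G" "(y, z) \<in> G" by auto
      then have "(x \<oplus>\<^bsub>V\<^esub> y, w \<oplus>\<^bsub>W\<^esub> z) \<in> G" using good[of G] by (auto simp: good_def)
      with G show ?thesis by auto
    qed
    have "\<Union>C \<subseteq> carrier V \<times> carrier W" using good unfolding good_def by blast
    moreover have "(\<lambda>x. (x, f x)) ` U \<subseteq> \<Union>C"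
    proof -
      obtain G where "G \<in> C" using \<open>C \<noteq> {}\<close> by auto
      moreover from this have "(\<lambda>x. (x, f x)) ` U \<subseteq> G" using good[of G] unfolding good_def by blast
      ultimately show ?thesis by blast
    qed
    moreover have "(a \<odot>\<^bsub>V\<^esub> x, a \<odot>\<^bsub>W\<^esub> w) \<in> \<Union>C" if a: "a \<in> carrier K" and "(x, w) \<in> \<Union>C" for a x w
    proof -
      from that obtain G where G: "G \<in> C" "(x, w) \<in> G" by auto
      then have "(a \<odot>\<^bsub>V\<^esub> x, a \<odot>\<^bsub>W\<^esub> w) \<in> G" using a good[of G] by (auto simp: good_def)
      with G show ?thesis by auto
    qed
    moreover have "w = \<zero>\<^bsub>W\<^esub>" if "(\<zero>\<^bsub>V\<^esub>, w) \<in> \<Union>C" for w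
      using that good by (auto simp: good_def)
    ultimately show ?thesis using add unfolding good_def by blast
  qed
  ultimately obtain G where "good G" and max: "\<And>G'. good G' \<Longrightarrow> G \<subseteq> G' \<Longrightarrow> G' = G"
    using subset_Zorn_nonempty[of "{G. good G}"] by auto
  then have G_sub: "G \<subseteq> carrier V \<times> carrier W" and G_f: "(\<lambda>x. (x, f x)) ` U \<subseteq> G"
    and G_add: "\<And>x w y z. (x, w) \<in> G \<Longrightarrow> (y, z) \<in> G \<Longrightarrow> (x \<oplus>\<^bsub>V\<^esub> y, w \<oplus>\<^bsub>W\<^esub> z) \<in> G"
    and G_smult: "\<And>a x w. a \<in> carrier K \<Longrightarrow> (x, w) \<in> G \<Longrightarrow> (a \<odot>\<^bsub>V\<^esub> x, a \<odot>\<^bsub>W\<^esub> w) \<in> G"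
    and G_zero: "\<And>w. (\<zero>\<^bsub>V\<^esub>, w) \<in> G \<Longrightarrow> w = \<zero>\<^bsub>W\<^esub>"
    unfolding good_def by blast+
  have G00: "(\<zero>\<^bsub>V\<^esub>, \<zero>\<^bsub>W\<^esub>) \<in> G"
    using G_f submodule_zero[OF U] f_zero by force
  have total: "\<exists>w. (x, w) \<in> G" if x: "x \<in> carrier V" for x
  proof (rule ccontr)
    assume no: "\<nexists>w. (x, w) \<in> G"
    \<comment> \<open>The extension sends the new vector \<open>x\<close> to zero: the pair
      \<open>(x, 0)\<close> and its multiples are added to \<open>G\<close>.\<close>
    define G' where "G' = {(u \<oplus>\<^bsub>V\<^esub> a \<odot>\<^bsub>V\<^esub> x, w) | u a w. (u, w) \<in> G \<and> a \<in> carrier K}"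
    have G'I: "(u \<oplus>\<^bsub>V\<^esub> a \<odot>\<^bsub>V\<^esub> x, w) \<in> G'" if "(u, w) \<in> G" "a \<in> carrier K" for u a w
      using that by (auto simp: G'_def)
    have GV: "u \<in> carrier V" "w \<in> carrier W" if "(u, w) \<in> G" for u w
      using that G_sub by auto
    have incl: "G \<subseteq> G'"
    proof (rule subrelI)
      fix u w assume "(u, w) \<in> G"
      then show "(u, w) \<in> G'" using G'I[of u w "\<zero>\<^bsub>K\<^esub>"] x GV by simp
    qed
    have "good G'"
      unfolding good_def
    proof (intro conjI allI impI)
      show "G' \<subseteq> carrier V \<times> carrier W" using GV x by (auto simp: G'_def)
      show "(\<lambda>x. (x, f x)) ` U \<subseteq> G'" using incl G_f by blast
    next
      fix y w z v assume "(y, w) \<in> G'" "(z, v) \<in> G'"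
      then obtain u a u' a' where *: "y = u \<oplus>\<^bsub>V\<^esub> a \<odot>\<^bsub>V\<^esub> x" "z = u' \<oplus>\<^bsub>V\<^esub> a' \<odot>\<^bsub>V\<^esub> x"
        "(u, w) \<in> G" "(u', v) \<in> G" "a \<in> carrier K" "a' \<in> carrier K"
        by (auto simp: G'_def)
      then have "y \<oplus>\<^bsub>V\<^esub> z = (u \<oplus>\<^bsub>V\<^esub> u') \<oplus>\<^bsub>V\<^esub> (a \<oplus>\<^bsub>K\<^esub> a') \<odot>\<^bsub>V\<^esub> x"
        using x GV by (simp add: V.smult_l_distr V.a_ac)
      then show "(y \<oplus>\<^bsub>V\<^esub> z, w \<oplus>\<^bsub>W\<^esub> v) \<in> G'"
        using G'I[OF G_add[OF *(3,4)], of "a \<oplus>\<^bsub>K\<^esub> a'"] * by simp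
    next
      fix b y w assume b: "b \<in> carrier K" and "(y, w) \<in> G'"
      then obtain u a where *: "y = u \<oplus>\<^bsub>V\<^esub> a \<odot>\<^bsub>V\<^esub> x" "(u, w) \<in> G" "a \<in> carrier K"
        by (auto simp: G'_def)
      then have "b \<odot>\<^bsub>V\<^esub> y = b \<odot>\<^bsub>V\<^esub> u \<oplus>\<^bsub>V\<^esub> (b \<otimes>\<^bsub>K\<^esub> a) \<odot>\<^bsub>V\<^esub> x"
        using x b GV by (simp add: V.smult_r_distr V.smult_assoc1)
      then show "(b \<odot>\<^bsub>V\<^esub> y, b \<odot>\<^bsub>W\<^esub> w) \<in> G'"
        using G'I[OF G_smult[OF b *(2)], of "b \<otimes>\<^bsub>K\<^esub> a"] * b by simp
    next
      fix w assume "(\<zero>\<^bsub>V\<^esub>, w) \<in> G'"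
      then obtain u a where *: "\<zero>\<^bsub>V\<^esub> = u \<oplus>\<^bsub>V\<^esub> a \<odot>\<^bsub>V\<^esub> x" "(u, w) \<in> G" "a \<in> carrier K"
        by (auto simp: G'_def)
      show "w = \<zero>\<^bsub>W\<^esub>"
      proof (cases "a = \<zero>\<^bsub>K\<^esub>")
        case True
        then show ?thesis using * x GV G_zero by simp
      next
        \<comment> \<open>A non-zero coefficient would make \<open>x\<close> a multiple of
          \<open>u\<close>, which is in the domain of \<open>G\<close> already.\<close>
        case False
        then have a: "inv\<^bsub>K\<^esub> a \<in> carrier K" "inv\<^bsub>K\<^esub> a \<otimes>\<^bsub>K\<^esub> a = \<one>\<^bsub>K\<^esub>"
          using * K.field_Units by auto
        have "a \<odot>\<^bsub>V\<^esub> x = \<ominus>\<^bsub>V\<^esub> u"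
          using * x GV by (metis V.minus_equality V.a_comm V.minus_minus V.smult_closed)
        then have "x = inv\<^bsub>K\<^esub> a \<odot>\<^bsub>V\<^esub> (\<ominus>\<^bsub>V\<^esub> u)"
          using a * x by (metis V.smult_assoc1 V.smult_one)
        also have "\<dots> = (\<ominus>\<^bsub>K\<^esub> (inv\<^bsub>K\<^esub> a)) \<odot>\<^bsub>V\<^esub> u"
          using a GV * by (simp add: V.smult_l_minus V.smult_r_minus)
        finally have "(x, (\<ominus>\<^bsub>K\<^esub> (inv\<^bsub>K\<^esub> a)) \<odot>\<^bsub>W\<^esub> w) \<in> G"
          using G_smult[OF _ *(2), of "\<ominus>\<^bsub>K\<^esub> (inv\<^bsub>K\<^esub> a)"] a by simp
        then show ?thesis using no by blast
      qed
    qed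
    then have "G' = G" using max incl by blast
    moreover have "(x, \<zero>\<^bsub>W\<^esub>) \<in> G'"
      using G'I[OF G00, of "\<one>\<^bsub>K\<^esub>"] x by simp
    ultimately show False using no by blast
  qed
  have unique: "w = v" if "(x, w) \<in> G" "(x, v) \<in> G" for x w v
  proof -
    have c: "x \<in> carrier V" "w \<in> carrier W" "v \<in> carrier W" using that G_sub by auto
    have "(x \<oplus>\<^bsub>V\<^esub> (\<ominus>\<^bsub>K\<^esub> \<one>\<^bsub>K\<^esub>) \<odot>\<^bsub>V\<^esub> x, w \<oplus>\<^bsub>W\<^esub> (\<ominus>\<^bsub>K\<^esub> \<one>\<^bsub>K\<^esub>) \<odot>\<^bsub>W\<^esub> v) \<in> G"
      using that by (intro G_add G_smult) auto
    then have "w \<ominus>\<^bsub>W\<^esub> v = \<zero>\<^bsub>W\<^esub>"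
      using G_zero c by (simp add: V.neg_smult W.neg_smult V.r_neg a_minus_def)
    then show ?thesis using c W.minus_eq_zero_iff by blast
  qed
  define g where "g x = (SOME w. (x, w) \<in> G)" for x
  have g: "(x, g x) \<in> G" if "x \<in> carrier V" for x
    unfolding g_def using total[OF that] by (rule someI_ex)
  have "g \<in> linear_maps K V W"
  proof (rule linear_mapsI)
    fix x y assume xy: "x \<in> carrier V" "y \<in> carrier V"
    show "g (x \<oplus>\<^bsub>V\<^esub> y) = g x \<oplus>\<^bsub>W\<^esub> g y"
      using xy by (intro unique[OF g G_add[OF g g]]) auto
  next
    fix a x assume "a \<in> carrier K" "x \<in> carrier V"
    then show "g (a \<odot>\<^bsub>V\<^esub> x) = a \<odot>\<^bsub>W\<^esub> g x"
      by (intro unique[OF g G_smult[OF _ g]]) auto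
  qed (use g G_sub in auto)
  moreover have "g x = f x" if "x \<in> U" for x
    using unique[OF g[OF U_carrier[OF that]]] G_f that by blast
  ultimately show ?thesis by blast
qed

text \<open>The identity of \<open>U\<close> is extended to \<open>V\<close> as a map into the
  module \<open>U\<close> itself, which forces all values of the extension into
  \<open>U\<close>.\<close>

lemma linear_projection_exists:
  assumes "field K" "module K V" "submodule U K V"
  shows "\<exists>r\<in>linear_maps K V V. (\<forall>x\<in>carrier V. r x \<in> U) \<and> (\<forall>x\<in>U. r x = x)"
proof -
  interpret V: module K V by fact
  have m: "module K (V\<lparr>carrier := U\<rparr>)"
    using submodule.submodule_is_module[OF assms(3,2)] .
  have "(\<lambda>x. x) \<in> linear_maps K (V\<lparr>carrier := U\<rparr>) (V\<lparr>carrier := U\<rparr>)"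
    by (rule linear_id)
  then obtain r where r: "r \<in> linear_maps K V (V\<lparr>carrier := U\<rparr>)" "\<forall>x\<in>U. r x = x"
    using extend_linear_map[OF assms(1,2) m assms(3)] by blast
  then have "r \<in> linear_maps K V V" "\<forall>x\<in>carrier V. r x \<in> U"
    using submodule_subset[OF assms(3)] by (auto simp: linear_maps_def)
  with r show ?thesis by blast
qed

text \<open>On \<open>U + W\<close> the functional is \<open>h\<close> after the projection to
  \<open>W\<close> along \<open>U\<close>; the rest is extension. Every functional that separates
  two subcoalgebras below comes from here, with \<open>h\<close> the counit.\<close>

lemma functional_on_disjoint_sum:
  assumes "field K" "module K V" "submodule U K V" "submodule W K V" "U \<inter> W = {\<zero>\<^bsub>V\<^esub>}"
    and h: "h \<in> linear_maps K V (self_module K)"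
  shows "\<exists>g\<in>linear_maps K V (self_module K). (\<forall>x\<in>U. g x = \<zero>\<^bsub>K\<^esub>) \<and> (\<forall>x\<in>W. g x = h x)"
proof -
  interpret K: field K by fact
  interpret V: module K V by fact
  have Uc: "x \<in> carrier V" if "x \<in> U" for x using submodule_carrier[OF assms(3) that] .
  have Wc: "x \<in> carrier V" if "x \<in> W" for x using submodule_carrier[OF assms(4) that] .
  define S where "S = {x \<oplus>\<^bsub>V\<^esub> y | x y. x \<in> U \<and> y \<in> W}"
  have S: "submodule S K V"
    unfolding S_def by (rule submodule_sum[OF assms(2-4)])
  have uniq: "w = w'" if "u \<oplus>\<^bsub>V\<^esub> w = u' \<oplus>\<^bsub>V\<^esub> w'" "u \<in> U" "u' \<in> U" "w \<in> W" "w' \<in> W" for u u' w w'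
  proof -
    have "u' \<oplus>\<^bsub>V\<^esub> (w' \<ominus>\<^bsub>V\<^esub> w) = u"
      using that Uc Wc unfolding a_minus_def
      by (metis V.a_assoc V.a_inv_closed V.r_neg V.r_zero)
    then have "w' \<ominus>\<^bsub>V\<^esub> w = u \<ominus>\<^bsub>V\<^esub> u'"
      using that Uc Wc
      by (smt (verit) V.a_comm V.a_assoc V.minus_closed V.r_neg V.r_zero V.a_inv_closed a_minus_def)
    then have "w' \<ominus>\<^bsub>V\<^esub> w \<in> U \<inter> W"
      using submodule_minus[OF assms(2,3) that(2,3)] submodule_minus[OF assms(2,4) that(5,4)] by simp
    then show ?thesis using assms(5) that Wc V.minus_eq_zero_iff by auto
  qed
  define f where "f s = h (THE w. w \<in> W \<and> (\<exists>u\<in>U. s = u \<oplus>\<^bsub>V\<^esub> w))" for s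
  have f: "f (u \<oplus>\<^bsub>V\<^esub> w) = h w" if "u \<in> U" "w \<in> W" for u w
    unfolding f_def by (rule arg_cong[where f = h], rule the_equality) (use that uniq in blast)+
  have "f \<in> linear_maps K (V\<lparr>carrier := S\<rparr>) (self_module K)"
  proof (rule linear_mapsI)
    fix x assume "x \<in> carrier (V\<lparr>carrier := S\<rparr>)"
    then obtain u w where *: "x = u \<oplus>\<^bsub>V\<^esub> w" "u \<in> U" "w \<in> W" by (auto simp: S_def)
    then show "f x \<in> carrier (self_module K)" using f Wc linear_closed[OF h] by simp
  next
    fix x y assume "x \<in> carrier (V\<lparr>carrier := S\<rparr>)" "y \<in> carrier (V\<lparr>carrier := S\<rparr>)"
    then obtain u w u' w' where *: "x = u \<oplus>\<^bsub>V\<^esub> w" "y = u' \<oplus>\<^bsub>V\<^esub> w'" "u \<in> U" "u' \<in> U" "w \<in> W" "w' \<in> W"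
      by (auto simp: S_def)
    then have "x \<oplus>\<^bsub>V\<^esub> y = (u \<oplus>\<^bsub>V\<^esub> u') \<oplus>\<^bsub>V\<^esub> (w \<oplus>\<^bsub>V\<^esub> w')"
      using Uc Wc by (simp add: V.a_ac)
    then have "f (x \<oplus>\<^bsub>V\<^esub> y) = h (w \<oplus>\<^bsub>V\<^esub> w')"
      using f[OF submodule_add[OF assms(3) *(3,4)] submodule_add[OF assms(4) *(5,6)]] by simp
    then show "f (x \<oplus>\<^bsub>V\<lparr>carrier := S\<rparr>\<^esub> y) = f x \<oplus>\<^bsub>self_module K\<^esub> f y"
      using * f Wc linear_add[OF h] by simp
  next
    fix a x assume a: "a \<in> carrier K" and "x \<in> carrier (V\<lparr>carrier := S\<rparr>)"
    then obtain u w where *: "x = u \<oplus>\<^bsub>V\<^esub> w" "u \<in> U" "w \<in> W" by (auto simp: S_def)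
    then have "a \<odot>\<^bsub>V\<^esub> x = a \<odot>\<^bsub>V\<^esub> u \<oplus>\<^bsub>V\<^esub> a \<odot>\<^bsub>V\<^esub> w"
      using a Uc Wc by (simp add: V.smult_r_distr)
    then have "f (a \<odot>\<^bsub>V\<^esub> x) = h (a \<odot>\<^bsub>V\<^esub> w)"
      using f[OF submodule_smult[OF assms(3) a *(2)] submodule_smult[OF assms(4) a *(3)]] by simp
    then show "f (a \<odot>\<^bsub>V\<lparr>carrier := S\<rparr>\<^esub> x) = a \<odot>\<^bsub>self_module K\<^esub> f x"
      using * f Wc a linear_smult[OF h] by simp
  qed
  then obtain g where g: "g \<in> linear_maps K V (self_module K)" "\<forall>x\<in>S. g x = f x"
    using extend_linear_map[OF assms(1,2) K.module_self S] by blast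
  have "g x = \<zero>\<^bsub>K\<^esub>" if "x \<in> U" for x
  proof -
    have x: "x = x \<oplus>\<^bsub>V\<^esub> \<zero>\<^bsub>V\<^esub>" using that Uc by simp
    then have "x \<in> S" using that submodule_zero[OF assms(4)] unfolding S_def by blast
    moreover have "f x = h \<zero>\<^bsub>V\<^esub>" using f[OF that submodule_zero[OF assms(4)]] x by simp
    ultimately show ?thesis using g linear_zero[OF assms(2) K.module_self h] by simp
  qed
  moreover have "g x = h x" if "x \<in> W" for x
  proof -
    have x: "x = \<zero>\<^bsub>V\<^esub> \<oplus>\<^bsub>V\<^esub> x" using that Wc by simp
    then have "x \<in> S" using that submodule_zero[OF assms(3)] unfolding S_def by blast
    moreover have "f x = h x" using f[OF submodule_zero[OF assms(3)] that] x by simp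
    ultimately show ?thesis using g by simp
  qed
  ultimately show ?thesis using g by blast
qed

text \<open>The line through \<open>x\<close> meets \<open>X\<close> only in zero, so
  \<open>functional_on_disjoint_sum\<close> applies to \<open>X\<close> and this line, with the
  coordinate along \<open>x\<close> as functional on the line.\<close>

lemma separating_functional:
  assumes "field K" "module K V" "submodule X K V" "x \<in> carrier V" "x \<notin> X"
  shows "\<exists>g\<in>linear_maps K V (self_module K). (\<forall>u\<in>X. g u = \<zero>\<^bsub>K\<^esub>) \<and> g x = \<one>\<^bsub>K\<^esub>"
proof -
  interpret K: field K by fact
  interpret V: module K V by fact
  define S where "S = {a \<odot>\<^bsub>V\<^esub> x | a. a \<in> carrier K}"
  have S: "submodule S K V"
    unfolding S_def by (rule V.submodule_multiples[OF assms(4)])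
  have scal: "b \<odot>\<^bsub>V\<^esub> x \<notin> X" if b: "b \<in> carrier K" "b \<noteq> \<zero>\<^bsub>K\<^esub>" for b
  proof
    assume "b \<odot>\<^bsub>V\<^esub> x \<in> X"
    moreover have "inv\<^bsub>K\<^esub> b \<in> carrier K" "inv\<^bsub>K\<^esub> b \<otimes>\<^bsub>K\<^esub> b = \<one>\<^bsub>K\<^esub>"
      using b K.field_Units by auto
    ultimately have "x \<in> X"
      using submodule_smult[OF assms(3), of "inv\<^bsub>K\<^esub> b"] b assms(4)
      by (metis V.smult_assoc1 V.smult_one)
    with assms(5) show False ..
  qed
  have inj: "a = b" if "a \<odot>\<^bsub>V\<^esub> x = b \<odot>\<^bsub>V\<^esub> x" "a \<in> carrier K" "b \<in> carrier K" for a b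
  proof -
    have "(a \<ominus>\<^bsub>K\<^esub> b) \<odot>\<^bsub>V\<^esub> x = \<zero>\<^bsub>V\<^esub>"
      using that assms(4) by (simp add: a_minus_def V.smult_l_distr V.smult_l_minus V.r_neg)
    then have "a \<ominus>\<^bsub>K\<^esub> b = \<zero>\<^bsub>K\<^esub>"
      using scal[of "a \<ominus>\<^bsub>K\<^esub> b"] that submodule_zero[OF assms(3)] by auto
    then show ?thesis using that by simp
  qed
  define c where "c y = (THE a. a \<in> carrier K \<and> y = a \<odot>\<^bsub>V\<^esub> x)" for y
  have c: "c (a \<odot>\<^bsub>V\<^esub> x) = a" if "a \<in> carrier K" for a
    unfolding c_def using that inj by blast
  have "c \<in> linear_maps K (V\<lparr>carrier := S\<rparr>) (self_module K)"
    by (rule linear_mapsI)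
      (auto simp: S_def c assms(4) simp flip: V.smult_l_distr V.smult_assoc1)
  then obtain h where h: "h \<in> linear_maps K V (self_module K)" "\<forall>y\<in>S. h y = c y"
    using extend_linear_map[OF assms(1,2) K.module_self S] by blast
  have "X \<inter> S = {\<zero>\<^bsub>V\<^esub>}"
  proof
    show "X \<inter> S \<subseteq> {\<zero>\<^bsub>V\<^esub>}" using scal assms(4) unfolding S_def by auto (metis V.smult_l_null)
  qed (use submodule_zero[OF S] submodule_zero[OF assms(3)] in auto)
  then obtain g where g: "g \<in> linear_maps K V (self_module K)"
      "\<forall>u\<in>X. g u = \<zero>\<^bsub>K\<^esub>" "\<forall>y\<in>S. g y = h y"
    using functional_on_disjoint_sum[OF assms(1-3) S _ h(1)] by blast
  have "\<one>\<^bsub>K\<^esub> \<odot>\<^bsub>V\<^esub> x \<in> S" unfolding S_def by blast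
  then have "g x = \<one>\<^bsub>K\<^esub>"
    using g(3) h(2) c[of "\<one>\<^bsub>K\<^esub>"] assms(4) by simp
  with g show ?thesis by blast
qed

subsection \<open>Quotient modules\<close>

text \<open>Operations on cosets are defined by applying a formula to the whole coset and taking the
  only value; this evaluates them once the formula is known to be constant there.\<close>

lemma the_elem_image_eq: "X \<noteq> {} \<Longrightarrow> (\<And>x. x \<in> X \<Longrightarrow> f x = c) \<Longrightarrow> the_elem (f ` X) = c"
  by (simp add: the_elem_image_unique image_constant_conv)

context
  fixes K :: "('a, 'i) ring_scheme" and M :: "('a, 'b, 'j) module_scheme" and N
  assumes M: "module K M" and N: "submodule N K M"
begin

interpretation M: module K M by (rule M)
interpretation N: abelian_subgroup N M
  by (rule abelian_subgroupI3)
    (auto simp: additive_subgroup_def submodule.axioms(1)[OF N] M.abelian_group_axioms)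

abbreviation (input) "proj x \<equiv> N +>\<^bsub>M\<^esub> x"

lemma coset_self: "x \<in> carrier M \<Longrightarrow> x \<in> proj x"
  by (rule N.a_rcos_self)

lemma coset_mem_iff: "x \<in> carrier M \<Longrightarrow> y \<in> proj x \<longleftrightarrow> y \<in> carrier M \<and> y \<ominus>\<^bsub>M\<^esub> x \<in> N"
  using N.a_rcos_module[of x y] N.a_elemrcos_carrier[of x y] by (auto simp: a_minus_def)

lemma coset_eq_iff: "x \<in> carrier M \<Longrightarrow> y \<in> carrier M \<Longrightarrow> proj x = proj y \<longleftrightarrow> x \<ominus>\<^bsub>M\<^esub> y \<in> N"
  using coset_mem_iff[of y x] coset_self[of x] N.a_repr_independence'[of x y] by blast

lemma quotient_carrier: "carrier (quotient_module K M N) = proj ` carrier M"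
  by (auto simp: quotient_module_def A_RCOSETS_def')

lemma quotient_zero: "zero (quotient_module K M N) = N"
  by (simp add: quotient_module_def)

lemma quotient_zero_coset: "zero (quotient_module K M N) = proj \<zero>\<^bsub>M\<^esub>"
  using N.a_rcos_const[of "\<zero>\<^bsub>M\<^esub>"] submodule_zero[OF N] by (simp add: quotient_zero)

lemma quotient_add:
  "x \<in> carrier M \<Longrightarrow> y \<in> carrier M \<Longrightarrow> proj x \<oplus>\<^bsub>quotient_module K M N\<^esub> proj y = proj (x \<oplus>\<^bsub>M\<^esub> y)"
  by (simp add: quotient_module_def N.a_rcos_sum)

lemma quotient_smult:
  assumes "a \<in> carrier K" "x \<in> carrier M"
  shows "a \<odot>\<^bsub>quotient_module K M N\<^esub> proj x = proj (a \<odot>\<^bsub>M\<^esub> x)"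
proof -
  have "the_elem ((\<lambda>x. proj (a \<odot>\<^bsub>M\<^esub> x)) ` proj x) = proj (a \<odot>\<^bsub>M\<^esub> x)"
  proof (rule the_elem_image_eq)
    show "proj x \<noteq> {}" using coset_self assms by blast
    fix y assume "y \<in> proj x"
    then have y: "y \<in> carrier M" "y \<ominus>\<^bsub>M\<^esub> x \<in> N" using coset_mem_iff assms by blast+
    have "a \<odot>\<^bsub>M\<^esub> y \<ominus>\<^bsub>M\<^esub> a \<odot>\<^bsub>M\<^esub> x = a \<odot>\<^bsub>M\<^esub> (y \<ominus>\<^bsub>M\<^esub> x)"
      using assms y by (simp add: a_minus_def M.smult_r_distr M.smult_r_minus)
    with y assms submodule_smult[OF N] show "proj (a \<odot>\<^bsub>M\<^esub> y) = proj (a \<odot>\<^bsub>M\<^esub> x)"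
      by (simp add: coset_eq_iff)
  qed
  then show ?thesis by (simp add: quotient_module_def)
qed

lemma quotient_is_module: "module K (quotient_module K M N)"
proof (rule moduleI)
  let ?Q = "quotient_module K M N"
  show "abelian_group ?Q"
  proof (rule abelian_groupI)
    fix X assume "X \<in> carrier ?Q"
    then obtain x where "X = proj x" "x \<in> carrier M" by (auto simp: quotient_carrier)
    then show "\<exists>Y\<in>carrier ?Q. Y \<oplus>\<^bsub>?Q\<^esub> X = \<zero>\<^bsub>?Q\<^esub>"
      by (auto simp: quotient_zero_coset quotient_carrier quotient_add M.l_neg
          intro!: bexI[of _ "\<ominus>\<^bsub>M\<^esub> x"])
  qed (auto simp: quotient_carrier quotient_zero_coset quotient_add M.a_ac)
qed (auto simp: M.R.cring_axioms quotient_carrier quotient_add quotient_smult M.smult_l_distr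
      M.smult_r_distr M.smult_assoc1)

lemma quotient_proj_linear: "proj \<in> linear_maps K M (quotient_module K M N)"
  by (rule linear_mapsI) (auto simp: quotient_carrier quotient_add quotient_smult)

lemma quotient_proj_zero: "x \<in> N \<Longrightarrow> proj x = \<zero>\<^bsub>quotient_module K M N\<^esub>"
  by (simp add: N.a_rcos_const quotient_zero)

end

section \<open>Tensor products\<close>

lemma free_module_simps [simp]:
  "zero (free_module K X) = (\<lambda>_. \<zero>\<^bsub>K\<^esub>)"
  "add (free_module K X) = (\<lambda>f g x. f x \<oplus>\<^bsub>K\<^esub> g x)"
  "smult (free_module K X) = (\<lambda>a f x. a \<otimes>\<^bsub>K\<^esub> f x)"
  by (simp_all add: free_module_def)

lemma free_module_carrier:
  "f \<in> carrier (free_module K X) \<longleftrightarrow> (\<forall>x. f x \<in> carrier K) \<and> {x. f x \<noteq> \<zero>\<^bsub>K\<^esub>} \<subseteq> X \<and> finite {x. f x \<noteq> \<zero>\<^bsub>K\<^esub>}"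
  by (simp add: free_module_def)

text \<open>The linear extension of \<open>b\<close> to formal sums; \<open>tensor_lift\<close> is
  its common value on a coset.\<close>

definition free_lift ::
    "('a, 'i) ring_scheme \<Rightarrow> ('a, 'd, 'm) module_scheme \<Rightarrow> ('x \<Rightarrow> 'd) \<Rightarrow> ('x \<Rightarrow> 'a) \<Rightarrow> 'd" where
  "free_lift K P b t = (\<Oplus>\<^bsub>P\<^esub>p\<in>{p. t p \<noteq> \<zero>\<^bsub>K\<^esub>}. t p \<odot>\<^bsub>P\<^esub> b p)"

context cring
begin

lemma free_module_is_module: "module R (free_module R X)"
proof (rule moduleI)
  show "abelian_group (free_module R X)"
  proof (rule abelian_groupI)
    fix f g assume f: "f \<in> carrier (free_module R X)" and g: "g \<in> carrier (free_module R X)"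
    have "{x. f x \<oplus> g x \<noteq> \<zero>} \<subseteq> {x. f x \<noteq> \<zero>} \<union> {x. g x \<noteq> \<zero>}" by auto
    then show "f \<oplus>\<^bsub>free_module R X\<^esub> g \<in> carrier (free_module R X)"
      using f g finite_subset[of "{x. f x \<oplus> g x \<noteq> \<zero>}" "{x. f x \<noteq> \<zero>} \<union> {x. g x \<noteq> \<zero>}"]
      by (auto simp: free_module_carrier)
  next
    fix f assume f: "f \<in> carrier (free_module R X)"
    have "{x. \<ominus> f x \<noteq> \<zero>} \<subseteq> {x. f x \<noteq> \<zero>}" by auto
    then have "(\<lambda>x. \<ominus> f x) \<in> carrier (free_module R X)"
      using f finite_subset[of "{x. \<ominus> f x \<noteq> \<zero>}" "{x. f x \<noteq> \<zero>}"]
      by (auto simp: free_module_carrier)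
    then show "\<exists>g\<in>carrier (free_module R X). g \<oplus>\<^bsub>free_module R X\<^esub> f = \<zero>\<^bsub>free_module R X\<^esub>"
      using f by (auto simp: free_module_carrier l_neg intro!: bexI[of _ "\<lambda>x. \<ominus> f x"])
  qed (auto simp: free_module_carrier a_ac)
next
  fix a f assume a: "a \<in> carrier R" and f: "f \<in> carrier (free_module R X)"
  have "{x. a \<otimes> f x \<noteq> \<zero>} \<subseteq> {x. f x \<noteq> \<zero>}" using a by auto
  then show "a \<odot>\<^bsub>free_module R X\<^esub> f \<in> carrier (free_module R X)"
    using a f finite_subset[of "{x. a \<otimes> f x \<noteq> \<zero>}" "{x. f x \<noteq> \<zero>}"]
    by (auto simp: free_module_carrier)
qed (auto simp: free_module_carrier cring_axioms l_distr r_distr m_assoc)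

lemma free_gen_carrier: "x \<in> X \<Longrightarrow> free_gen R x \<in> carrier (free_module R X)"
  by (auto simp: free_module_carrier free_gen_def)

context
  fixes P :: "('a, 'd, 'm) module_scheme" and b :: "'x \<Rightarrow> 'd" and X
  assumes P: "module R P" and b: "b \<in> X \<rightarrow> carrier P"
begin

interpretation P: module R P by (rule P)

text \<open>Formal sums with different supports become comparable once they are summed over a common
  finite set.\<close>

lemma free_lift_superset:
  assumes "t \<in> carrier (free_module R X)" "{x. t x \<noteq> \<zero>} \<subseteq> A" "finite A" "A \<subseteq> X"
  shows "free_lift R P b t = (\<Oplus>\<^bsub>P\<^esub>p\<in>A. t p \<odot>\<^bsub>P\<^esub> b p)"
  unfolding free_lift_def
  by (rule P.add.finprod_mono_neutral_cong)
    (use assms b in \<open>auto simp: free_module_carrier Pi_def subset_eq\<close>)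

lemma free_lift_linear: "free_lift R P b \<in> linear_maps R (free_module R X) P"
proof (rule linear_mapsI)
  fix t assume t: "t \<in> carrier (free_module R X)"
  then show "free_lift R P b t \<in> carrier P"
    unfolding free_lift_def using b
    by (intro P.finsum_closed) (auto simp: free_module_carrier Pi_def subset_eq)
next
  fix t s assume t: "t \<in> carrier (free_module R X)" and s: "s \<in> carrier (free_module R X)"
  interpret F: module R "free_module R X" by (rule free_module_is_module)
  let ?A = "{x. t x \<noteq> \<zero>} \<union> {x. s x \<noteq> \<zero>}"
  have A: "finite ?A" "?A \<subseteq> X" using t s by (auto simp: free_module_carrier)
  have c: "t p \<in> carrier R" "s p \<in> carrier R" for p using t s by (auto simp: free_module_carrier)
  have bA: "p \<in> ?A \<Longrightarrow> b p \<in> carrier P" for p using A b by (auto simp: Pi_def subset_eq)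
  have ts: "t \<oplus>\<^bsub>free_module R X\<^esub> s \<in> carrier (free_module R X)" using t s by (rule F.a_closed)
  have "free_lift R P b (t \<oplus>\<^bsub>free_module R X\<^esub> s) = (\<Oplus>\<^bsub>P\<^esub>p\<in>?A. (t p \<oplus> s p) \<odot>\<^bsub>P\<^esub> b p)"
    by (subst free_lift_superset[OF ts _ A]) auto
  also have "\<dots> = (\<Oplus>\<^bsub>P\<^esub>p\<in>?A. t p \<odot>\<^bsub>P\<^esub> b p \<oplus>\<^bsub>P\<^esub> s p \<odot>\<^bsub>P\<^esub> b p)"
    by (rule P.add.finprod_cong') (use bA c in \<open>auto simp: P.smult_l_distr\<close>)
  also have "\<dots> = (\<Oplus>\<^bsub>P\<^esub>p\<in>?A. t p \<odot>\<^bsub>P\<^esub> b p) \<oplus>\<^bsub>P\<^esub> (\<Oplus>\<^bsub>P\<^esub>p\<in>?A. s p \<odot>\<^bsub>P\<^esub> b p)"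
    by (rule P.finsum_addf) (use bA c in auto)
  also have "\<dots> = free_lift R P b t \<oplus>\<^bsub>P\<^esub> free_lift R P b s"
    using free_lift_superset[OF t _ A] free_lift_superset[OF s _ A] by simp
  finally show "free_lift R P b (t \<oplus>\<^bsub>free_module R X\<^esub> s) = free_lift R P b t \<oplus>\<^bsub>P\<^esub> free_lift R P b s" .
next
  fix a t assume a: "a \<in> carrier R" and t: "t \<in> carrier (free_module R X)"
  interpret F: module R "free_module R X" by (rule free_module_is_module)
  let ?A = "{x. t x \<noteq> \<zero>}"
  have A: "finite ?A" "?A \<subseteq> X" using t by (auto simp: free_module_carrier)
  have c: "t p \<in> carrier R" for p using t by (auto simp: free_module_carrier)
  have bA: "p \<in> ?A \<Longrightarrow> b p \<in> carrier P" for p using A b by (auto simp: Pi_def subset_eq)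
  have at: "a \<odot>\<^bsub>free_module R X\<^esub> t \<in> carrier (free_module R X)" using a t by (rule F.smult_closed)
  have "free_lift R P b (a \<odot>\<^bsub>free_module R X\<^esub> t) = (\<Oplus>\<^bsub>P\<^esub>p\<in>?A. (a \<otimes> t p) \<odot>\<^bsub>P\<^esub> b p)"
    by (subst free_lift_superset[OF at _ A]) (use a in auto)
  also have "\<dots> = (\<Oplus>\<^bsub>P\<^esub>p\<in>?A. a \<odot>\<^bsub>P\<^esub> (t p \<odot>\<^bsub>P\<^esub> b p))"
    by (rule P.add.finprod_cong') (use bA c a in \<open>auto simp: P.smult_assoc1\<close>)
  also have "\<dots> = a \<odot>\<^bsub>P\<^esub> (\<Oplus>\<^bsub>P\<^esub>p\<in>?A. t p \<odot>\<^bsub>P\<^esub> b p)"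
    by (rule P.finsum_smult_ldistr[symmetric]) (use A a bA c in auto)
  finally show "free_lift R P b (a \<odot>\<^bsub>free_module R X\<^esub> t) = a \<odot>\<^bsub>P\<^esub> free_lift R P b t"
    by (simp add: free_lift_def)
qed

lemma free_lift_gen:
  assumes "x \<in> X"
  shows "free_lift R P b (free_gen R x) = b x"
proof -
  have "free_lift R P b (free_gen R x) = (\<Oplus>\<^bsub>P\<^esub>p\<in>{x}. free_gen R x p \<odot>\<^bsub>P\<^esub> b p)"
    by (rule free_lift_superset) (use assms free_gen_carrier[OF assms] in \<open>auto simp: free_gen_def split: if_splits\<close>)
  then show ?thesis using assms b by (auto simp: free_gen_def Pi_def)
qed

end

end

text \<open>A list, and not a set, of pairs, as the same elementary tensor may have to occur several
  times.\<close>

definition tensor_sum ::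
    "('a, 'i) ring_scheme \<Rightarrow> ('a, 'b, 'j) module_scheme \<Rightarrow> ('a, 'c, 'l) module_scheme
      \<Rightarrow> ('b \<times> 'c) list \<Rightarrow> ('b \<times> 'c \<Rightarrow> 'a) set" where
  "tensor_sum K M N xs = lsum (tensor K M N) (map (\<lambda>(x, y). tensor_elem K M N x y) xs)"

section \<open>The universal property of the tensor product\<close>

context
  fixes K :: "('a, 'i) ring_scheme"
    and M :: "('a, 'b, 'j) module_scheme" and N :: "('a, 'c, 'l) module_scheme"
  assumes M: "module K M" and N: "module K N"
begin

interpretation M: module K M by (rule M)
interpretation N: module K N by (rule N)

private abbreviation (input) "F \<equiv> free_module K (carrier M \<times> carrier N)"

interpretation F: module K F by (rule M.R.free_module_is_module)

lemma free_gen_pair: "x \<in> carrier M \<Longrightarrow> y \<in> carrier N \<Longrightarrow> free_gen K (x, y) \<in> carrier F"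
  by (rule M.R.free_gen_carrier) simp

lemma tensor_relations_submodule: "submodule (tensor_relations K M N) K F"
  unfolding tensor_relations_def Let_def
  by (rule module_span_submodule[OF F.module_axioms]; (intro Un_least subsetI; elim CollectE exE conjE)?)
    (simp_all only:, auto simp del: free_module_simps intro!: F.minus_closed F.a_closed F.smult_closed free_gen_pair)

lemma tensor_module: "module K (tensor K M N)"
  unfolding tensor_def by (rule quotient_is_module[OF F.module_axioms tensor_relations_submodule])

private lemma relations:
  shows rel_add_left: "\<lbrakk>x \<in> carrier M; x' \<in> carrier M; y \<in> carrier N\<rbrakk> \<Longrightarrow>
      free_gen K (x \<oplus>\<^bsub>M\<^esub> x', y) \<ominus>\<^bsub>F\<^esub> (free_gen K (x, y) \<oplus>\<^bsub>F\<^esub> free_gen K (x', y)) \<in> tensor_relations K M N"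
    and rel_add_right: "\<lbrakk>x \<in> carrier M; y \<in> carrier N; y' \<in> carrier N\<rbrakk> \<Longrightarrow>
      free_gen K (x, y \<oplus>\<^bsub>N\<^esub> y') \<ominus>\<^bsub>F\<^esub> (free_gen K (x, y) \<oplus>\<^bsub>F\<^esub> free_gen K (x, y')) \<in> tensor_relations K M N"
    and rel_smult_left: "\<lbrakk>a \<in> carrier K; x \<in> carrier M; y \<in> carrier N\<rbrakk> \<Longrightarrow>
      free_gen K (a \<odot>\<^bsub>M\<^esub> x, y) \<ominus>\<^bsub>F\<^esub> (a \<odot>\<^bsub>F\<^esub> free_gen K (x, y)) \<in> tensor_relations K M N"
    and rel_smult_right: "\<lbrakk>a \<in> carrier K; x \<in> carrier M; y \<in> carrier N\<rbrakk> \<Longrightarrow>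
      free_gen K (x, a \<odot>\<^bsub>N\<^esub> y) \<ominus>\<^bsub>F\<^esub> (a \<odot>\<^bsub>F\<^esub> free_gen K (x, y)) \<in> tensor_relations K M N"
  unfolding tensor_relations_def Let_def
  by (rule subsetD[OF module_span_incl], blast)+

private lemmas FR = F.module_axioms tensor_relations_submodule

lemma tensor_elem_bilinear: "tensor_elem K M N \<in> bilinear_maps K M N (tensor K M N)"
proof (intro bilinear_mapsI linear_mapsI)
  show "tensor_elem K M N x y \<in> carrier (tensor K M N)" if "x \<in> carrier M" "y \<in> carrier N" for x y
    using that free_gen_pair by (auto simp: tensor_elem_def tensor_def quotient_carrier[OF FR])
  then show "tensor_elem K M N x y \<in> carrier (tensor K M N)" if "y \<in> carrier N" "x \<in> carrier M" for x y
    using that by blast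
next
  fix x y z assume xyz: "x \<in> carrier M" "y \<in> carrier N" "z \<in> carrier N"
  then have "tensor_elem K M N x (y \<oplus>\<^bsub>N\<^esub> z)
      = tensor_relations K M N +>\<^bsub>F\<^esub> (free_gen K (x, y) \<oplus>\<^bsub>F\<^esub> free_gen K (x, z))"
    unfolding tensor_elem_def
    using rel_add_right free_gen_pair by (subst coset_eq_iff[OF FR]) (simp_all del: free_module_simps)
  with xyz show "tensor_elem K M N x (y \<oplus>\<^bsub>N\<^esub> z)
      = tensor_elem K M N x y \<oplus>\<^bsub>tensor K M N\<^esub> tensor_elem K M N x z"
    by (simp add: tensor_elem_def tensor_def quotient_add[OF FR] free_gen_pair del: free_module_simps)
next
  fix x y z assume xyz: "y \<in> carrier N" "x \<in> carrier M" "z \<in> carrier M"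
  then have "tensor_elem K M N (x \<oplus>\<^bsub>M\<^esub> z) y
      = tensor_relations K M N +>\<^bsub>F\<^esub> (free_gen K (x, y) \<oplus>\<^bsub>F\<^esub> free_gen K (z, y))"
    unfolding tensor_elem_def
    using rel_add_left free_gen_pair by (subst coset_eq_iff[OF FR]) (simp_all del: free_module_simps)
  with xyz show "tensor_elem K M N (x \<oplus>\<^bsub>M\<^esub> z) y
      = tensor_elem K M N x y \<oplus>\<^bsub>tensor K M N\<^esub> tensor_elem K M N z y"
    by (simp add: tensor_elem_def tensor_def quotient_add[OF FR] free_gen_pair del: free_module_simps)
next
  fix a x y assume axy: "x \<in> carrier M" "a \<in> carrier K" "y \<in> carrier N"
  then have "tensor_elem K M N x (a \<odot>\<^bsub>N\<^esub> y)
      = tensor_relations K M N +>\<^bsub>F\<^esub> (a \<odot>\<^bsub>F\<^esub> free_gen K (x, y))"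
    unfolding tensor_elem_def
    using rel_smult_right free_gen_pair by (subst coset_eq_iff[OF FR]) (simp_all del: free_module_simps)
  with axy show "tensor_elem K M N x (a \<odot>\<^bsub>N\<^esub> y) = a \<odot>\<^bsub>tensor K M N\<^esub> tensor_elem K M N x y"
    by (simp add: tensor_elem_def tensor_def quotient_smult[OF FR] free_gen_pair del: free_module_simps)
next
  fix a x y assume axy: "y \<in> carrier N" "a \<in> carrier K" "x \<in> carrier M"
  then have "tensor_elem K M N (a \<odot>\<^bsub>M\<^esub> x) y
      = tensor_relations K M N +>\<^bsub>F\<^esub> (a \<odot>\<^bsub>F\<^esub> free_gen K (x, y))"
    unfolding tensor_elem_def
    using rel_smult_left free_gen_pair by (subst coset_eq_iff[OF FR]) (simp_all del: free_module_simps)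
  with axy show "tensor_elem K M N (a \<odot>\<^bsub>M\<^esub> x) y = a \<odot>\<^bsub>tensor K M N\<^esub> tensor_elem K M N x y"
    by (simp add: tensor_elem_def tensor_def quotient_smult[OF FR] free_gen_pair del: free_module_simps)
qed

lemma tensor_elem_closed:
  "x \<in> carrier M \<Longrightarrow> y \<in> carrier N \<Longrightarrow> tensor_elem K M N x y \<in> carrier (tensor K M N)"
  by (rule bilinear_closed[OF tensor_elem_bilinear])

text \<open>Induction on the support of a representing formal sum. The coefficient of a pair is
  absorbed into its left factor, which is why \<open>tensor_sum\<close> carries no scalars.\<close>

lemma tensor_sum_exists:
  assumes "T \<in> carrier (tensor K M N)"
  shows "\<exists>xs. set xs \<subseteq> carrier M \<times> carrier N \<and> T = tensor_sum K M N xs"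
proof -
  let ?c = "\<lambda>t. tensor_relations K M N +>\<^bsub>F\<^esub> t"
  have c_lin: "?c \<in> linear_maps K F (tensor K M N)"
    unfolding tensor_def by (rule quotient_proj_linear[OF FR])
  have main: "t \<in> carrier F \<Longrightarrow> {p. t p \<noteq> \<zero>\<^bsub>K\<^esub>} = S \<Longrightarrow>
      \<exists>xs. set xs \<subseteq> carrier M \<times> carrier N \<and> ?c t = tensor_sum K M N xs" if "finite S" for S t
    using that
  proof (induction S arbitrary: t rule: finite_induct)
    case empty
    then have "t = \<zero>\<^bsub>F\<^esub>" by auto
    then have "?c t = \<zero>\<^bsub>tensor K M N\<^esub>"
      using linear_zero[OF F.module_axioms tensor_module c_lin] by blast
    then show ?case by (intro exI[of _ "[]"]) (simp add: tensor_sum_def)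
  next
    case (insert p S)
    obtain x y where p: "p = (x, y)" by fastforce
    have xy: "x \<in> carrier M" "y \<in> carrier N"
      using insert.prems p by (auto simp: free_module_carrier)
    have tp: "t p \<in> carrier K" using insert.prems by (auto simp: free_module_carrier)
    \<comment> \<open>\<open>s\<close> is \<open>t\<close> with the coefficient at \<open>p\<close>
      erased, so that its support is the smaller set \<open>S\<close>.\<close>
    define s where "s = (\<lambda>q. if q = p then \<zero>\<^bsub>K\<^esub> else t q)"
    have supp: "{q. s q \<noteq> \<zero>\<^bsub>K\<^esub>} = S" using insert by (auto simp: s_def)
    have s: "s \<in> carrier F"
      using insert supp by (auto simp: free_module_carrier s_def)
    obtain xs where xs: "set xs \<subseteq> carrier M \<times> carrier N" "?c s = tensor_sum K M N xs"
      using insert.IH[OF s supp] by blast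
    have "t = t p \<odot>\<^bsub>F\<^esub> free_gen K (x, y) \<oplus>\<^bsub>F\<^esub> s"
      using insert.prems by (auto simp: s_def free_gen_def p free_module_carrier)
    then have "?c t = ?c (t p \<odot>\<^bsub>F\<^esub> free_gen K (x, y) \<oplus>\<^bsub>F\<^esub> s)" by simp
    also have "\<dots> = ?c (t p \<odot>\<^bsub>F\<^esub> free_gen K (x, y)) \<oplus>\<^bsub>tensor K M N\<^esub> ?c s"
      by (rule linear_add[OF c_lin]) (use s tp xy free_gen_pair in \<open>auto simp del: free_module_simps\<close>)
    also have "?c (t p \<odot>\<^bsub>F\<^esub> free_gen K (x, y)) = t p \<odot>\<^bsub>tensor K M N\<^esub> tensor_elem K M N x y"
      unfolding tensor_elem_def by (rule linear_smult[OF c_lin]) (use tp xy free_gen_pair in auto)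
    also have "\<dots> = tensor_elem K M N (t p \<odot>\<^bsub>M\<^esub> x) y"
      using linear_smult[of "\<lambda>x. tensor_elem K M N x y" K M "tensor K M N"] tensor_elem_bilinear xy tp
      by (auto simp: bilinear_maps_def)
    finally show ?case
      using xs xy tp by (intro exI[of _ "(t p \<odot>\<^bsub>M\<^esub> x, y) # xs"]) (simp add: tensor_sum_def)
  qed
  obtain t where "t \<in> carrier F" "T = ?c t"
    using assms by (auto simp: tensor_def quotient_carrier[OF FR])
  moreover from this have "finite {p. t p \<noteq> \<zero>\<^bsub>K\<^esub>}" by (simp add: free_module_carrier)
  ultimately show ?thesis using main by blast
qed

context
  fixes P :: "('a, 'd, 'm) module_scheme" and \<beta> :: "'b \<Rightarrow> 'c \<Rightarrow> 'd"
  assumes P: "module K P" and \<beta>: "\<beta> \<in> bilinear_maps K M N P"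
begin

interpretation P: module K P by (rule P)

private abbreviation (input) "ev \<equiv> free_lift K P (\<lambda>p. \<beta> (fst p) (snd p))"

private lemma b: "(\<lambda>p. \<beta> (fst p) (snd p)) \<in> carrier M \<times> carrier N \<rightarrow> carrier P"
  using bilinear_closed[OF \<beta>] by auto

private lemma ev_linear: "ev \<in> linear_maps K F P"
  by (rule M.R.free_lift_linear[OF P b])

private lemma ev_gen: "x \<in> carrier M \<Longrightarrow> y \<in> carrier N \<Longrightarrow> ev (free_gen K (x, y)) = \<beta> x y"
  using M.R.free_lift_gen[OF P b, of "(x, y)"] by simp

text \<open>The kernel of \<open>ev\<close> is a submodule, and bilinearity of \<beta> places each
  of the four families of generating relations in it.\<close>

private lemma ev_relations: "t \<in> tensor_relations K M N \<Longrightarrow> ev t = \<zero>\<^bsub>P\<^esub>"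
proof -
  have lin: "(\<lambda>y. \<beta> x y) \<in> linear_maps K N P" "(\<lambda>x. \<beta> x y) \<in> linear_maps K M P"
    if "x \<in> carrier M" "y \<in> carrier N" for x y using \<beta> that by (auto simp: bilinear_maps_def)
  have *: "s \<ominus>\<^bsub>F\<^esub> t \<in> {t \<in> carrier F. ev t \<in> {\<zero>\<^bsub>P\<^esub>}}"
    if "s \<in> carrier F" "t \<in> carrier F" "ev s = ev t" for s t
    using that linear_minus[OF F.module_axioms P ev_linear that(1,2)] linear_closed[OF ev_linear that(2)]
    by (simp add: a_minus_def P.r_neg del: free_module_simps)
  have "tensor_relations K M N \<subseteq> {t \<in> carrier F. ev t \<in> {\<zero>\<^bsub>P\<^esub>}}"
    unfolding tensor_relations_def Let_def
    by (rule module_span_least, rule linear_kernel_submodule[OF F.module_axioms P ev_linear zero_submodule[OF P]])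
      (intro Un_least subsetI; elim CollectE exE conjE; simp only:; rule *;
       simp add: free_gen_pair linear_add[OF ev_linear] linear_smult[OF ev_linear] ev_gen
         linear_add[OF lin(1)] linear_add[OF lin(2)] linear_smult[OF lin(1)] linear_smult[OF lin(2)]
         del: free_module_simps)
  then show "t \<in> tensor_relations K M N \<Longrightarrow> ev t = \<zero>\<^bsub>P\<^esub>" by blast
qed

private lemma tensor_lift_coset:
  assumes "t \<in> carrier F"
  shows "tensor_lift K P \<beta> (tensor_relations K M N +>\<^bsub>F\<^esub> t) = ev t"
proof -
  have "the_elem (ev ` (tensor_relations K M N +>\<^bsub>F\<^esub> t)) = ev t"
  proof (rule the_elem_image_eq)
    show "tensor_relations K M N +>\<^bsub>F\<^esub> t \<noteq> {}" using coset_self[OF FR assms] by blast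
    fix s assume "s \<in> tensor_relations K M N +>\<^bsub>F\<^esub> t"
    then have s: "s \<in> carrier F" "s \<ominus>\<^bsub>F\<^esub> t \<in> tensor_relations K M N"
      using coset_mem_iff[OF FR assms] by blast+
    have "ev s \<ominus>\<^bsub>P\<^esub> ev t = \<zero>\<^bsub>P\<^esub>"
      using ev_relations[OF s(2)] linear_minus[OF F.module_axioms P ev_linear s(1) assms] by argo
    then show "ev s = ev t"
      using P.minus_eq_zero_iff linear_closed[OF ev_linear] s assms by blast
  qed
  then show ?thesis by (simp add: tensor_lift_def free_lift_def[abs_def])
qed

lemma tensor_lift_linear: "tensor_lift K P \<beta> \<in> linear_maps K (tensor K M N) P"
proof (rule linear_mapsI)
  fix X assume "X \<in> carrier (tensor K M N)"
  then show "tensor_lift K P \<beta> X \<in> carrier P"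
    by (auto simp: tensor_def quotient_carrier[OF FR] tensor_lift_coset linear_closed[OF ev_linear])
next
  fix X Y assume "X \<in> carrier (tensor K M N)" "Y \<in> carrier (tensor K M N)"
  then show "tensor_lift K P \<beta> (X \<oplus>\<^bsub>tensor K M N\<^esub> Y) = tensor_lift K P \<beta> X \<oplus>\<^bsub>P\<^esub> tensor_lift K P \<beta> Y"
    by (auto simp: tensor_def quotient_carrier[OF FR] quotient_add[OF FR] tensor_lift_coset
        linear_add[OF ev_linear] simp del: free_module_simps)
next
  fix a X assume "a \<in> carrier K" "X \<in> carrier (tensor K M N)"
  then show "tensor_lift K P \<beta> (a \<odot>\<^bsub>tensor K M N\<^esub> X) = a \<odot>\<^bsub>P\<^esub> tensor_lift K P \<beta> X"
    by (auto simp: tensor_def quotient_carrier[OF FR] quotient_smult[OF FR] tensor_lift_coset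
        linear_smult[OF ev_linear] simp del: free_module_simps)
qed

lemma tensor_lift_elem:
  "x \<in> carrier M \<Longrightarrow> y \<in> carrier N \<Longrightarrow> tensor_lift K P \<beta> (tensor_elem K M N x y) = \<beta> x y"
  by (simp add: tensor_elem_def tensor_lift_coset free_gen_pair ev_gen)

lemma tensor_lift_sum:
  assumes "set xs \<subseteq> carrier M \<times> carrier N"
  shows "tensor_lift K P \<beta> (tensor_sum K M N xs) = lsum P (map (\<lambda>(x, y). \<beta> x y) xs)"
proof -
  have "tensor_lift K P \<beta> (tensor_sum K M N xs)
      = lsum P (map (tensor_lift K P \<beta>) (map (\<lambda>(x, y). tensor_elem K M N x y) xs))"
    unfolding tensor_sum_def
    by (rule linear_lsum[OF tensor_module P tensor_lift_linear])
      (use assms in \<open>auto intro: tensor_elem_closed\<close>)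
  also have "map (tensor_lift K P \<beta>) (map (\<lambda>(x, y). tensor_elem K M N x y) xs) = map (\<lambda>(x, y). \<beta> x y) xs"
    using assms by (auto simp: tensor_lift_elem)
  finally show ?thesis .
qed

end

end

subsection \<open>Detecting elementary tensors by functionals\<close>

text \<open>The subspace \<open>X\<close> is what makes the induction go through: it collects the left factors that
  have already been split off, and is \<open>{0}\<close> in the application.\<close>

lemma tensor_sum_in_span:
  assumes K: "field K" and M: "module K M" and N: "module K N" and U: "submodule U K N"
    and X: "submodule X K M" and xs: "set xs \<subseteq> carrier M \<times> carrier N"
    and slices: "\<And>\<phi>. \<phi> \<in> linear_maps K M (self_module K) \<Longrightarrow> (\<forall>x\<in>X. \<phi> x = \<zero>\<^bsub>K\<^esub>) \<Longrightarrow>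
       lsum N (map (\<lambda>(x, y). \<phi> x \<odot>\<^bsub>N\<^esub> y) xs) \<in> U"
  shows "tensor_sum K M N xs \<in> module_span K (tensor K M N)
    ({tensor_elem K M N x y | x y. x \<in> carrier M \<and> y \<in> U} \<union>
     {tensor_elem K M N x y | x y. x \<in> X \<and> y \<in> carrier N})"
  using X xs slices
proof (induction xs arbitrary: X)
  interpret M: module K M by fact
  interpret N: module K N by fact
  interpret T: module K "tensor K M N" by (rule tensor_module[OF M N])
  let ?G = "\<lambda>X. {tensor_elem K M N x y | x y. x \<in> carrier M \<and> y \<in> U} \<union>
     {tensor_elem K M N x y | x y. x \<in> X \<and> y \<in> carrier N}"
  let ?S = "\<lambda>X. module_span K (tensor K M N) (?G X)"
  have Uc: "y \<in> carrier N" if "y \<in> U" for y using submodule_carrier[OF U that] .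
  have sub: "submodule (?S X) K (tensor K M N)" if "submodule X K M" for X
    by (rule module_span_submodule[OF T.module_axioms])
      (use Uc submodule_carrier[OF that] in \<open>auto intro!: tensor_elem_closed[OF M N]\<close>)
  {
    case Nil
    show ?case using submodule_zero[OF sub[OF Nil(1)]] by (simp add: tensor_sum_def)
  next
    case (Cons p xs)
    obtain x y where p: "p = (x, y)" by fastforce
    have xy: "x \<in> carrier M" "y \<in> carrier N" and xs: "set xs \<subseteq> carrier M \<times> carrier N"
      using Cons.prems p by auto
    have mem: "fst z \<in> carrier M \<and> snd z \<in> carrier N" if "z \<in> set xs" for z
      using that xs by auto
    have sumc: "lsum N (map (\<lambda>(x, y). \<phi> x \<odot>\<^bsub>N\<^esub> y) xs) \<in> carrier N"
      if "\<phi> \<in> linear_maps K M (self_module K)" for \<phi>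
      using mem linear_closed[OF that] by (intro N.lsum_closed) (auto simp: case_prod_beta)
    show ?case
    proof (cases "x \<in> X")
      case True
      have "tensor_sum K M N xs \<in> ?S X"
      proof (rule Cons.IH[OF Cons.prems(1) xs])
        fix \<phi> assume \<phi>: "\<phi> \<in> linear_maps K M (self_module K)" "\<forall>x\<in>X. \<phi> x = \<zero>\<^bsub>K\<^esub>"
        then show "lsum N (map (\<lambda>(x, y). \<phi> x \<odot>\<^bsub>N\<^esub> y) xs) \<in> U"
          using Cons.prems(3)[OF \<phi>] True p xy sumc by simp
      qed
      moreover have "tensor_elem K M N x y \<in> ?S X"
        by (rule subsetD[OF module_span_incl]) (use True xy in blast)
      ultimately show ?thesis
        using submodule_add[OF sub[OF Cons.prems(1)]] p by (simp add: tensor_sum_def)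
    next
      case False
      \<comment> \<open>A functional vanishing on the enlarged space \<open>X'\<close> kills
        \<open>x\<close>, so the head of the list contributes nothing to its slice and the induction
        hypothesis applies to the tail.\<close>
      define X' where "X' = {u \<oplus>\<^bsub>M\<^esub> a \<odot>\<^bsub>M\<^esub> x | u a. u \<in> X \<and> a \<in> carrier K}"
      have Xc: "u \<in> carrier M" if "u \<in> X" for u using submodule_carrier[OF Cons.prems(1) that] .
      have X': "submodule X' K M"
      proof -
        have "X' = {u \<oplus>\<^bsub>M\<^esub> v | u v. u \<in> X \<and> v \<in> {a \<odot>\<^bsub>M\<^esub> x | a. a \<in> carrier K}}"
          unfolding X'_def by blast
        then show ?thesis
          using submodule_sum[OF M Cons.prems(1) M.submodule_multiples[OF xy(1)]] by simp
      qed
      have XX': "u \<in> X'" if "u \<in> X" for u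
        unfolding X'_def using that Xc xy by (auto intro!: exI[of _ u] exI[of _ "\<zero>\<^bsub>K\<^esub>"])
      have xX': "x \<in> X'"
        unfolding X'_def using submodule_zero[OF Cons.prems(1)] xy
        by (auto intro!: exI[of _ "\<zero>\<^bsub>M\<^esub>"] exI[of _ "\<one>\<^bsub>K\<^esub>"])
      have IH: "tensor_sum K M N xs \<in> ?S X'"
      proof (rule Cons.IH[OF X' xs])
        fix \<phi> assume \<phi>: "\<phi> \<in> linear_maps K M (self_module K)" "\<forall>x\<in>X'. \<phi> x = \<zero>\<^bsub>K\<^esub>"
        then have "\<forall>x\<in>X. \<phi> x = \<zero>\<^bsub>K\<^esub>" "\<phi> x = \<zero>\<^bsub>K\<^esub>" using XX' xX' by auto
        then show "lsum N (map (\<lambda>(x, y). \<phi> x \<odot>\<^bsub>N\<^esub> y) xs) \<in> U"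
          using Cons.prems(3)[OF \<phi>(1)] p xy sumc[OF \<phi>(1)] by simp
      qed
      let ?t = "\<lambda>z. tensor_elem K M N x z"
      have t_lin: "?t \<in> linear_maps K N (tensor K M N)"
        using tensor_elem_bilinear[OF M N] xy by (auto simp: bilinear_maps_def)
      \<comment> \<open>The price of enlarging \<open>X\<close> by \<open>x\<close> is an error term
        in x \<otimes> N, which is collected into a single \<open>?t z\<close>.\<close>
      let ?V = "{s \<oplus>\<^bsub>tensor K M N\<^esub> ?t z | s z. s \<in> ?S X \<and> z \<in> carrier N}"
      have Sc: "s \<in> carrier (tensor K M N)" if "s \<in> ?S X" for s
        using submodule_carrier[OF sub[OF Cons.prems(1)] that] .
      have tc: "?t z \<in> carrier (tensor K M N)" if "z \<in> carrier N" for z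
        using linear_closed[OF t_lin that] .
      have "submodule ?V K (tensor K M N)"
      proof (rule T.submoduleI')
        show "?V \<subseteq> carrier (tensor K M N)" using Sc tc by auto
        show "\<zero>\<^bsub>tensor K M N\<^esub> \<in> ?V"
        proof -
          have "\<zero>\<^bsub>tensor K M N\<^esub> = \<zero>\<^bsub>tensor K M N\<^esub> \<oplus>\<^bsub>tensor K M N\<^esub> ?t \<zero>\<^bsub>N\<^esub>"
            using linear_zero[OF N T.module_axioms t_lin] by simp
          then show ?thesis using submodule_zero[OF sub[OF Cons.prems(1)]] by blast
        qed
      next
        fix v w assume "v \<in> ?V" "w \<in> ?V"
        then obtain s z s' z' where *: "v = s \<oplus>\<^bsub>tensor K M N\<^esub> ?t z" "w = s' \<oplus>\<^bsub>tensor K M N\<^esub> ?t z'"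
          "s \<in> ?S X" "s' \<in> ?S X" "z \<in> carrier N" "z' \<in> carrier N" by blast
        then have "v \<oplus>\<^bsub>tensor K M N\<^esub> w
            = (s \<oplus>\<^bsub>tensor K M N\<^esub> s') \<oplus>\<^bsub>tensor K M N\<^esub> ?t (z \<oplus>\<^bsub>N\<^esub> z')"
          using Sc tc by (simp add: linear_add[OF t_lin] T.a_ac)
        with * submodule_add[OF sub[OF Cons.prems(1)] *(3,4)]
        show "v \<oplus>\<^bsub>tensor K M N\<^esub> w \<in> ?V" by blast
      next
        fix a v assume a: "a \<in> carrier K" and "v \<in> ?V"
        then obtain s z where *: "v = s \<oplus>\<^bsub>tensor K M N\<^esub> ?t z" "s \<in> ?S X" "z \<in> carrier N" by blast
        then have "a \<odot>\<^bsub>tensor K M N\<^esub> v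
            = (a \<odot>\<^bsub>tensor K M N\<^esub> s) \<oplus>\<^bsub>tensor K M N\<^esub> ?t (a \<odot>\<^bsub>N\<^esub> z)"
          using Sc tc a by (simp add: linear_smult[OF t_lin] T.smult_r_distr)
        with * a submodule_smult[OF sub[OF Cons.prems(1)] a *(2)]
        show "a \<odot>\<^bsub>tensor K M N\<^esub> v \<in> ?V" by blast
      qed
      moreover have "?G X' \<subseteq> ?V"
      proof
        fix g assume "g \<in> ?G X'"
        then consider u v where "g = tensor_elem K M N u v" "u \<in> carrier M" "v \<in> U"
          | u v where "g = tensor_elem K M N u v" "u \<in> X'" "v \<in> carrier N" by blast
        then show "g \<in> ?V"
        proof cases
          case 1
          then have "g \<in> ?S X" using subsetD[OF module_span_incl, of g "?G X"] by blast
          moreover have "g = g \<oplus>\<^bsub>tensor K M N\<^esub> ?t \<zero>\<^bsub>N\<^esub>"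
            using linear_zero[OF N T.module_axioms t_lin] Sc[OF \<open>g \<in> ?S X\<close>] by simp
          ultimately show ?thesis by blast
        next
          case 2
          then obtain w a where *: "u = w \<oplus>\<^bsub>M\<^esub> a \<odot>\<^bsub>M\<^esub> x" "w \<in> X" "a \<in> carrier K"
            unfolding X'_def by blast
          have lin: "(\<lambda>u. tensor_elem K M N u v) \<in> linear_maps K M (tensor K M N)"
            "(\<lambda>v. tensor_elem K M N x v) \<in> linear_maps K N (tensor K M N)"
            using tensor_elem_bilinear[OF M N] 2 xy by (auto simp: bilinear_maps_def)
          have "g = tensor_elem K M N w v \<oplus>\<^bsub>tensor K M N\<^esub> ?t (a \<odot>\<^bsub>N\<^esub> v)"
            using 2 * Xc xy
            by (simp add: linear_add[OF lin(1)] linear_smult[OF lin(1)] linear_smult[OF lin(2)])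
          moreover have "tensor_elem K M N w v \<in> ?S X"
            by (rule subsetD[OF module_span_incl]) (use * 2 in blast)
          ultimately show ?thesis using 2 * by blast
        qed
      qed
      ultimately have "?S X' \<subseteq> ?V" by (rule module_span_least)
      with IH obtain s z where sz: "tensor_sum K M N xs = s \<oplus>\<^bsub>tensor K M N\<^esub> ?t z"
        "s \<in> ?S X" "z \<in> carrier N" by blast
      then have total: "tensor_sum K M N (p # xs) = s \<oplus>\<^bsub>tensor K M N\<^esub> ?t (y \<oplus>\<^bsub>N\<^esub> z)"
        using p Sc tc xy by (simp add: tensor_sum_def linear_add[OF t_lin] T.a_ac)
      \<comment> \<open>The functional that kills \<open>X\<close> and is 1 at \<open>x\<close>
        reads off the coefficient \<open>y + z\<close> of \<open>x\<close> modulo \<open>U\<close>;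
        the slice hypothesis then puts this coefficient into \<open>U\<close>.\<close>
      obtain \<phi> where \<phi>: "\<phi> \<in> linear_maps K M (self_module K)" "\<forall>u\<in>X. \<phi> u = \<zero>\<^bsub>K\<^esub>" "\<phi> x = \<one>\<^bsub>K\<^esub>"
        using separating_functional[OF K M Cons.prems(1) xy(1) False] by blast
      have \<phi>c: "\<phi> u \<in> carrier K" if "u \<in> carrier M" for u using linear_closed[OF \<phi>(1) that] by simp
      have bil: "(\<lambda>u v. \<phi> u \<odot>\<^bsub>N\<^esub> v) \<in> bilinear_maps K M N N"
        by (rule bilinear_mapsI)
          (use \<phi>c in \<open>auto intro!: smult_linear_right[OF N] smult_linear_left[OF N] \<phi> linear_id\<close>)
      let ?L = "tensor_lift K N (\<lambda>u v. \<phi> u \<odot>\<^bsub>N\<^esub> v)"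
      have L_lin: "?L \<in> linear_maps K (tensor K M N) N"
        by (rule tensor_lift_linear[OF M N N bil])
      have "?S X \<subseteq> {t \<in> carrier (tensor K M N). ?L t \<in> U}"
      proof (rule module_span_least)
        show "submodule {t \<in> carrier (tensor K M N). ?L t \<in> U} K (tensor K M N)"
          by (rule linear_kernel_submodule[OF T.module_axioms N L_lin U])
        show "?G X \<subseteq> {t \<in> carrier (tensor K M N). ?L t \<in> U}"
          using Uc Xc \<phi>(2) \<phi>c submodule_smult[OF U] submodule_zero[OF U]
          by (auto simp: tensor_lift_elem[OF M N N bil] intro!: tensor_elem_closed[OF M N])
      qed
      then have Ls: "?L s \<in> U" using sz by blast
      have "?L (tensor_sum K M N (p # xs)) \<in> U"
        using tensor_lift_sum[OF M N N bil Cons.prems(2)] Cons.prems(3)[OF \<phi>(1,2)] by simp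
      moreover have "?L (tensor_sum K M N (p # xs)) = ?L s \<oplus>\<^bsub>N\<^esub> (y \<oplus>\<^bsub>N\<^esub> z)"
        using total sz xy Sc tc \<phi>(3)
        by (simp add: linear_add[OF L_lin] tensor_lift_elem[OF M N N bil])
      ultimately have "(?L s \<oplus>\<^bsub>N\<^esub> (y \<oplus>\<^bsub>N\<^esub> z)) \<ominus>\<^bsub>N\<^esub> ?L s \<in> U"
        using Ls submodule_minus[OF N U] by simp
      moreover have "(?L s \<oplus>\<^bsub>N\<^esub> (y \<oplus>\<^bsub>N\<^esub> z)) \<ominus>\<^bsub>N\<^esub> ?L s = y \<oplus>\<^bsub>N\<^esub> z"
      proof -
        have "?L s \<in> carrier N" using Ls Uc by blast
        then show ?thesis
          using xy sz by (simp add: a_minus_def N.a_comm[of "?L s"] N.a_assoc N.r_neg)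
      qed
      ultimately have "y \<oplus>\<^bsub>N\<^esub> z \<in> U" by simp
      then have "?t (y \<oplus>\<^bsub>N\<^esub> z) \<in> ?S X"
        by (intro subsetD[OF module_span_incl]) (use xy in blast)
      then show ?thesis
        unfolding total using submodule_add[OF sub[OF Cons.prems(1)] sz(2)] by blast
    qed
  }
qed

text \<open>The left slices place the tensor in M \<otimes> U and, after a flip, the right slices
  place it in U \<otimes> M. For a projection \<open>p\<close> onto \<open>U\<close> it is therefore
  fixed by id \<otimes> p and by p \<otimes> id, hence by p \<otimes> p, and applying the latter to
  any presentation gives one with all factors in \<open>U\<close>.\<close>

lemma tensor_span_both:
  assumes K: "field K" and M: "module K M" and U: "submodule U K M"
    and xs: "set xs \<subseteq> carrier M \<times> carrier M"
    and left: "\<And>\<phi>. \<phi> \<in> linear_maps K M (self_module K) \<Longrightarrow> lsum M (map (\<lambda>(x, y). \<phi> x \<odot>\<^bsub>M\<^esub> y) xs) \<in> U"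
    and right: "\<And>\<phi>. \<phi> \<in> linear_maps K M (self_module K) \<Longrightarrow> lsum M (map (\<lambda>(x, y). \<phi> y \<odot>\<^bsub>M\<^esub> x) xs) \<in> U"
  shows "tensor_sum K M M xs \<in> module_span K (tensor K M M) {tensor_elem K M M x y | x y. x \<in> U \<and> y \<in> U}"
proof -
  interpret M: module K M by fact
  interpret T: module K "tensor K M M" by (rule tensor_module[OF M M])
  let ?e = "tensor_elem K M M"
  note e_closed = tensor_elem_closed[OF M M] and e_bil = tensor_elem_bilinear[OF M M]
  have Uc: "y \<in> carrier M" if "y \<in> U" for y using submodule_carrier[OF U that] .
  have l: "tensor_sum K M M xs \<in> module_span K (tensor K M M)
    ({?e x y | x y. x \<in> carrier M \<and> y \<in> U} \<union> {?e x y | x y. x \<in> {\<zero>\<^bsub>M\<^esub>} \<and> y \<in> carrier M})"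
    by (rule tensor_sum_in_span[OF K M M U zero_submodule[OF M] xs left])
  let ?ys = "map (\<lambda>(x, y). (y, x)) xs"
  have ys: "set ?ys \<subseteq> carrier M \<times> carrier M" using xs by auto
  have r: "tensor_sum K M M ?ys \<in> module_span K (tensor K M M)
    ({?e x y | x y. x \<in> carrier M \<and> y \<in> U} \<union> {?e x y | x y. x \<in> {\<zero>\<^bsub>M\<^esub>} \<and> y \<in> carrier M})"
  proof (rule tensor_sum_in_span[OF K M M U zero_submodule[OF M] ys])
    fix \<phi> assume "\<phi> \<in> linear_maps K M (self_module K)"
    from right[OF this] show "lsum M (map (\<lambda>(x, y). \<phi> x \<odot>\<^bsub>M\<^esub> y) ?ys) \<in> U"
      by (simp add: comp_def case_prod_unfold)
  qed
  obtain p where p: "p \<in> linear_maps K M M" "\<And>x. x \<in> carrier M \<Longrightarrow> p x \<in> U" "\<And>x. x \<in> U \<Longrightarrow> p x = x"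
    using linear_projection_exists[OF K M U] by blast
  have pc: "p x \<in> carrier M" if "x \<in> carrier M" for x using p that Uc by blast
  have b1: "(\<lambda>x y. ?e x (p y)) \<in> bilinear_maps K M M (tensor K M M)"
    by (rule bilinear_mapsI)
      (use pc in \<open>auto intro!: bilinear_right[OF e_bil] bilinear_left[OF e_bil] p linear_id\<close>)
  have b2: "(\<lambda>x y. ?e y x) \<in> bilinear_maps K M M (tensor K M M)"
    by (rule bilinear_mapsI)
      (auto intro!: bilinear_right[OF e_bil] bilinear_left[OF e_bil] linear_id)
  have b3: "(\<lambda>x y. ?e (p x) y) \<in> bilinear_maps K M M (tensor K M M)"
    by (rule bilinear_mapsI)
      (use pc in \<open>auto intro!: bilinear_right[OF e_bil] bilinear_left[OF e_bil] p linear_id\<close>)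
  let ?R = "tensor_lift K (tensor K M M) (\<lambda>x y. ?e x (p y))"
  let ?L = "tensor_lift K (tensor K M M) (\<lambda>x y. ?e (p x) y)"
  \<comment> \<open>\<open>?F\<close> is the flip: \<open>r\<close> concerns the list with swapped
    factors, and its conclusion is carried back through \<open>?F\<close>.\<close>
  let ?F = "tensor_lift K (tensor K M M) (\<lambda>x y. ?e y x)"
  note lin = tensor_lift_linear[OF M M T.module_axioms]
  note elem = tensor_lift_elem[OF M M T.module_axioms]
  note sum = tensor_lift_sum[OF M M T.module_axioms]
  have ezero: "?e \<zero>\<^bsub>M\<^esub> y = \<zero>\<^bsub>tensor K M M\<^esub>" if "y \<in> carrier M" for y
    by (rule linear_zero[OF M T.module_axioms bilinear_left[OF e_bil that linear_id]])
  have ezero': "?e y \<zero>\<^bsub>M\<^esub> = \<zero>\<^bsub>tensor K M M\<^esub>" if "y \<in> carrier M" for y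
    by (rule linear_zero[OF M T.module_axioms bilinear_right[OF e_bil that linear_id]])
  have "module_span K (tensor K M M)
    ({?e x y | x y. x \<in> carrier M \<and> y \<in> U} \<union> {?e x y | x y. x \<in> {\<zero>\<^bsub>M\<^esub>} \<and> y \<in> carrier M})
    \<subseteq> {t \<in> carrier (tensor K M M). ?R t = t}"
    by (rule module_span_least[OF linear_equalizer_submodule[OF T.module_axioms T.module_axioms lin[OF b1] linear_id]])
      (use Uc p pc in \<open>auto simp: elem[OF b1] ezero linear_zero[OF T.module_axioms T.module_axioms lin[OF b1]] intro!: e_closed\<close>)
  with l have R: "?R (tensor_sum K M M xs) = tensor_sum K M M xs" by blast
  have FL: "(\<lambda>t. ?L (?F t)) \<in> linear_maps K (tensor K M M) (tensor K M M)"
    by (rule linear_comp[OF lin[OF b3] lin[OF b2]])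
  have "module_span K (tensor K M M)
    ({?e x y | x y. x \<in> carrier M \<and> y \<in> U} \<union> {?e x y | x y. x \<in> {\<zero>\<^bsub>M\<^esub>} \<and> y \<in> carrier M})
    \<subseteq> {t \<in> carrier (tensor K M M). ?L (?F t) = ?F t}"
    by (rule module_span_least[OF linear_equalizer_submodule[OF T.module_axioms T.module_axioms FL lin[OF b2]]])
      (use Uc p pc in \<open>auto simp: elem[OF b2] elem[OF b3] ezero' linear_zero[OF T.module_axioms T.module_axioms lin[OF b3]] intro!: e_closed\<close>)
  with r have "?L (?F (tensor_sum K M M ?ys)) = ?F (tensor_sum K M M ?ys)" by blast
  moreover have "?F (tensor_sum K M M ?ys) = tensor_sum K M M xs"
    using sum[OF b2 ys] by (simp add: tensor_sum_def comp_def case_prod_unfold)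
  ultimately have L: "?L (tensor_sum K M M xs) = tensor_sum K M M xs" by simp
  have c: "?e (fst z) (p (snd z)) \<in> carrier (tensor K M M)" if "z \<in> set xs" for z
    using that xs pc by (intro e_closed) auto
  have "?R (tensor_sum K M M xs) = lsum (tensor K M M) (map (\<lambda>(x, y). ?e x (p y)) xs)"
    by (rule sum[OF b1 xs])
  then have "tensor_sum K M M xs = ?L (lsum (tensor K M M) (map (\<lambda>(x, y). ?e x (p y)) xs))"
    using R L by simp
  also have "\<dots> = lsum (tensor K M M) (map ?L (map (\<lambda>(x, y). ?e x (p y)) xs))"
    by (rule linear_lsum[OF T.module_axioms T.module_axioms lin[OF b3]]) (use c in auto)
  also have "map ?L (map (\<lambda>(x, y). ?e x (p y)) xs) = map (\<lambda>(x, y). ?e (p x) (p y)) xs"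
    using xs pc by (auto simp: elem[OF b3])
  also have "lsum (tensor K M M) \<dots> \<in> module_span K (tensor K M M) {?e x y | x y. x \<in> U \<and> y \<in> U}"
  proof (rule submodule_lsum[OF T.module_axioms module_span_submodule[OF T.module_axioms]])
    show "{?e x y | x y. x \<in> U \<and> y \<in> U} \<subseteq> carrier (tensor K M M)" using Uc e_closed by blast
    have "set (map (\<lambda>(x, y). ?e (p x) (p y)) xs) \<subseteq> {?e x y | x y. x \<in> U \<and> y \<in> U}"
    proof
      fix t assume "t \<in> set (map (\<lambda>(x, y). ?e (p x) (p y)) xs)"
      then obtain x y where "(x, y) \<in> set xs" "t = ?e (p x) (p y)" by auto
      moreover from this have "p x \<in> U" "p y \<in> U" using xs p(2) by auto
      ultimately show "t \<in> {?e x y | x y. x \<in> U \<and> y \<in> U}" by blast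
    qed
    then show "set (map (\<lambda>(x, y). ?e (p x) (p y)) xs) \<subseteq> module_span K (tensor K M M) {?e x y | x y. x \<in> U \<and> y \<in> U}"
      by (rule order_trans[OF _ module_span_incl])
  qed
  finally show ?thesis .
qed

section \<open>Coalgebras\<close>

context coalgebra
begin

section \<open>Sweedler sums\<close>

lemmas modC = module_axioms
lemmas modK = module_self
lemmas modT = tensor_module[OF module_axioms module_axioms]

lemma fieldK: "field K" by (rule field_axioms)

abbreviation "dual \<equiv> linear_maps K C (self_module K)"

text \<open>A chosen presentation of \<open>\<Delta> c\<close> as a finite sum of elementary tensors; \<open>sweedler P c \<beta>\<close> is
  \<open>\<Sum> \<beta> c\<^sub>1 c\<^sub>2\<close> for this presentation, which depends on it only when \<open>\<beta>\<close> is not bilinear.\<close>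

definition comult_pairs :: "'b \<Rightarrow> ('b \<times> 'b) list" where
  "comult_pairs c = (SOME xs. set xs \<subseteq> carrier C \<times> carrier C \<and> comult C c = tensor_sum K C C xs)"

definition sweedler :: "('a, 'd, 'm) module_scheme \<Rightarrow> 'b \<Rightarrow> ('b \<Rightarrow> 'b \<Rightarrow> 'd) \<Rightarrow> 'd" where
  "sweedler P c \<beta> = lsum P (map (\<lambda>(x, y). \<beta> x y) (comult_pairs c))"

lemma comult_closed: "c \<in> carrier C \<Longrightarrow> comult C c \<in> carrier (tensor K C C)"
  by (rule linear_closed[OF comult_linear])

lemma comult_pairs:
  assumes "c \<in> carrier C"
  shows "set (comult_pairs c) \<subseteq> carrier C \<times> carrier C" "comult C c = tensor_sum K C C (comult_pairs c)"
  using someI_ex[OF tensor_sum_exists[OF modC modC comult_closed[OF assms]], folded comult_pairs_def]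
  by simp_all

lemma comult_pairs_mem:
  "c \<in> carrier C \<Longrightarrow> z \<in> set (comult_pairs c) \<Longrightarrow> fst z \<in> carrier C \<and> snd z \<in> carrier C"
  using subsetD[OF comult_pairs(1)] by (auto simp: mem_Times_iff)

lemma sweedler_eq_tensor_lift:
  "\<lbrakk>module K P; \<beta> \<in> bilinear_maps K C C P; c \<in> carrier C\<rbrakk>
    \<Longrightarrow> tensor_lift K P \<beta> (comult C c) = sweedler P c \<beta>"
  by (simp add: sweedler_def comult_pairs tensor_lift_sum[OF modC modC])

text \<open>For bilinear \<beta> both sides are the value of \<open>tensor_lift\<close> at the same
  tensor. This permits replacing the chosen presentation by one adapted to a subcoalgebra.\<close>

lemma sweedler_eq_lsum:
  "\<lbrakk>module K P; \<beta> \<in> bilinear_maps K C C P; c \<in> carrier C; set xs \<subseteq> carrier C \<times> carrier C;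
    comult C c = tensor_sum K C C xs\<rbrakk> \<Longrightarrow> sweedler P c \<beta> = lsum P (map (\<lambda>(x, y). \<beta> x y) xs)"
  using sweedler_eq_tensor_lift[of P \<beta> c] tensor_lift_sum[OF modC modC, of P \<beta> xs] by simp

lemma sweedler_closed:
  assumes "module K P" "c \<in> carrier C" "\<And>x y. x \<in> carrier C \<Longrightarrow> y \<in> carrier C \<Longrightarrow> \<beta> x y \<in> carrier P"
  shows "sweedler P c \<beta> \<in> carrier P"
proof -
  interpret P: module K P by fact
  show ?thesis
    unfolding sweedler_def
    by (rule P.lsum_closed) (auto intro!: assms(3) dest: comult_pairs_mem[OF assms(2)])
qed

lemma sweedler_cong:
  assumes "c \<in> carrier C" "\<And>x y. x \<in> carrier C \<Longrightarrow> y \<in> carrier C \<Longrightarrow> \<beta> x y = \<gamma> x y"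
  shows "sweedler P c \<beta> = sweedler P c \<gamma>"
proof -
  have "map (\<lambda>(x, y). \<beta> x y) (comult_pairs c) = map (\<lambda>(x, y). \<gamma> x y) (comult_pairs c)"
    by (auto simp: case_prod_unfold assms(2) dest: comult_pairs_mem[OF assms(1)])
  then show ?thesis unfolding sweedler_def by (rule arg_cong)
qed

lemma sweedler_image:
  assumes "module K P" "module K Q" "h \<in> linear_maps K P Q" "c \<in> carrier C"
    and "\<And>x y. x \<in> carrier C \<Longrightarrow> y \<in> carrier C \<Longrightarrow> \<beta> x y \<in> carrier P"
  shows "h (sweedler P c \<beta>) = sweedler Q c (\<lambda>x y. h (\<beta> x y))"
proof -
  have "h (sweedler P c \<beta>) = lsum Q (map h (map (\<lambda>(x, y). \<beta> x y) (comult_pairs c)))"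
    unfolding sweedler_def
    by (rule linear_lsum[OF assms(1-3)]) (auto intro!: assms(5) dest: comult_pairs_mem[OF assms(4)])
  then show ?thesis by (simp add: sweedler_def comp_def case_prod_unfold)
qed

lemma sweedler_swap:
  assumes "module K P" "c \<in> carrier C" "d \<in> carrier C"
    and "\<And>x y u v. \<lbrakk>x \<in> carrier C; y \<in> carrier C; u \<in> carrier C; v \<in> carrier C\<rbrakk> \<Longrightarrow> \<gamma> x y u v \<in> carrier P"
  shows "sweedler P c (\<lambda>x y. sweedler P d (\<gamma> x y)) = sweedler P d (\<lambda>u v. sweedler P c (\<lambda>x y. \<gamma> x y u v))"
proof -
  interpret P: module K P by fact
  have "lsum P (map (\<lambda>z. lsum P (map (\<lambda>w. \<gamma> (fst z) (snd z) (fst w) (snd w)) (comult_pairs d))) (comult_pairs c))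
    = lsum P (map (\<lambda>w. lsum P (map (\<lambda>z. \<gamma> (fst z) (snd z) (fst w) (snd w)) (comult_pairs c))) (comult_pairs d))"
    by (rule P.lsum_swap) (simp add: assms(4) comult_pairs_mem[OF assms(2)] comult_pairs_mem[OF assms(3)])
  then show ?thesis by (simp add: sweedler_def case_prod_unfold)
qed

lemma sweedler_zero:
  assumes "module K P" "c \<in> carrier C" "\<And>x y. x \<in> carrier C \<Longrightarrow> y \<in> carrier C \<Longrightarrow> \<beta> x y = \<zero>\<^bsub>P\<^esub>"
  shows "sweedler P c \<beta> = \<zero>\<^bsub>P\<^esub>"
proof -
  interpret P: module K P by fact
  show ?thesis
    unfolding sweedler_def
    by (rule P.lsum_map_zero) (simp add: case_prod_unfold assms(3) comult_pairs_mem[OF assms(2)])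
qed

lemma sweedler_smult:
  assumes "module K P" "c \<in> carrier C" "k \<in> carrier K"
    and "\<And>x y. x \<in> carrier C \<Longrightarrow> y \<in> carrier C \<Longrightarrow> \<beta> x y \<in> carrier P"
  shows "k \<odot>\<^bsub>P\<^esub> sweedler P c \<beta> = sweedler P c (\<lambda>x y. k \<odot>\<^bsub>P\<^esub> \<beta> x y)"
  by (rule sweedler_image[OF assms(1,1) smult_linear_right[OF assms(1,3) linear_id] assms(2,4)])

lemma sweedler_smult_const:
  assumes "module K P" "c \<in> carrier C" "v \<in> carrier P"
    and "\<And>x y. x \<in> carrier C \<Longrightarrow> y \<in> carrier C \<Longrightarrow> \<beta> x y \<in> carrier K"
  shows "sweedler (self_module K) c \<beta> \<odot>\<^bsub>P\<^esub> v = sweedler P c (\<lambda>x y. \<beta> x y \<odot>\<^bsub>P\<^esub> v)"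
  by (rule sweedler_image[OF modK assms(1) smult_linear_left[OF assms(1,3) linear_id] assms(2)])
    (use assms(4) in simp)

text \<open>The presentations chosen for different elements are unrelated, so linearity in the
  comultiplied element is visible only after passing to \<open>tensor_lift\<close> and the linear
  map \<open>comult\<close>.\<close>

lemma sweedler_linear:
  assumes "module K P" "\<beta> \<in> bilinear_maps K C C P" "g \<in> linear_maps K L C" "module K L"
  shows "(\<lambda>x. sweedler P (g x) \<beta>) \<in> linear_maps K L P"
  by (rule linear_cong[OF linear_comp[OF linear_comp[OF tensor_lift_linear[OF modC modC assms(1,2)]
        comult_linear] assms(3)] assms(4)])
    (simp add: sweedler_eq_tensor_lift assms linear_closed[OF assms(3)])

text \<open>Here the comultiplied element is fixed and \<open>z\<close> is a parameter of the
  summand, so the same list serves for all \<open>z\<close>.\<close>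

lemma sweedler_linear_fun:
  assumes "module K P" "c \<in> carrier C"
    and "\<And>x y. x \<in> carrier C \<Longrightarrow> y \<in> carrier C \<Longrightarrow> (\<lambda>z. \<gamma> z x y) \<in> linear_maps K L P"
  shows "(\<lambda>z. sweedler P c (\<lambda>x y. \<gamma> z x y)) \<in> linear_maps K L P"
proof -
  have "(\<lambda>z. lsum P (map (\<lambda>w. \<gamma> z (fst w) (snd w)) (comult_pairs c))) \<in> linear_maps K L P"
    by (rule linear_lsum_fun[OF assms(1)]) (simp add: assms(3) comult_pairs_mem[OF assms(2)])
  then show ?thesis by (simp add: sweedler_def case_prod_unfold)
qed

lemma dual_closed: "\<phi> \<in> dual \<Longrightarrow> x \<in> carrier C \<Longrightarrow> \<phi> x \<in> carrier K"
  using linear_closed[of \<phi> K C "self_module K"] by simp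

lemma counit_closed: "x \<in> carrier C \<Longrightarrow> counit C x \<in> carrier K"
  by (rule dual_closed[OF counit_linear])

lemma sweedler_counit_left:
  assumes "module K P" "f \<in> linear_maps K C P" "c \<in> carrier C"
  shows "sweedler P c (\<lambda>x y. counit C x \<odot>\<^bsub>P\<^esub> f y) = f c"
proof -
  have "(\<lambda>x y. counit C x \<odot>\<^bsub>C\<^esub> y) \<in> bilinear_maps K C C C"
    by (rule bilinear_mapsI)
      (auto intro!: smult_linear_right[OF modC] smult_linear_left[OF modC] counit_closed linear_id counit_linear)
  then have "sweedler C c (\<lambda>x y. counit C x \<odot>\<^bsub>C\<^esub> y) = c"
    using counit_left[OF assms(3)] by (simp flip: sweedler_eq_tensor_lift[OF modC _ assms(3)])
  then have "f c = sweedler P c (\<lambda>x y. f (counit C x \<odot>\<^bsub>C\<^esub> y))"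
    using sweedler_image[OF modC assms(1,2,3), of "\<lambda>x y. counit C x \<odot>\<^bsub>C\<^esub> y"] counit_closed by simp
  also have "\<dots> = sweedler P c (\<lambda>x y. counit C x \<odot>\<^bsub>P\<^esub> f y)"
    by (rule sweedler_cong[OF assms(3)]) (simp add: linear_smult[OF assms(2)] counit_closed)
  finally show ?thesis by simp
qed

lemma sweedler_counit_right:
  assumes "module K P" "f \<in> linear_maps K C P" "c \<in> carrier C"
  shows "sweedler P c (\<lambda>x y. counit C y \<odot>\<^bsub>P\<^esub> f x) = f c"
proof -
  have "(\<lambda>x y. counit C y \<odot>\<^bsub>C\<^esub> x) \<in> bilinear_maps K C C C"
    by (rule bilinear_mapsI)
      (auto intro!: smult_linear_right[OF modC] smult_linear_left[OF modC] counit_closed linear_id counit_linear)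
  then have "sweedler C c (\<lambda>x y. counit C y \<odot>\<^bsub>C\<^esub> x) = c"
    using counit_right[OF assms(3)] by (simp flip: sweedler_eq_tensor_lift[OF modC _ assms(3)])
  then have "f c = sweedler P c (\<lambda>x y. f (counit C y \<odot>\<^bsub>C\<^esub> x))"
    using sweedler_image[OF modC assms(1,2,3), of "\<lambda>x y. counit C y \<odot>\<^bsub>C\<^esub> x"] counit_closed by simp
  also have "\<dots> = sweedler P c (\<lambda>x y. counit C y \<odot>\<^bsub>P\<^esub> f x)"
    by (rule sweedler_cong[OF assms(3)]) (simp add: linear_smult[OF assms(2)] counit_closed)
  finally show ?thesis by simp
qed

text \<open>A trilinear \<gamma> induces a linear map \<Phi> on C \<otimes> (C \<otimes> C), by
  lifting first in the last two variables and then in the first. Applying \<Phi> to the two sides of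
  the axiom gives the two iterated sums.\<close>

lemma sweedler_coassoc:
  assumes P: "module K P" and c: "c \<in> carrier C"
    and \<gamma>1: "\<And>y z. y \<in> carrier C \<Longrightarrow> z \<in> carrier C \<Longrightarrow> (\<lambda>x. \<gamma> x y z) \<in> linear_maps K C P"
    and \<gamma>2: "\<And>x z. x \<in> carrier C \<Longrightarrow> z \<in> carrier C \<Longrightarrow> (\<lambda>y. \<gamma> x y z) \<in> linear_maps K C P"
    and \<gamma>3: "\<And>x y. x \<in> carrier C \<Longrightarrow> y \<in> carrier C \<Longrightarrow> (\<lambda>z. \<gamma> x y z) \<in> linear_maps K C P"
  shows "sweedler P c (\<lambda>w z. sweedler P w (\<lambda>x y. \<gamma> x y z)) = sweedler P c (\<lambda>x w. sweedler P w (\<lambda>y z. \<gamma> x y z))"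
proof -
  let ?T = "tensor K C C" and ?TT = "tensor K C (tensor K C C)"
  let ?e = "tensor_elem K C C" and ?ee = "tensor_elem K C ?T"
  have TT: "module K ?TT" by (rule tensor_module[OF modC modT])
  note e = tensor_elem_bilinear[OF modC modC] and ee = tensor_elem_bilinear[OF modC modT]
  note ec = tensor_elem_closed[OF modC modC] and eec = tensor_elem_closed[OF modC modT]
  have \<gamma>b: "(\<lambda>y z. \<gamma> x y z) \<in> bilinear_maps K C C P" if "x \<in> carrier C" for x
    by (rule bilinear_mapsI) (use \<gamma>2 \<gamma>3 that in auto)
  define \<Psi> where "\<Psi> x w = tensor_lift K P (\<lambda>y z. \<gamma> x y z) w" for x w
  have \<Psi>_elem: "\<Psi> x (?e y z) = \<gamma> x y z" if "x \<in> carrier C" "y \<in> carrier C" "z \<in> carrier C" for x y z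
    unfolding \<Psi>_def using tensor_lift_elem[OF modC modC P \<gamma>b[OF that(1)] that(2,3)] .
  have \<Psi>b: "\<Psi> \<in> bilinear_maps K C ?T P"
  proof (rule bilinear_mapsI)
    fix x assume "x \<in> carrier C"
    then show "\<Psi> x \<in> linear_maps K ?T P"
      unfolding \<Psi>_def by (intro tensor_lift_linear[OF modC modC P] \<gamma>b)
  next
    fix w assume "w \<in> carrier ?T"
    then obtain xs where xs: "set xs \<subseteq> carrier C \<times> carrier C" "w = tensor_sum K C C xs"
      using tensor_sum_exists[OF modC modC] by blast
    \<comment> \<open>A general \<open>w\<close> is not an elementary tensor; expanding it into a
      sum of such reduces linearity in \<open>x\<close> to that of \<gamma>.\<close>
    have "(\<lambda>x. lsum P (map (\<lambda>p. \<gamma> x (fst p) (snd p)) xs)) \<in> linear_maps K C P"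
      by (rule linear_lsum_fun[OF P]) (use xs \<gamma>1 in auto)
    then show "(\<lambda>x. \<Psi> x w) \<in> linear_maps K C P"
    proof (rule linear_cong[OF _ modC])
      fix x assume "x \<in> carrier C"
      then show "\<Psi> x w = lsum P (map (\<lambda>p. \<gamma> x (fst p) (snd p)) xs)"
        unfolding \<Psi>_def xs(2) using tensor_lift_sum[OF modC modC P \<gamma>b xs(1)]
        by (simp add: case_prod_unfold)
    qed
  qed
  let ?\<Phi> = "tensor_lift K P \<Psi>"
  have \<Phi>: "?\<Phi> \<in> linear_maps K ?TT P" by (rule tensor_lift_linear[OF modC modT P \<Psi>b])
  have \<Phi>_elem: "?\<Phi> (?ee x w) = \<Psi> x w" if "x \<in> carrier C" "w \<in> carrier ?T" for x w
    by (rule tensor_lift_elem[OF modC modT P \<Psi>b that])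
  have inner: "(\<lambda>x y. ?ee x (?e y z)) \<in> bilinear_maps K C C ?TT" if "z \<in> carrier C" for z
    by (rule bilinear_mapsI)
      (use that ec in \<open>auto intro!: bilinear_right[OF ee] bilinear_left[OF ee] bilinear_left[OF e] linear_id\<close>)
  have outer: "(\<lambda>w z. sweedler ?TT w (\<lambda>x y. ?ee x (?e y z))) \<in> bilinear_maps K C C ?TT"
    by (rule bilinear_mapsI)
      (auto intro!: sweedler_linear_fun[OF TT] sweedler_linear[OF TT inner] linear_id modC
        bilinear_right[OF ee] bilinear_right[OF e])
  \<comment> \<open>The axiom contains \<open>tensor_lift\<close> where \<open>outer\<close> has a
    Sweedler sum. The two agree on the carrier only, so bilinearity has to be transferred.\<close>
  have outer': "(\<lambda>w z. tensor_lift K ?TT (\<lambda>x y. ?ee x (?e y z)) (comult C w)) \<in> bilinear_maps K C C ?TT"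
  proof (rule bilinear_mapsI)
    fix w assume w: "w \<in> carrier C"
    show "(\<lambda>z. tensor_lift K ?TT (\<lambda>x y. ?ee x (?e y z)) (comult C w)) \<in> linear_maps K C ?TT"
      by (rule linear_cong[OF bilinear_right[OF outer w linear_id] modC])
        (simp add: sweedler_eq_tensor_lift[OF TT inner w])
  next
    fix z assume z: "z \<in> carrier C"
    show "(\<lambda>w. tensor_lift K ?TT (\<lambda>x y. ?ee x (?e y z)) (comult C w)) \<in> linear_maps K C ?TT"
      by (rule linear_cong[OF bilinear_left[OF outer z linear_id] modC])
        (simp add: sweedler_eq_tensor_lift[OF TT inner[OF z]])
  qed
  have right: "(\<lambda>x w. ?ee x (comult C w)) \<in> bilinear_maps K C C ?TT"
    by (rule bilinear_mapsI)
      (auto intro!: bilinear_right[OF ee] bilinear_left[OF ee] comult_linear comult_closed linear_id)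
  have "sweedler ?TT c (\<lambda>w z. sweedler ?TT w (\<lambda>x y. ?ee x (?e y z)))
      = sweedler ?TT c (\<lambda>w z. tensor_lift K ?TT (\<lambda>x y. ?ee x (?e y z)) (comult C w))"
    by (rule sweedler_cong[OF c]) (simp add: sweedler_eq_tensor_lift[OF TT inner])
  also have "\<dots> = sweedler ?TT c (\<lambda>x w. ?ee x (comult C w))"
    using coassoc[OF c] sweedler_eq_tensor_lift[OF TT outer' c] sweedler_eq_tensor_lift[OF TT right c]
    by simp
  finally have eq: "?\<Phi> (sweedler ?TT c (\<lambda>w z. sweedler ?TT w (\<lambda>x y. ?ee x (?e y z))))
      = ?\<Phi> (sweedler ?TT c (\<lambda>x w. ?ee x (comult C w)))" by simp
  have "?\<Phi> (sweedler ?TT c (\<lambda>w z. sweedler ?TT w (\<lambda>x y. ?ee x (?e y z))))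
      = sweedler P c (\<lambda>w z. ?\<Phi> (sweedler ?TT w (\<lambda>x y. ?ee x (?e y z))))"
    by (rule sweedler_image[OF TT P \<Phi> c]) (auto intro!: sweedler_closed[OF TT] eec ec)
  also have "\<dots> = sweedler P c (\<lambda>w z. sweedler P w (\<lambda>x y. \<gamma> x y z))"
  proof (rule sweedler_cong[OF c])
    fix w z assume wz: "w \<in> carrier C" "z \<in> carrier C"
    have "?\<Phi> (sweedler ?TT w (\<lambda>x y. ?ee x (?e y z))) = sweedler P w (\<lambda>x y. ?\<Phi> (?ee x (?e y z)))"
      by (rule sweedler_image[OF TT P \<Phi> wz(1)]) (use wz in \<open>auto intro!: eec ec\<close>)
    also have "\<dots> = sweedler P w (\<lambda>x y. \<gamma> x y z)"
      by (rule sweedler_cong[OF wz(1)]) (use wz in \<open>simp add: \<Phi>_elem \<Psi>_elem ec\<close>)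
    finally show "?\<Phi> (sweedler ?TT w (\<lambda>x y. ?ee x (?e y z))) = sweedler P w (\<lambda>x y. \<gamma> x y z)" .
  qed
  finally have l: "?\<Phi> (sweedler ?TT c (\<lambda>w z. sweedler ?TT w (\<lambda>x y. ?ee x (?e y z))))
      = sweedler P c (\<lambda>w z. sweedler P w (\<lambda>x y. \<gamma> x y z))" .
  have "?\<Phi> (sweedler ?TT c (\<lambda>x w. ?ee x (comult C w))) = sweedler P c (\<lambda>x w. ?\<Phi> (?ee x (comult C w)))"
    by (rule sweedler_image[OF TT P \<Phi> c]) (auto intro!: eec comult_closed)
  also have "\<dots> = sweedler P c (\<lambda>x w. sweedler P w (\<lambda>y z. \<gamma> x y z))"
    by (rule sweedler_cong[OF c])
      (simp add: \<Phi>_elem comult_closed \<Psi>_def sweedler_eq_tensor_lift[OF P \<gamma>b])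
  finally show ?thesis using l eq by simp
qed

subsection \<open>Subcoalgebras\<close>

text \<open>A scalar can be moved into the left factor, so the elementary tensors with factors in
  \<open>D\<close> absorb scalars and \<open>module_span_lsum\<close> yields a plain list. The
  chosen \<open>comult_pairs d\<close>, by contrast, may well leave \<open>D\<close>.\<close>

lemma subcoalgebra_pairs:
  assumes "subcoalgebra K C D" "d \<in> D"
  shows "\<exists>xs. set xs \<subseteq> D \<times> D \<and> comult C d = tensor_sum K C C xs"
proof -
  let ?G = "{tensor_elem K C C x y | x y. x \<in> D \<and> y \<in> D}"
  have D: "submodule D K C" using assms(1) by (simp add: subcoalgebra_def)
  have Dc: "x \<in> carrier C" if "x \<in> D" for x using submodule_carrier[OF D that] .
  have span: "comult C d \<in> module_span K (tensor K C C) ?G"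
    using assms by (auto simp: subcoalgebra_def)
  have closed: "?G \<subseteq> carrier (tensor K C C)" using Dc tensor_elem_closed[OF modC modC] by blast
  have smult: "a \<odot>\<^bsub>tensor K C C\<^esub> t \<in> ?G" if a: "a \<in> carrier K" and t: "t \<in> ?G" for a t
  proof -
    obtain x y where xy: "t = tensor_elem K C C x y" "x \<in> D" "y \<in> D" using t by blast
    have "tensor_elem K C C (a \<odot>\<^bsub>C\<^esub> x) y = a \<odot>\<^bsub>tensor K C C\<^esub> tensor_elem K C C x y"
      using linear_smult[OF bilinear_left[OF tensor_elem_bilinear[OF modC modC] Dc[OF xy(3)] linear_id] a Dc[OF xy(2)]] .
    with xy submodule_smult[OF D a xy(2)] show ?thesis by blast
  qed
  have "\<exists>ts. set ts \<subseteq> ?G \<and> comult C d = lsum (tensor K C C) ts"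
    by (rule module_span_lsum[OF modT closed _ span]) (rule smult)
  then obtain ts where ts: "set ts \<subseteq> ?G" "comult C d = lsum (tensor K C C) ts"
    by (elim exE conjE)
  have "\<exists>xs. set xs \<subseteq> D \<times> D \<and> ts = map (\<lambda>(x, y). tensor_elem K C C x y) xs"
    using ts(1)
  proof (induction ts)
    case (Cons t ts)
    have t: "t \<in> ?G" and "set ts \<subseteq> ?G" using Cons.prems by simp_all
    then have "\<exists>xs. set xs \<subseteq> D \<times> D \<and> ts = map (\<lambda>(x, y). tensor_elem K C C x y) xs"
      by (intro Cons.IH)
    then obtain xs where "set xs \<subseteq> D \<times> D" "ts = map (\<lambda>(x, y). tensor_elem K C C x y) xs"
      by (elim exE conjE)
    moreover obtain x y where "t = tensor_elem K C C x y" "x \<in> D" "y \<in> D"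
      using t by (elim CollectE exE conjE)
    ultimately show ?case by (intro exI[of _ "(x, y) # xs"]) simp
  qed simp
  with ts show ?thesis by (auto simp: tensor_sum_def)
qed

lemma subcoalgebra_submodule: "subcoalgebra K C D \<Longrightarrow> submodule D K C"
  by (simp add: subcoalgebra_def)

lemma subcoalgebra_carrier: "subcoalgebra K C D \<Longrightarrow> x \<in> D \<Longrightarrow> x \<in> carrier C"
  by (rule submodule_carrier[OF subcoalgebra_submodule])

text \<open>Bilinearity allows the chosen presentation to be exchanged for one inside
  \<open>D\<close>, for which each summand lies in \<open>U\<close>.\<close>

lemma sweedler_subcoalgebra_mem:
  assumes "subcoalgebra K C D" "d \<in> D" "module K P" "\<beta> \<in> bilinear_maps K C C P" "submodule U K P"
    and "\<And>x y. x \<in> D \<Longrightarrow> y \<in> D \<Longrightarrow> \<beta> x y \<in> U"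
  shows "sweedler P d \<beta> \<in> U"
proof -
  obtain xs where xs: "set xs \<subseteq> D \<times> D" "comult C d = tensor_sum K C C xs"
    using subcoalgebra_pairs[OF assms(1,2)] by blast
  have "sweedler P d \<beta> = lsum P (map (\<lambda>(x, y). \<beta> x y) xs)"
    by (rule sweedler_eq_lsum[OF assms(3,4)]) (use xs subcoalgebra_carrier[OF assms(1)] assms(2) in auto)
  also have "\<dots> \<in> U"
    by (rule submodule_lsum[OF assms(3,5)]) (use xs assms(6) in auto)
  finally show ?thesis .
qed

lemma sweedler_subcoalgebra_cong:
  assumes "subcoalgebra K C D" "d \<in> D" "module K P" "\<beta> \<in> bilinear_maps K C C P" "\<gamma> \<in> bilinear_maps K C C P"
    and "\<And>x y. x \<in> D \<Longrightarrow> y \<in> D \<Longrightarrow> \<beta> x y = \<gamma> x y"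
  shows "sweedler P d \<beta> = sweedler P d \<gamma>"
proof -
  obtain xs where xs: "set xs \<subseteq> D \<times> D" "comult C d = tensor_sum K C C xs"
    using subcoalgebra_pairs[OF assms(1,2)] by blast
  have xs': "set xs \<subseteq> carrier C \<times> carrier C" "d \<in> carrier C"
    using xs subcoalgebra_carrier[OF assms(1)] assms(2) by auto
  have "map (\<lambda>(x, y). \<beta> x y) xs = map (\<lambda>(x, y). \<gamma> x y) xs"
    using xs assms(6) by auto
  from arg_cong[OF this, of "lsum P"] show ?thesis
    using sweedler_eq_lsum[OF assms(3,4) xs'(2,1) xs(2)] sweedler_eq_lsum[OF assms(3,5) xs'(2,1) xs(2)]
    by simp
qed

section \<open>The two actions of the dual on a coalgebra\<close>

definition lhit :: "('b \<Rightarrow> 'a) \<Rightarrow> 'b \<Rightarrow> 'b" where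
  "lhit \<phi> c = sweedler C c (\<lambda>x y. \<phi> x \<odot>\<^bsub>C\<^esub> y)"

text \<open>These are the usual hit actions of the convolution algebra. The letter tells which
  tensor factor of \<Delta> c the functional is evaluated on: \<open>lhit\<close> is (\<phi>
  \<otimes> id) \<Delta> and \<open>rhit\<close> is (id \<otimes> \<phi>) \<Delta>.\<close>

definition rhit :: "('b \<Rightarrow> 'a) \<Rightarrow> 'b \<Rightarrow> 'b" where
  "rhit \<phi> c = sweedler C c (\<lambda>x y. \<phi> y \<odot>\<^bsub>C\<^esub> x)"

lemma lhit_bilinear: "\<phi> \<in> dual \<Longrightarrow> (\<lambda>x y. \<phi> x \<odot>\<^bsub>C\<^esub> y) \<in> bilinear_maps K C C C"
  by (rule bilinear_mapsI)
    (auto intro!: smult_linear_right[OF modC] smult_linear_left[OF modC] linear_id dest: dual_closed)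

lemma rhit_bilinear: "\<phi> \<in> dual \<Longrightarrow> (\<lambda>x y. \<phi> y \<odot>\<^bsub>C\<^esub> x) \<in> bilinear_maps K C C C"
  by (rule bilinear_mapsI)
    (auto intro!: smult_linear_right[OF modC] smult_linear_left[OF modC] linear_id dest: dual_closed)

lemma lhit_linear: "\<phi> \<in> dual \<Longrightarrow> lhit \<phi> \<in> linear_maps K C C"
  unfolding lhit_def[abs_def] by (rule sweedler_linear[OF modC lhit_bilinear linear_id modC])

lemma rhit_linear: "\<phi> \<in> dual \<Longrightarrow> rhit \<phi> \<in> linear_maps K C C"
  unfolding rhit_def[abs_def] by (rule sweedler_linear[OF modC rhit_bilinear linear_id modC])

lemma hit_counit:
  assumes "c \<in> carrier C"
  shows "lhit (counit C) c = c" "rhit (counit C) c = c"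
  unfolding lhit_def rhit_def
  using sweedler_counit_left[OF modC linear_id assms] sweedler_counit_right[OF modC linear_id assms] by auto

text \<open>By coassociativity both sides are
  \<open>\<Sum> \<phi> c\<^sub>1 \<psi> c\<^sub>3 c\<^sub>2\<close>.\<close>

lemma lhit_rhit_commute:
  assumes \<phi>: "\<phi> \<in> dual" and \<psi>: "\<psi> \<in> dual" and c: "c \<in> carrier C"
  shows "lhit \<phi> (rhit \<psi> c) = rhit \<psi> (lhit \<phi> c)"
proof -
  note cl = dual_closed[OF \<phi>] dual_closed[OF \<psi>]
  have comm: "\<psi> z \<odot>\<^bsub>C\<^esub> (\<phi> x \<odot>\<^bsub>C\<^esub> y) = \<phi> x \<odot>\<^bsub>C\<^esub> (\<psi> z \<odot>\<^bsub>C\<^esub> y)"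
    if "x \<in> carrier C" "y \<in> carrier C" "z \<in> carrier C" for x y z
    using that cl by (simp add: m_comm flip: smult_assoc1)
  have "lhit \<phi> (rhit \<psi> c) = sweedler C c (\<lambda>w z. lhit \<phi> (\<psi> z \<odot>\<^bsub>C\<^esub> w))"
    unfolding rhit_def by (rule sweedler_image[OF modC modC lhit_linear[OF \<phi>] c]) (use cl in auto)
  also have "\<dots> = sweedler C c (\<lambda>w z. sweedler C w (\<lambda>x y. \<psi> z \<odot>\<^bsub>C\<^esub> (\<phi> x \<odot>\<^bsub>C\<^esub> y)))"
  proof (rule sweedler_cong[OF c])
    fix w z assume wz: "w \<in> carrier C" "z \<in> carrier C"
    then have "lhit \<phi> (\<psi> z \<odot>\<^bsub>C\<^esub> w) = \<psi> z \<odot>\<^bsub>C\<^esub> lhit \<phi> w"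
      using linear_smult[OF lhit_linear[OF \<phi>]] cl by blast
    also have "\<dots> = sweedler C w (\<lambda>x y. \<psi> z \<odot>\<^bsub>C\<^esub> (\<phi> x \<odot>\<^bsub>C\<^esub> y))"
      unfolding lhit_def by (rule sweedler_smult[OF modC]) (use wz cl in auto)
    finally show "lhit \<phi> (\<psi> z \<odot>\<^bsub>C\<^esub> w) = sweedler C w (\<lambda>x y. \<psi> z \<odot>\<^bsub>C\<^esub> (\<phi> x \<odot>\<^bsub>C\<^esub> y))" .
  qed
  also have "\<dots> = sweedler C c (\<lambda>x w. sweedler C w (\<lambda>y z. \<psi> z \<odot>\<^bsub>C\<^esub> (\<phi> x \<odot>\<^bsub>C\<^esub> y)))"
    by (rule sweedler_coassoc[OF modC c])
      (use cl in \<open>auto intro!: smult_linear_right[OF modC] smult_linear_left[OF modC] linear_id \<phi> \<psi>\<close>)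
  also have "\<dots> = sweedler C c (\<lambda>x w. \<phi> x \<odot>\<^bsub>C\<^esub> rhit \<psi> w)"
  proof (rule sweedler_cong[OF c])
    fix x w assume xw: "x \<in> carrier C" "w \<in> carrier C"
    have "\<phi> x \<odot>\<^bsub>C\<^esub> rhit \<psi> w = sweedler C w (\<lambda>y z. \<phi> x \<odot>\<^bsub>C\<^esub> (\<psi> z \<odot>\<^bsub>C\<^esub> y))"
      unfolding rhit_def by (rule sweedler_smult[OF modC]) (use xw cl in auto)
    also have "\<dots> = sweedler C w (\<lambda>y z. \<psi> z \<odot>\<^bsub>C\<^esub> (\<phi> x \<odot>\<^bsub>C\<^esub> y))"
      by (rule sweedler_cong[OF xw(2)]) (use xw comm in auto)
    finally show "sweedler C w (\<lambda>y z. \<psi> z \<odot>\<^bsub>C\<^esub> (\<phi> x \<odot>\<^bsub>C\<^esub> y)) = \<phi> x \<odot>\<^bsub>C\<^esub> rhit \<psi> w" by simp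
  qed
  also have "\<dots> = sweedler C c (\<lambda>x w. rhit \<psi> (\<phi> x \<odot>\<^bsub>C\<^esub> w))"
    by (rule sweedler_cong[OF c]) (simp add: linear_smult[OF rhit_linear[OF \<psi>]] cl)
  also have "\<dots> = rhit \<psi> (lhit \<phi> c)"
    unfolding lhit_def by (rule sweedler_image[OF modC modC rhit_linear[OF \<psi>] c, symmetric]) (use cl in auto)
  finally show ?thesis .
qed

text \<open>Both sides are the convolution product
  \<open>\<Sum> \<phi> c\<^sub>1 \<psi> c\<^sub>2\<close>.\<close>

lemma functional_rhit:
  assumes \<phi>: "\<phi> \<in> dual" and \<psi>: "\<psi> \<in> dual" and c: "c \<in> carrier C"
  shows "\<phi> (rhit \<psi> c) = \<psi> (lhit \<phi> c)"
proof -
  note cl = dual_closed[OF \<phi>] dual_closed[OF \<psi>]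
  have "\<phi> (rhit \<psi> c) = sweedler (self_module K) c (\<lambda>x y. \<phi> (\<psi> y \<odot>\<^bsub>C\<^esub> x))"
    unfolding rhit_def by (rule sweedler_image[OF modC modK \<phi> c]) (use cl in auto)
  also have "\<dots> = sweedler (self_module K) c (\<lambda>x y. \<psi> (\<phi> x \<odot>\<^bsub>C\<^esub> y))"
    by (rule sweedler_cong[OF c]) (simp add: linear_smult[OF \<phi>] linear_smult[OF \<psi>] cl m_comm)
  also have "\<dots> = \<psi> (lhit \<phi> c)"
    unfolding lhit_def by (rule sweedler_image[OF modC modK \<psi> c, symmetric]) (use cl in auto)
  finally show ?thesis .
qed

lemma subcoalgebra_hit:
  assumes "subcoalgebra K C D" "d \<in> D" "\<phi> \<in> dual"
  shows "lhit \<phi> d \<in> D" "rhit \<phi> d \<in> D"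
proof -
  have D: "submodule D K C" by (rule subcoalgebra_submodule[OF assms(1)])
  show "lhit \<phi> d \<in> D"
    unfolding lhit_def
    by (rule sweedler_subcoalgebra_mem[OF assms(1,2) modC lhit_bilinear[OF assms(3)] D])
      (auto intro!: submodule_smult[OF D] dual_closed[OF assms(3)] subcoalgebra_carrier[OF assms(1)])
  show "rhit \<phi> d \<in> D"
    unfolding rhit_def
    by (rule sweedler_subcoalgebra_mem[OF assms(1,2) modC rhit_bilinear[OF assms(3)] D])
      (auto intro!: submodule_smult[OF D] dual_closed[OF assms(3)] subcoalgebra_carrier[OF assms(1)])
qed

text \<open>The converse of \<open>subcoalgebra_hit\<close>: the two stability conditions are the
  slice conditions of \<open>tensor_span_both\<close> for \<Delta> d. Subcoalgebras are thus the
  subbimodules for the dual.\<close>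

lemma subcoalgebraI:
  assumes "submodule D K C"
    and "\<And>\<phi> d. \<phi> \<in> dual \<Longrightarrow> d \<in> D \<Longrightarrow> lhit \<phi> d \<in> D"
    and "\<And>\<phi> d. \<phi> \<in> dual \<Longrightarrow> d \<in> D \<Longrightarrow> rhit \<phi> d \<in> D"
  shows "subcoalgebra K C D"
  unfolding subcoalgebra_def
proof (intro conjI assms(1) image_subsetI)
  fix d assume d: "d \<in> D"
  then have dc: "d \<in> carrier C" by (rule submodule_carrier[OF assms(1)])
  have "tensor_sum K C C (comult_pairs d)
      \<in> module_span K (tensor K C C) {tensor_elem K C C x y | x y. x \<in> D \<and> y \<in> D}"
    by (rule tensor_span_both[OF fieldK modC assms(1) comult_pairs(1)[OF dc]])
      (use assms(2,3) d in \<open>simp_all add: lhit_def rhit_def sweedler_def\<close>)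
  then show "comult C d \<in> module_span K (tensor K C C) {tensor_elem K C C x y | x y. x \<in> D \<and> y \<in> D}"
    using comult_pairs(2)[OF dc] by simp
qed

text \<open>As \<Delta> d has a presentation with factors in \<open>D\<close>, only the restriction
  of a functional to \<open>D\<close> matters for its action on \<open>D\<close>.\<close>

lemma hit_agree:
  assumes "subcoalgebra K C D" "d \<in> D" "\<phi> \<in> dual" "\<psi> \<in> dual" "\<And>x. x \<in> D \<Longrightarrow> \<phi> x = \<psi> x"
  shows "lhit \<phi> d = lhit \<psi> d" "rhit \<phi> d = rhit \<psi> d"
  unfolding lhit_def rhit_def
  using sweedler_subcoalgebra_cong[OF assms(1,2) modC lhit_bilinear[OF assms(3)] lhit_bilinear[OF assms(4)]]
    sweedler_subcoalgebra_cong[OF assms(1,2) modC rhit_bilinear[OF assms(3)] rhit_bilinear[OF assms(4)]]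
    assms(5) by auto

text \<open>Comparison with the counit, which acts as the identity. Together with
  \<open>hit_zero_on\<close> this turns functionals into projections between subcoalgebras.\<close>

lemma hit_agree_counit:
  assumes "subcoalgebra K C D" "d \<in> D" "\<phi> \<in> dual" "\<And>x. x \<in> D \<Longrightarrow> \<phi> x = counit C x"
  shows "lhit \<phi> d = d" "rhit \<phi> d = d"
  using hit_agree[OF assms(1,2,3) counit_linear assms(4)] hit_counit[OF subcoalgebra_carrier[OF assms(1,2)]]
  by auto

lemma hit_zero_on:
  assumes "subcoalgebra K C D" "d \<in> D" "\<phi> \<in> dual" "\<And>x. x \<in> D \<Longrightarrow> \<phi> x = \<zero>\<^bsub>K\<^esub>"
  shows "lhit \<phi> d = \<zero>\<^bsub>C\<^esub>" "rhit \<phi> d = \<zero>\<^bsub>C\<^esub>"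
proof -
  have z: "(\<lambda>x. \<zero>\<^bsub>K\<^esub>) \<in> dual" using linear_const_zero[OF modK, of C] by simp
  have d: "d \<in> carrier C" by (rule subcoalgebra_carrier[OF assms(1,2)])
  have "lhit (\<lambda>x. \<zero>\<^bsub>K\<^esub>) d = \<zero>\<^bsub>C\<^esub>" "rhit (\<lambda>x. \<zero>\<^bsub>K\<^esub>) d = \<zero>\<^bsub>C\<^esub>"
    unfolding lhit_def rhit_def by (rule sweedler_zero[OF modC d]; simp)+
  then show "lhit \<phi> d = \<zero>\<^bsub>C\<^esub>" "rhit \<phi> d = \<zero>\<^bsub>C\<^esub>"
    using hit_agree[OF assms(1,2,3) z assms(4)] by auto
qed

end

subsection \<open>Sums, intersections and complements of subcoalgebras\<close>

context coalgebra
begin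

lemma subcoalgebra_Int:
  assumes "subcoalgebra K C D" "subcoalgebra K C E"
  shows "subcoalgebra K C (D \<inter> E)"
proof (rule subcoalgebraI)
  show "submodule (D \<inter> E) K C"
    by (rule submodule_Int[OF modC subcoalgebra_submodule[OF assms(1)] subcoalgebra_submodule[OF assms(2)]])
qed (auto intro: subcoalgebra_hit[OF assms(1)] subcoalgebra_hit[OF assms(2)])

text \<open>A map that preserves every member of the family preserves its span, because the preimage
  of the span is a submodule containing the family. This is applied to the two actions.\<close>

lemma subcoalgebra_span_Union:
  assumes "\<And>D. D \<in> \<S> \<Longrightarrow> subcoalgebra K C D"
  shows "subcoalgebra K C (module_span K C (\<Union>\<S>))"
proof -
  let ?S = "module_span K C (\<Union>\<S>)"
  have sub: "\<Union>\<S> \<subseteq> carrier C" using subcoalgebra_carrier[OF assms] by blast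
  have S: "submodule ?S K C" by (rule module_span_submodule[OF modC sub])
  have *: "f d \<in> ?S" if "f \<in> linear_maps K C C" "\<And>D d. D \<in> \<S> \<Longrightarrow> d \<in> D \<Longrightarrow> f d \<in> D" "d \<in> ?S" for f d
  proof -
    have "\<Union>\<S> \<subseteq> {x \<in> carrier C. f x \<in> ?S}"
      using sub that(2) subsetD[OF module_span_incl, of _ "\<Union>\<S>" K C] by blast
    then have "?S \<subseteq> {x \<in> carrier C. f x \<in> ?S}"
      by (rule module_span_least[OF linear_kernel_submodule[OF modC modC that(1) S]])
    then show ?thesis using that(3) by blast
  qed
  show ?thesis
    by (rule subcoalgebraI[OF S])
      (rule *[OF lhit_linear] *[OF rhit_linear]; use subcoalgebra_hit[OF assms] in blast)+
qed

lemma subcoalgebra_Union_chain: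
  assumes "subset.chain {D. subcoalgebra K C D} \<C>" "\<C> \<noteq> {}"
  shows "subcoalgebra K C (\<Union>\<C>)"
proof -
  have sub: "subcoalgebra K C D" if "D \<in> \<C>" for D using assms(1) that by (auto simp: subset_chain_def)
  have two: "\<exists>D\<in>\<C>. x \<in> D \<and> y \<in> D" if "x \<in> \<Union>\<C>" "y \<in> \<Union>\<C>" for x y
    using assms(1) that unfolding subset_chain_def by blast
  show ?thesis
  proof (rule subcoalgebraI)
    show "submodule (\<Union>\<C>) K C"
    proof (rule submoduleI')
      show "\<Union>\<C> \<subseteq> carrier C" using subcoalgebra_carrier[OF sub] by blast
      show "\<zero>\<^bsub>C\<^esub> \<in> \<Union>\<C>" using assms(2) submodule_zero[OF subcoalgebra_submodule[OF sub]] by blast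
    next
      fix x y assume "x \<in> \<Union>\<C>" "y \<in> \<Union>\<C>"
      from two[OF this] obtain D where D: "D \<in> \<C>" "x \<in> D" "y \<in> D" by blast
      from submodule_add[OF subcoalgebra_submodule[OF sub[OF D(1)]] D(2,3)] D(1)
      show "x \<oplus>\<^bsub>C\<^esub> y \<in> \<Union>\<C>" by blast
    next
      fix a x assume a: "a \<in> carrier K" and "x \<in> \<Union>\<C>"
      then obtain D where D: "D \<in> \<C>" "x \<in> D" by blast
      from submodule_smult[OF subcoalgebra_submodule[OF sub[OF D(1)]] a D(2)] D(1)
      show "a \<odot>\<^bsub>C\<^esub> x \<in> \<Union>\<C>" by blast
    qed
  qed (use subcoalgebra_hit[OF sub] in blast)+
qed

text \<open>A functional vanishing on \<open>A\<close> and equal to the counit on one summand \<open>D\<close> acts on a sum in \<open>A\<close>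
  by zero and fixes its component in \<open>D\<close>, so that this component can be removed from the sum.\<close>

lemma disjoint_span_Union:
  assumes A: "subcoalgebra K C A" and \<S>: "\<And>D. D \<in> \<S> \<Longrightarrow> subcoalgebra K C D"
    and disj: "\<And>D. D \<in> \<S> \<Longrightarrow> A \<inter> D = {\<zero>\<^bsub>C\<^esub>}"
  shows "A \<inter> module_span K C (\<Union>\<S>) = {\<zero>\<^bsub>C\<^esub>}"
proof -
  have sub: "\<Union>\<S> \<subseteq> carrier C" using subcoalgebra_carrier[OF \<S>] by blast
  \<comment> \<open>The tail of the list gets changed before the induction hypothesis is used, so
    the induction runs over the length.\<close>
  have key: "lsum C xs = \<zero>\<^bsub>C\<^esub>" if "length xs = n" "set xs \<subseteq> \<Union>\<S>" "lsum C xs \<in> A" for n xs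
    using that
  proof (induction n arbitrary: xs)
    case 0
    then show ?case by simp
  next
    case (Suc n)
    then obtain d ys where xs: "xs = d # ys" "length ys = n" by (cases xs) auto
    then obtain D where D: "D \<in> \<S>" "d \<in> D" and ys: "set ys \<subseteq> \<Union>\<S>" using Suc.prems by auto
    obtain \<phi> where \<phi>: "\<phi> \<in> dual" "\<And>x. x \<in> A \<Longrightarrow> \<phi> x = \<zero>\<^bsub>K\<^esub>" "\<And>x. x \<in> D \<Longrightarrow> \<phi> x = counit C x"
      using functional_on_disjoint_sum[OF fieldK modC subcoalgebra_submodule[OF A]
          subcoalgebra_submodule[OF \<S>[OF D(1)]] disj[OF D(1)] counit_linear] by blast
    \<comment> \<open>The map \<open>?h\<close> kills \<open>d\<close>, fixes the total sum, which
      lies in \<open>A\<close>, and preserves every subcoalgebra. The sum is thereby rewritten with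
      one entry fewer.\<close>
    let ?h = "\<lambda>x. x \<ominus>\<^bsub>C\<^esub> rhit \<phi> x"
    have h: "?h \<in> linear_maps K C C" by (rule linear_diff[OF modC modC linear_id rhit_linear[OF \<phi>(1)]])
    have dc: "d \<in> carrier C" and ysc: "set ys \<subseteq> carrier C" using D sub ys by auto
    have yc: "lsum C ys \<in> carrier C" using ysc by (rule lsum_closed)
    have rc: "rhit \<phi> (lsum C ys) \<in> carrier C" by (rule linear_closed[OF rhit_linear[OF \<phi>(1)] yc])
    have "d \<oplus>\<^bsub>C\<^esub> rhit \<phi> (lsum C ys) = rhit \<phi> (d \<oplus>\<^bsub>C\<^esub> lsum C ys)"
      using linear_add[OF rhit_linear[OF \<phi>(1)] dc yc] hit_agree_counit(2)[OF \<S>[OF D(1)] D(2) \<phi>(1,3)]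
      by simp
    also have "\<dots> = \<zero>\<^bsub>C\<^esub>"
      using hit_zero_on(2)[OF A _ \<phi>(1,2)] Suc.prems xs by simp
    finally have "d = \<ominus>\<^bsub>C\<^esub> rhit \<phi> (lsum C ys)"
      using dc rc by (metis M.minus_equality M.minus_minus M.a_comm)
    then have "lsum C xs = ?h (lsum C ys)"
      using xs yc rc by (simp add: a_minus_def M.a_comm)
    also have "\<dots> = lsum C (map ?h ys)" by (rule linear_lsum[OF modC modC h ysc])
    finally have eq: "lsum C xs = lsum C (map ?h ys)" .
    have "set (map ?h ys) \<subseteq> \<Union>\<S>"
    proof
      fix z assume "z \<in> set (map ?h ys)"
      then obtain y where y: "y \<in> set ys" "z = ?h y" by auto
      with ys obtain E where E: "E \<in> \<S>" "y \<in> E" by auto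
      have "z \<in> E"
        unfolding y(2) by (rule submodule_minus[OF modC subcoalgebra_submodule[OF \<S>[OF E(1)]] E(2)
              subcoalgebra_hit(2)[OF \<S>[OF E(1)] E(2) \<phi>(1)]])
      with E show "z \<in> \<Union>\<S>" by blast
    qed
    then have "lsum C (map ?h ys) = \<zero>\<^bsub>C\<^esub>"
      by (rule Suc.IH[rotated]) (use xs Suc.prems eq in auto)
    with eq show ?case by simp
  qed
  show ?thesis
  proof
    show "A \<inter> module_span K C (\<Union>\<S>) \<subseteq> {\<zero>\<^bsub>C\<^esub>}"
    proof
      fix x assume x: "x \<in> A \<inter> module_span K C (\<Union>\<S>)"
      have "\<exists>xs. set xs \<subseteq> \<Union>\<S> \<and> x = lsum C xs"
        by (rule module_span_lsum[OF modC sub])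
          (use x submodule_smult[OF subcoalgebra_submodule[OF \<S>]] in auto)
      then show "x \<in> {\<zero>\<^bsub>C\<^esub>}" using key x by auto
    qed
    show "{\<zero>\<^bsub>C\<^esub>} \<subseteq> A \<inter> module_span K C (\<Union>\<S>)"
      using submodule_zero[OF subcoalgebra_submodule[OF A]] submodule_zero[OF module_span_submodule[OF modC sub]]
      by simp
  qed
qed

definition complementary :: "'b set \<Rightarrow> 'b set \<Rightarrow> bool" where
  "complementary A B \<longleftrightarrow> A \<inter> B = {\<zero>\<^bsub>C\<^esub>} \<and> (\<forall>x\<in>carrier C. \<exists>a\<in>A. \<exists>b\<in>B. x = a \<oplus>\<^bsub>C\<^esub> b)"

text \<open>For c = a + b with \<open>a\<close> in \<open>A\<close> and \<open>b\<close> in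
  \<open>B\<close>, either action of \<open>q\<close> fixes \<open>a\<close> and kills
  \<open>b\<close>. Both therefore equal the projection onto \<open>A\<close> along
  \<open>B\<close>; that they agree is what later lets an expression be recognized from the left or
  from the right.\<close>

lemma complementary_functional:
  assumes A: "subcoalgebra K C A" and B: "subcoalgebra K C B" and AB: "complementary A B"
  shows "\<exists>q\<in>dual. (\<forall>a\<in>A. q a = counit C a) \<and> (\<forall>b\<in>B. q b = \<zero>\<^bsub>K\<^esub>) \<and>
    (\<forall>c\<in>carrier C. lhit q c \<in> A \<and> rhit q c = lhit q c)"
proof -
  have "B \<inter> A = {\<zero>\<^bsub>C\<^esub>}" using AB by (auto simp: complementary_def)
  then obtain q where q: "q \<in> dual" "\<And>x. x \<in> B \<Longrightarrow> q x = \<zero>\<^bsub>K\<^esub>" "\<And>x. x \<in> A \<Longrightarrow> q x = counit C x"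
    using functional_on_disjoint_sum[OF fieldK modC subcoalgebra_submodule[OF B] subcoalgebra_submodule[OF A]
        _ counit_linear] by blast
  have "lhit q c \<in> A \<and> rhit q c = lhit q c" if c: "c \<in> carrier C" for c
  proof -
    obtain a b where ab: "a \<in> A" "b \<in> B" "c = a \<oplus>\<^bsub>C\<^esub> b"
      using AB c unfolding complementary_def by blast
    note [simp] = subcoalgebra_carrier[OF A ab(1)] subcoalgebra_carrier[OF B ab(2)]
    have "lhit q c = a" "rhit q c = a"
      using linear_add[OF lhit_linear[OF q(1)], of a b] linear_add[OF rhit_linear[OF q(1)], of a b]
        hit_agree_counit[OF A ab(1) q(1,3)] hit_zero_on[OF B ab(2) q(1,2)] ab(3) by simp_all
    with ab show ?thesis by simp
  qed
  with q show ?thesis by blast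
qed

text \<open>\<open>B\<close> is spanned by the simple subcoalgebras that are not contained in
  \<open>A\<close>. Such a simple subcoalgebra meets \<open>A\<close> in a proper subcoalgebra of
  itself, hence in zero, and \<open>disjoint_span_Union\<close> passes this to the span. Each simple
  subcoalgebra lies in \<open>A\<close> or in \<open>B\<close>, so A + B is everything.\<close>

lemma cosemisimple_complement:
  assumes sum: "is_direct_sum C {D. simple_subcoalgebra K C D}" and A: "subcoalgebra K C A"
  shows "\<exists>B. subcoalgebra K C B \<and> complementary A B"
proof -
  define \<S> where "\<S> = {D. simple_subcoalgebra K C D \<and> \<not> D \<subseteq> A}"
  define B where "B = module_span K C (\<Union>\<S>)"
  have sub: "subcoalgebra K C D" if "D \<in> \<S>" for D
    using that by (simp add: \<S>_def simple_subcoalgebra_def)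
  have B: "subcoalgebra K C B" unfolding B_def by (rule subcoalgebra_span_Union[OF sub])
  have "A \<inter> D = {\<zero>\<^bsub>C\<^esub>}" if D: "D \<in> \<S>" for D
  proof -
    have "subcoalgebra K C (A \<inter> D)" by (rule subcoalgebra_Int[OF A sub[OF D]])
    then have "A \<inter> D = {\<zero>\<^bsub>C\<^esub>} \<or> A \<inter> D = D"
      using D unfolding \<S>_def simple_subcoalgebra_def by blast
    then show ?thesis using D unfolding \<S>_def by blast
  qed
  then have disj: "A \<inter> B = {\<zero>\<^bsub>C\<^esub>}" unfolding B_def by (intro disjoint_span_Union[OF A sub])
  note sA = subcoalgebra_submodule[OF A] and sB = subcoalgebra_submodule[OF B]
  have "\<exists>a\<in>A. \<exists>b\<in>B. x = a \<oplus>\<^bsub>C\<^esub> b" if x: "x \<in> carrier C" for x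
  proof -
    let ?N = "{a \<oplus>\<^bsub>C\<^esub> b | a b. a \<in> A \<and> b \<in> B}"
    obtain f where f: "f \<in> (\<Pi>\<^sub>E D\<in>{D. simple_subcoalgebra K C D}. D)"
      "finite {D \<in> {D. simple_subcoalgebra K C D}. f D \<noteq> \<zero>\<^bsub>C\<^esub>}"
      "x = (\<Oplus>\<^bsub>C\<^esub>D\<in>{D \<in> {D. simple_subcoalgebra K C D}. f D \<noteq> \<zero>\<^bsub>C\<^esub>}. f D)"
      using bspec[OF sum[unfolded is_direct_sum_def] x] by (elim ex1E conjE)
    have "x \<in> ?N"
      unfolding f(3)
    proof (rule submodule_finsum[OF modC submodule_sum[OF modC sA sB] f(2)])
      fix D assume "D \<in> {D \<in> {D. simple_subcoalgebra K C D}. f D \<noteq> \<zero>\<^bsub>C\<^esub>}"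
      then have D: "simple_subcoalgebra K C D" and fD: "f D \<in> D" using f(1) by auto
      have c: "f D \<in> carrier C"
        using D fD subcoalgebra_carrier by (auto simp: simple_subcoalgebra_def)
      show "f D \<in> ?N"
      proof (cases "D \<subseteq> A")
        case True
        have "f D = f D \<oplus>\<^bsub>C\<^esub> \<zero>\<^bsub>C\<^esub>" using c by simp
        with True fD submodule_zero[OF sB] show ?thesis by blast
      next
        case False
        then have "f D \<in> \<Union>\<S>" using D fD unfolding \<S>_def by blast
        then have "f D \<in> B" unfolding B_def by (rule subsetD[OF module_span_incl])
        moreover have "f D = \<zero>\<^bsub>C\<^esub> \<oplus>\<^bsub>C\<^esub> f D" using c by simp
        ultimately show ?thesis using submodule_zero[OF sA] by blast
      qed
    qed
    then show ?thesis by blast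
  qed
  with B disj show ?thesis unfolding complementary_def by blast
qed

subsection \<open>Complemented subcoalgebras and cosemisimplicity\<close>

text \<open>Entries of the list that belong to the same summand are merged into one
  coordinate.\<close>

lemma decomposition_exists:
  assumes \<S>: "\<And>D. D \<in> \<S> \<Longrightarrow> submodule D K C" and xs: "set xs \<subseteq> \<Union>\<S>"
  shows "\<exists>f. f \<in> (\<Pi>\<^sub>E D\<in>\<S>. D) \<and> finite {D \<in> \<S>. f D \<noteq> \<zero>\<^bsub>C\<^esub>} \<and>
     lsum C xs = (\<Oplus>\<^bsub>C\<^esub>D\<in>{D \<in> \<S>. f D \<noteq> \<zero>\<^bsub>C\<^esub>}. f D)"
  using xs
proof (induction xs)
  case Nil
  show ?case
    by (rule exI[of _ "\<lambda>D\<in>\<S>. \<zero>\<^bsub>C\<^esub>"]) (auto intro: submodule_zero[OF \<S>] simp: cong: conj_cong)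
next
  case (Cons d ds)
  then obtain D f where D: "D \<in> \<S>" "d \<in> D" and f: "f \<in> (\<Pi>\<^sub>E D\<in>\<S>. D)"
    "finite {D \<in> \<S>. f D \<noteq> \<zero>\<^bsub>C\<^esub>}" "lsum C ds = (\<Oplus>\<^bsub>C\<^esub>D\<in>{D \<in> \<S>. f D \<noteq> \<zero>\<^bsub>C\<^esub>}. f D)" by auto
  define g where "g = f(D := d \<oplus>\<^bsub>C\<^esub> f D)"
  have fE: "f E \<in> E" if "E \<in> \<S>" for E using f(1) that by auto
  have fc: "f E \<in> carrier C" if "E \<in> \<S>" for E using submodule_carrier[OF \<S>[OF that] fE[OF that]] .
  have dc: "d \<in> carrier C" using submodule_carrier[OF \<S>[OF D(1)] D(2)] .
  have gE: "g E \<in> E" if "E \<in> \<S>" for E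
    using fE[OF that] that submodule_add[OF \<S>[OF D(1)] D(2) fE[OF D(1)]] by (simp add: g_def)
  have gc: "g E \<in> carrier C" if "E \<in> \<S>" for E using submodule_carrier[OF \<S>[OF that] gE[OF that]] .
  \<comment> \<open>Adding \<open>d\<close> may make the coordinate at \<open>D\<close> non-zero or
    cancel it, so neither support need contain the other; both sums are compared over
    \<open>?T\<close>.\<close>
  let ?T = "insert D {E \<in> \<S>. f E \<noteq> \<zero>\<^bsub>C\<^esub>}"
  have T: "finite ?T" "?T \<subseteq> \<S>" using f(2) D by auto
  have "g \<in> (\<Pi>\<^sub>E D\<in>\<S>. D)"
    using f(1) gE D(1) by (auto simp: PiE_iff extensional_def g_def)
  moreover have supp: "{E \<in> \<S>. g E \<noteq> \<zero>\<^bsub>C\<^esub>} \<subseteq> ?T" by (auto simp: g_def)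
  then have "finite {E \<in> \<S>. g E \<noteq> \<zero>\<^bsub>C\<^esub>}" using T(1) by (rule finite_subset)
  moreover have "lsum C (d # ds) = (\<Oplus>\<^bsub>C\<^esub>E\<in>{E \<in> \<S>. g E \<noteq> \<zero>\<^bsub>C\<^esub>}. g E)"
  proof -
    let ?R = "{E \<in> \<S>. f E \<noteq> \<zero>\<^bsub>C\<^esub>} - {D}"
    have R: "finite ?R" "?R \<subseteq> \<S>" "D \<notin> ?R" "?T = insert D ?R" using f(2) by auto
    have "(\<Oplus>\<^bsub>C\<^esub>E\<in>{E \<in> \<S>. g E \<noteq> \<zero>\<^bsub>C\<^esub>}. g E) = (\<Oplus>\<^bsub>C\<^esub>E\<in>?T. g E)"
      by (rule M.add.finprod_mono_neutral_cong_left) (use T supp gc in auto)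
    also have "\<dots> = g D \<oplus>\<^bsub>C\<^esub> (\<Oplus>\<^bsub>C\<^esub>E\<in>?R. g E)"
      unfolding R(4) by (rule M.finsum_insert) (use R D gc in auto)
    also have "(\<Oplus>\<^bsub>C\<^esub>E\<in>?R. g E) = (\<Oplus>\<^bsub>C\<^esub>E\<in>?R. f E)"
      by (rule M.finsum_cong') (use R fc in \<open>auto simp: g_def\<close>)
    also have "g D \<oplus>\<^bsub>C\<^esub> (\<Oplus>\<^bsub>C\<^esub>E\<in>?R. f E) = d \<oplus>\<^bsub>C\<^esub> (f D \<oplus>\<^bsub>C\<^esub> (\<Oplus>\<^bsub>C\<^esub>E\<in>?R. f E))"
      using dc fc D R by (simp add: g_def M.a_assoc M.finsum_closed Pi_def)
    also have "f D \<oplus>\<^bsub>C\<^esub> (\<Oplus>\<^bsub>C\<^esub>E\<in>?R. f E) = (\<Oplus>\<^bsub>C\<^esub>E\<in>?T. f E)"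
      unfolding R(4) by (rule M.finsum_insert[symmetric]) (use R D fc in auto)
    also have "\<dots> = (\<Oplus>\<^bsub>C\<^esub>E\<in>{E \<in> \<S>. f E \<noteq> \<zero>\<^bsub>C\<^esub>}. f E)"
      by (rule M.add.finprod_mono_neutral_cong_right) (use T fc D in auto)
    finally show ?thesis using f(3) by simp
  qed
  ultimately show ?case by blast
qed

text \<open>If some \<open>x\<close> is outside the span, let \<open>M\<close> be maximal among the
  subcoalgebras that contain the span and avoid \<open>x\<close>. A complement \<open>N\<close> of
  \<open>M\<close> turns out to be simple, so it lies in the span, hence in \<open>M\<close>, and is
  zero; this is the contradiction.\<close>

lemma complemented_imp_spanned_by_simple:
  assumes compl: "\<And>D. subcoalgebra K C D \<Longrightarrow> \<exists>E. subcoalgebra K C E \<and> complementary D E"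
  shows "module_span K C (\<Union>{D. simple_subcoalgebra K C D}) = carrier C"
proof (rule ccontr)
  let ?S = "module_span K C (\<Union>{D. simple_subcoalgebra K C D})"
  assume "?S \<noteq> carrier C"
  have S: "subcoalgebra K C ?S"
    by (rule subcoalgebra_span_Union) (simp add: simple_subcoalgebra_def)
  then obtain x where x: "x \<in> carrier C" "x \<notin> ?S"
    using \<open>?S \<noteq> carrier C\<close> subcoalgebra_carrier[OF S] by blast
  let ?Z = "{D. subcoalgebra K C D \<and> ?S \<subseteq> D \<and> x \<notin> D}"
  have nonempty: "?Z \<noteq> {}" using S x by blast
  have chain: "\<Union>\<C> \<in> ?Z" if "\<C> \<noteq> {}" "subset.chain ?Z \<C>" for \<C>
  proof -
    have "subset.chain {D. subcoalgebra K C D} \<C>" using that(2) unfolding subset_chain_def by blast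
    then have "subcoalgebra K C (\<Union>\<C>)" by (rule subcoalgebra_Union_chain[OF _ that(1)])
    moreover have "?S \<subseteq> \<Union>\<C>" "x \<notin> \<Union>\<C>" using that unfolding subset_chain_def by blast+
    ultimately show ?thesis by blast
  qed
  have "\<exists>M\<in>?Z. \<forall>D\<in>?Z. M \<subseteq> D \<longrightarrow> D = M"
    by (rule subset_Zorn_nonempty[OF nonempty chain])
  then obtain M where "M \<in> ?Z" and maxM: "\<And>D. D \<in> ?Z \<Longrightarrow> M \<subseteq> D \<Longrightarrow> D = M"
    by (elim bexE) simp
  then have M: "subcoalgebra K C M" "?S \<subseteq> M" "x \<notin> M" by auto
  obtain N where N: "subcoalgebra K C N" "complementary M N" using compl[OF M(1)] by blast
  then have MN: "M \<inter> N = {\<zero>\<^bsub>C\<^esub>}" and decomp: "\<And>y. y \<in> carrier C \<Longrightarrow> \<exists>a\<in>M. \<exists>b\<in>N. y = a \<oplus>\<^bsub>C\<^esub> b"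
    by (auto simp: complementary_def)
  note sM = subcoalgebra_submodule[OF M(1)] and sN = subcoalgebra_submodule[OF N(1)]
  have Mc: "y \<in> carrier C" if "y \<in> M" for y by (rule subcoalgebra_carrier[OF M(1) that])
  have Nc: "y \<in> carrier C" if "y \<in> N" for y by (rule subcoalgebra_carrier[OF N(1) that])
  \<comment> \<open>By maximality of \<open>M\<close>, the sum of \<open>M\<close> with any non-zero
    subcoalgebra of \<open>N\<close> is strictly larger than \<open>M\<close> and so must contain
    \<open>x\<close>.\<close>
  have big: "\<exists>m\<in>M. \<exists>v\<in>V. x = m \<oplus>\<^bsub>C\<^esub> v" if V: "subcoalgebra K C V" "V \<subseteq> N" "V \<noteq> {\<zero>\<^bsub>C\<^esub>}" for V
  proof (rule ccontr)
    assume no: "\<not> ?thesis"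
    let ?W = "module_span K C (\<Union>{M, V})"
    have W: "subcoalgebra K C ?W" by (rule subcoalgebra_span_Union) (use M V in auto)
    have incl: "M \<union> V \<subseteq> ?W" using module_span_incl[of "\<Union>{M, V}" K C] by simp
    note sV = subcoalgebra_submodule[OF V(1)]
    have "?W \<subseteq> {m \<oplus>\<^bsub>C\<^esub> v | m v. m \<in> M \<and> v \<in> V}"
    proof (rule module_span_least[OF submodule_sum[OF modC sM sV]])
      show "\<Union>{M, V} \<subseteq> {m \<oplus>\<^bsub>C\<^esub> v | m v. m \<in> M \<and> v \<in> V}"
      proof
        fix y assume "y \<in> \<Union>{M, V}"
        then consider "y \<in> M" | "y \<in> V" by blast
        then show "y \<in> {m \<oplus>\<^bsub>C\<^esub> v | m v. m \<in> M \<and> v \<in> V}"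
        proof cases
          case 1
          then have "y = y \<oplus>\<^bsub>C\<^esub> \<zero>\<^bsub>C\<^esub>" using Mc by simp
          with 1 submodule_zero[OF sV] show ?thesis by blast
        next
          case 2
          then have "y = \<zero>\<^bsub>C\<^esub> \<oplus>\<^bsub>C\<^esub> y" using Nc V by auto
          with 2 submodule_zero[OF sM] show ?thesis by blast
        qed
      qed
    qed
    with no have "x \<notin> ?W" by blast
    then have "?W = M" using maxM[of ?W] W M(2) incl by blast
    then have "V \<subseteq> M \<inter> N" using incl V by blast
    then show False using V MN submodule_zero[OF sV] by blast
  qed
  have "simple_subcoalgebra K C N"
    unfolding simple_subcoalgebra_def
  proof (intro conjI allI impI N(1))
    show "N \<noteq> {\<zero>\<^bsub>C\<^esub>}"
    proof
      assume "N = {\<zero>\<^bsub>C\<^esub>}"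
      with decomp[OF x(1)] obtain a where "a \<in> M" "x = a \<oplus>\<^bsub>C\<^esub> \<zero>\<^bsub>C\<^esub>" by blast
      with Mc M(3) show False by simp
    qed
  next
    fix V assume V: "subcoalgebra K C V \<and> V \<subseteq> N"
    note sV = subcoalgebra_submodule[OF conjunct1[OF V]]
    show "V = {\<zero>\<^bsub>C\<^esub>} \<or> V = N"
    proof (rule disjCI, rule ccontr)
      assume VN: "V \<noteq> N" and V0: "\<not> V = {\<zero>\<^bsub>C\<^esub>}"
      obtain W where W: "subcoalgebra K C W" "complementary V W" using compl V by blast
      have WN: "subcoalgebra K C (W \<inter> N)" by (rule subcoalgebra_Int[OF W(1) N(1)])
      \<comment> \<open>The modular law: for \<open>n\<close> in \<open>N\<close> the component of
        \<open>n\<close> in \<open>W\<close> differs from \<open>n\<close> by an element of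
        \<open>V\<close>, so it lies in both \<open>W\<close> and \<open>N\<close>; were this
        intersection zero, \<open>N\<close> would be contained in \<open>V\<close>.\<close>
      have "W \<inter> N \<noteq> {\<zero>\<^bsub>C\<^esub>}"
      proof
        assume WN0: "W \<inter> N = {\<zero>\<^bsub>C\<^esub>}"
        have "N \<subseteq> V"
        proof
          fix n assume n: "n \<in> N"
          then obtain v w where vw: "v \<in> V" "w \<in> W" "n = v \<oplus>\<^bsub>C\<^esub> w"
            using W(2) Nc unfolding complementary_def by blast
          then have vwc: "v \<in> carrier C" "w \<in> carrier C"
            using V Nc subcoalgebra_carrier[OF W(1)] by auto
          have "n \<ominus>\<^bsub>C\<^esub> v \<in> N" using submodule_minus[OF modC sN n] vw(1) V by blast
          moreover have "n \<ominus>\<^bsub>C\<^esub> v = w"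
            using vw vwc by (simp add: a_minus_def M.a_comm[of v] M.a_assoc M.r_neg)
          ultimately have "w = \<zero>\<^bsub>C\<^esub>" using vw WN0 by blast
          then show "n \<in> V" using vw vwc by simp
        qed
        with V VN show False by blast
      qed
      \<comment> \<open>Now \<open>x\<close> has a component in \<open>N\<close> that comes from
        \<open>V\<close> and one that comes from \<open>W\<close>. As \<open>M\<close> and
        \<open>N\<close> meet only in zero these coincide, so they lie in both \<open>V\<close> and
        \<open>W\<close> and vanish, which puts \<open>x\<close> into \<open>M\<close>.\<close>
      then obtain m' w where w: "m' \<in> M" "w \<in> W \<inter> N" "x = m' \<oplus>\<^bsub>C\<^esub> w"
        using big[OF WN] by blast
      obtain m v where v: "m \<in> M" "v \<in> V" "x = m \<oplus>\<^bsub>C\<^esub> v" using big[of V] V V0 by blast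
      have c: "m \<in> carrier C" "m' \<in> carrier C" "v \<in> carrier C" "w \<in> carrier C"
        using v w V Mc Nc by auto
      have "v \<ominus>\<^bsub>C\<^esub> w = m' \<ominus>\<^bsub>C\<^esub> m"
      proof -
        have "m \<oplus>\<^bsub>C\<^esub> v = m' \<oplus>\<^bsub>C\<^esub> w" using v w by simp
        then have "\<ominus>\<^bsub>C\<^esub> m \<oplus>\<^bsub>C\<^esub> ((m \<oplus>\<^bsub>C\<^esub> v) \<oplus>\<^bsub>C\<^esub> \<ominus>\<^bsub>C\<^esub> w) = \<ominus>\<^bsub>C\<^esub> m \<oplus>\<^bsub>C\<^esub> ((m' \<oplus>\<^bsub>C\<^esub> w) \<oplus>\<^bsub>C\<^esub> \<ominus>\<^bsub>C\<^esub> w)"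
          by simp
        moreover have "\<ominus>\<^bsub>C\<^esub> m \<oplus>\<^bsub>C\<^esub> ((m \<oplus>\<^bsub>C\<^esub> v) \<oplus>\<^bsub>C\<^esub> \<ominus>\<^bsub>C\<^esub> w) = v \<ominus>\<^bsub>C\<^esub> w"
          using c by (simp add: a_minus_def M.a_assoc M.r_neg1)
        moreover have "\<ominus>\<^bsub>C\<^esub> m \<oplus>\<^bsub>C\<^esub> ((m' \<oplus>\<^bsub>C\<^esub> w) \<oplus>\<^bsub>C\<^esub> \<ominus>\<^bsub>C\<^esub> w) = m' \<ominus>\<^bsub>C\<^esub> m"
          using c by (simp add: a_minus_def M.a_assoc M.r_neg) (simp add: M.a_comm)
        ultimately show ?thesis by simp
      qed
      moreover have "v \<ominus>\<^bsub>C\<^esub> w \<in> N" using submodule_minus[OF modC sN] v w V by blast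
      moreover have "m' \<ominus>\<^bsub>C\<^esub> m \<in> M" using submodule_minus[OF modC sM] v w by blast
      ultimately have "v \<ominus>\<^bsub>C\<^esub> w = \<zero>\<^bsub>C\<^esub>" using MN by auto
      then have "v = w" using minus_eq_zero_iff c by blast
      then have "v \<in> V \<inter> W" using v w by blast
      then have "v = \<zero>\<^bsub>C\<^esub>" using W(2) unfolding complementary_def by blast
      then show False using v c M(3) by simp
    qed
  qed
  then have "N \<subseteq> ?S" using module_span_incl[of "\<Union>{D. simple_subcoalgebra K C D}" K C] by blast
  then have "N \<subseteq> {\<zero>\<^bsub>C\<^esub>}" using M(2) MN by blast
  then have "N = {\<zero>\<^bsub>C\<^esub>}" using submodule_zero[OF sN] by blast
  with \<open>simple_subcoalgebra K C N\<close> show False by (simp add: simple_subcoalgebra_def)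
qed

text \<open>Existence of a decomposition is the spanning property. For uniqueness, a complement of a
  simple \<open>D\<close> provides a functional whose action extracts the coordinate at
  \<open>D\<close> from any decomposition.\<close>

lemma complemented_imp_direct_sum:
  assumes compl: "\<And>D. subcoalgebra K C D \<Longrightarrow> \<exists>E. subcoalgebra K C E \<and> complementary D E"
  shows "is_direct_sum C {D. simple_subcoalgebra K C D}"
  unfolding is_direct_sum_def
proof (intro ballI ex_ex1I)
  let ?S = "{D. simple_subcoalgebra K C D}"
  have sub: "subcoalgebra K C D" if "D \<in> ?S" for D using that by (simp add: simple_subcoalgebra_def)
  have Sc: "\<Union>?S \<subseteq> carrier C" using subcoalgebra_carrier[OF sub] by blast
  fix x assume x: "x \<in> carrier C"
  have "\<exists>xs. set xs \<subseteq> \<Union>?S \<and> x = lsum C xs"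
    by (rule module_span_lsum[OF modC Sc])
      (use x complemented_imp_spanned_by_simple[OF compl] submodule_smult[OF subcoalgebra_submodule[OF sub]] in auto)
  then obtain xs where xs: "set xs \<subseteq> \<Union>?S" "x = lsum C xs" by blast
  show "\<exists>f. f \<in> (\<Pi>\<^sub>E D\<in>?S. D) \<and> finite {D \<in> ?S. f D \<noteq> \<zero>\<^bsub>C\<^esub>} \<and>
     x = (\<Oplus>\<^bsub>C\<^esub>D\<in>{D \<in> ?S. f D \<noteq> \<zero>\<^bsub>C\<^esub>}. f D)"
    unfolding xs(2) by (rule decomposition_exists[OF subcoalgebra_submodule[OF sub] xs(1)])
next
  let ?S = "{D. simple_subcoalgebra K C D}"
  have sub: "subcoalgebra K C D" if "D \<in> ?S" for D using that by (simp add: simple_subcoalgebra_def)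
  fix x f g
  assume f: "f \<in> (\<Pi>\<^sub>E D\<in>?S. D) \<and> finite {D \<in> ?S. f D \<noteq> \<zero>\<^bsub>C\<^esub>} \<and>
     x = (\<Oplus>\<^bsub>C\<^esub>D\<in>{D \<in> ?S. f D \<noteq> \<zero>\<^bsub>C\<^esub>}. f D)"
   and g: "g \<in> (\<Pi>\<^sub>E D\<in>?S. D) \<and> finite {D \<in> ?S. g D \<noteq> \<zero>\<^bsub>C\<^esub>} \<and>
     x = (\<Oplus>\<^bsub>C\<^esub>D\<in>{D \<in> ?S. g D \<noteq> \<zero>\<^bsub>C\<^esub>}. g D)"
  show "f = g"
  proof (rule PiE_ext)
    show "f \<in> (\<Pi>\<^sub>E D\<in>?S. D)" "g \<in> (\<Pi>\<^sub>E D\<in>?S. D)" using f g by auto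
    fix D assume D: "D \<in> ?S"
    obtain E where E: "subcoalgebra K C E" "complementary D E" using compl[OF sub[OF D]] by blast
    obtain q where q: "q \<in> dual" "\<And>a. a \<in> D \<Longrightarrow> q a = counit C a" "\<And>c. c \<in> carrier C \<Longrightarrow> lhit q c \<in> D"
      using complementary_functional[OF sub[OF D] E] by blast
    \<comment> \<open>The image of \<open>d\<close> lies in \<open>F\<close>, since subcoalgebras
      are stable, and in \<open>D\<close>, the image of the action of \<open>q\<close>; distinct
      simple subcoalgebras meet only in zero.\<close>
    have other: "lhit q d = \<zero>\<^bsub>C\<^esub>" if F: "F \<in> ?S" "F \<noteq> D" "d \<in> F" for F d
    proof -
      have "lhit q d \<in> F \<inter> D"
        using subcoalgebra_hit(1)[OF sub[OF F(1)] F(3) q(1)] q(3)[OF subcoalgebra_carrier[OF sub[OF F(1)] F(3)]]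
        by blast
      moreover have "F \<inter> D = {\<zero>\<^bsub>C\<^esub>}"
      proof -
        have "subcoalgebra K C (F \<inter> D)" by (rule subcoalgebra_Int[OF sub[OF F(1)] sub[OF D]])
        then have "F \<inter> D = {\<zero>\<^bsub>C\<^esub>} \<or> F \<inter> D = F" "F \<inter> D = {\<zero>\<^bsub>C\<^esub>} \<or> F \<inter> D = D"
          using F(1) D unfolding simple_subcoalgebra_def by blast+
        then show ?thesis using F(2) by blast
      qed
      ultimately show ?thesis by blast
    qed
    have comp: "lhit q (\<Oplus>\<^bsub>C\<^esub>D\<in>{D \<in> ?S. h D \<noteq> \<zero>\<^bsub>C\<^esub>}. h D) = h D"
      if h: "h \<in> (\<Pi>\<^sub>E D\<in>?S. D)" "finite {D \<in> ?S. h D \<noteq> \<zero>\<^bsub>C\<^esub>}" for h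
    proof -
      let ?F = "{D \<in> ?S. h D \<noteq> \<zero>\<^bsub>C\<^esub>}"
      have hE: "h E \<in> E" if "E \<in> ?S" for E using h(1) that by (rule PiE_mem)
      have hc: "h E \<in> carrier C" if "E \<in> ?S" for E using subcoalgebra_carrier[OF sub[OF that] hE[OF that]] .
      have hD: "lhit q (h D) = h D" by (rule hit_agree_counit(1)[OF sub[OF D] hE[OF D] q(1,2)])
      have "lhit q (\<Oplus>\<^bsub>C\<^esub>D\<in>?F. h D) = (\<Oplus>\<^bsub>C\<^esub>D\<in>?F. lhit q (h D))"
        by (rule linear_finsum[OF modC modC lhit_linear[OF q(1)] h(2)]) (use hc in auto)
      also have "\<dots> = (\<Oplus>\<^bsub>C\<^esub>E\<in>{D}. lhit q (h E))"
      proof (rule M.add.finprod_mono_neutral_cong)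
        fix E assume "E \<in> ?F - {D}"
        then show "lhit q (h E) = \<zero>\<^bsub>C\<^esub>" by (intro other[of E] hE) auto
      next
        fix E assume "E \<in> {D} - ?F"
        then show "lhit q (h E) = \<zero>\<^bsub>C\<^esub>" using hD D by auto
      qed (use hc D linear_closed[OF lhit_linear[OF q(1)]] h(2) in auto)
      also have "\<dots> = h D" using hD hc[OF D] by simp
      finally show ?thesis .
    qed
    from f g comp[of f] comp[of g] show "f D = g D" by metis
  qed
qed

subsection \<open>Coseparable coalgebras\<close>

text \<open>For a linear projection \<open>r\<close> onto \<open>D\<close>, the functionals \<open>e c = \<Sum> \<tau> c\<^sub>1 (r c\<^sub>2)\<close> and
  \<open>e' c = \<Sum> \<tau> (r c\<^sub>1) c\<^sub>2\<close> act from the two sides by commuting projections onto \<open>D\<close>. They therefore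
  coincide, and their kernel is a subcoalgebra.\<close>

lemma coseparable_complement:
  assumes \<tau>: "\<tau> \<in> bilinear_maps K C C (self_module K)"
    and \<tau>_counit: "\<And>c. c \<in> carrier C \<Longrightarrow> sweedler (self_module K) c \<tau> = counit C c"
    and \<tau>_balanced: "\<And>c d. c \<in> carrier C \<Longrightarrow> d \<in> carrier C \<Longrightarrow>
      sweedler C c (\<lambda>x y. \<tau> y d \<odot>\<^bsub>C\<^esub> x) = sweedler C d (\<lambda>x y. \<tau> c x \<odot>\<^bsub>C\<^esub> y)"
    and D: "subcoalgebra K C D"
  shows "\<exists>E. subcoalgebra K C E \<and> complementary D E"
proof -
  have sD: "submodule D K C" by (rule subcoalgebra_submodule[OF D])
  have Dc: "x \<in> carrier C" if "x \<in> D" for x by (rule subcoalgebra_carrier[OF D that])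
  obtain r where r: "r \<in> linear_maps K C C" "\<And>x. x \<in> carrier C \<Longrightarrow> r x \<in> D" "\<And>x. x \<in> D \<Longrightarrow> r x = x"
    using linear_projection_exists[OF fieldK modC sD] by blast
  have rc: "r x \<in> carrier C" if "x \<in> carrier C" for x using Dc[OF r(2)[OF that]] .
  have \<tau>c: "\<tau> x y \<in> carrier K" if "x \<in> carrier C" "y \<in> carrier C" for x y
    using bilinear_closed[OF \<tau> that] by simp
  have b1: "(\<lambda>x y. \<tau> x (r y)) \<in> bilinear_maps K C C (self_module K)"
    by (rule bilinear_mapsI) (auto intro!: bilinear_right[OF \<tau>] bilinear_left[OF \<tau>] r(1) rc linear_id)
  have b2: "(\<lambda>x y. \<tau> (r x) y) \<in> bilinear_maps K C C (self_module K)"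
    by (rule bilinear_mapsI) (auto intro!: bilinear_right[OF \<tau>] bilinear_left[OF \<tau>] r(1) rc linear_id)
  define e where "e c = sweedler (self_module K) c (\<lambda>x y. \<tau> x (r y))" for c
  define e' where "e' c = sweedler (self_module K) c (\<lambda>x y. \<tau> (r x) y)" for c
  have e: "e \<in> dual" unfolding e_def[abs_def] by (rule sweedler_linear[OF modK b1 linear_id modC])
  have e': "e' \<in> dual" unfolding e'_def[abs_def] by (rule sweedler_linear[OF modK b2 linear_id modC])
  have e_D: "e d = counit C d" if "d \<in> D" for d
    unfolding e_def \<tau>_counit[OF Dc[OF that], symmetric]
    by (rule sweedler_subcoalgebra_cong[OF D that modK b1 \<tau>]) (simp add: r(3))
  have e'_D: "e' d = counit C d" if "d \<in> D" for d
    unfolding e'_def \<tau>_counit[OF Dc[OF that], symmetric]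
    by (rule sweedler_subcoalgebra_cong[OF D that modK b2 \<tau>]) (simp add: r(3))
  have sweedler_D: "sweedler C c \<beta> \<in> D"
    if "c \<in> carrier C" "\<And>x y. x \<in> carrier C \<Longrightarrow> y \<in> carrier C \<Longrightarrow> \<beta> x y \<in> D" for c \<beta>
    unfolding sweedler_def
    by (rule submodule_lsum[OF modC sD]) (auto intro!: that(2) dest: comult_pairs_mem[OF that(1)])
  \<comment> \<open>For fixed \<open>d\<close> these sums are hit actions of functionals given by
    \<tau> on \<open>r c\<close>, which lies in the subcoalgebra \<open>D\<close>.\<close>
  have r_D: "sweedler C (r c) (\<lambda>u v. \<tau> d u \<odot>\<^bsub>C\<^esub> v) \<in> D" "sweedler C (r c) (\<lambda>u v. \<tau> v d \<odot>\<^bsub>C\<^esub> u) \<in> D"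
    if "c \<in> carrier C" "d \<in> carrier C" for c d
  proof -
    have 1: "(\<lambda>u. \<tau> d u) \<in> dual" using bilinear_right[OF \<tau> that(2) linear_id] .
    have 2: "(\<lambda>u. \<tau> u d) \<in> dual" using bilinear_left[OF \<tau> that(2) linear_id] .
    show "sweedler C (r c) (\<lambda>u v. \<tau> d u \<odot>\<^bsub>C\<^esub> v) \<in> D"
      using subcoalgebra_hit(1)[OF D r(2)[OF that(1)] 1] by (simp add: lhit_def)
    show "sweedler C (r c) (\<lambda>u v. \<tau> v d \<odot>\<^bsub>C\<^esub> u) \<in> D"
      using subcoalgebra_hit(2)[OF D r(2)[OF that(1)] 2] by (simp add: rhit_def)
  qed
  \<comment> \<open>After regrouping, the inner sum comultiplies \<open>w\<close>, about which
    nothing is known. The balance of \<tau> moves the comultiplication to \<open>r z\<close>, and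
    \<open>r z\<close> is in \<open>D\<close>.\<close>
  have rhit_D: "rhit e c \<in> D" if c: "c \<in> carrier C" for c
  proof -
    have "rhit e c = sweedler C c (\<lambda>x w. sweedler C w (\<lambda>y z. \<tau> y (r z) \<odot>\<^bsub>C\<^esub> x))"
      unfolding rhit_def e_def
      by (rule sweedler_cong[OF c], rule sweedler_smult_const[OF modC]) (auto intro!: \<tau>c rc)
    also have "\<dots> = sweedler C c (\<lambda>w z. sweedler C w (\<lambda>x y. \<tau> y (r z) \<odot>\<^bsub>C\<^esub> x))"
      by (rule sweedler_coassoc[OF modC c, symmetric])
        (auto intro!: smult_linear_right[OF modC] smult_linear_left[OF modC] bilinear_right[OF \<tau>]
          bilinear_left[OF \<tau>] \<tau>c rc r(1) linear_id)
    also have "\<dots> \<in> D"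
    proof (rule sweedler_D[OF c])
      fix w z assume wz: "w \<in> carrier C" "z \<in> carrier C"
      show "sweedler C w (\<lambda>x y. \<tau> y (r z) \<odot>\<^bsub>C\<^esub> x) \<in> D"
        unfolding \<tau>_balanced[OF wz(1) rc[OF wz(2)]] by (rule r_D(1)[OF wz(2,1)])
    qed
    finally show ?thesis .
  qed
  \<comment> \<open>The same exchange read backwards: the comultiplication is moved from
    \<open>w\<close> to \<open>r x\<close>.\<close>
  have lhit_D: "lhit e' c \<in> D" if c: "c \<in> carrier C" for c
  proof -
    have "lhit e' c = sweedler C c (\<lambda>w z. sweedler C w (\<lambda>x y. \<tau> (r x) y \<odot>\<^bsub>C\<^esub> z))"
      unfolding lhit_def e'_def
      by (rule sweedler_cong[OF c], rule sweedler_smult_const[OF modC]) (auto intro!: \<tau>c rc)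
    also have "\<dots> = sweedler C c (\<lambda>x w. sweedler C w (\<lambda>y z. \<tau> (r x) y \<odot>\<^bsub>C\<^esub> z))"
      by (rule sweedler_coassoc[OF modC c])
        (auto intro!: smult_linear_right[OF modC] smult_linear_left[OF modC] bilinear_right[OF \<tau>]
          bilinear_left[OF \<tau>] \<tau>c rc r(1) linear_id)
    also have "\<dots> \<in> D"
    proof (rule sweedler_D[OF c])
      fix x w assume xw: "x \<in> carrier C" "w \<in> carrier C"
      show "sweedler C w (\<lambda>y z. \<tau> (r x) y \<odot>\<^bsub>C\<^esub> z) \<in> D"
        unfolding \<tau>_balanced[OF rc[OF xw(1)] xw(2), symmetric] by (rule r_D(2)[OF xw])
    qed
    finally show ?thesis .
  qed
  note lin = rhit_linear[OF e]
  have same: "lhit e' c = rhit e c" if c: "c \<in> carrier C" for c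
  proof -
    have "lhit e' c = rhit e (lhit e' c)"
      using hit_agree_counit(2)[OF D lhit_D[OF c] e e_D] by simp
    also have "\<dots> = lhit e' (rhit e c)" by (rule lhit_rhit_commute[OF e' e c, symmetric])
    also have "\<dots> = rhit e c" by (rule hit_agree_counit(1)[OF D rhit_D[OF c] e' e'_D])
    finally show ?thesis .
  qed
  define E where "E = {x \<in> carrier C. rhit e x \<in> {\<zero>\<^bsub>C\<^esub>}}"
  have sE: "submodule E K C"
    unfolding E_def by (rule linear_kernel_submodule[OF modC modC lin zero_submodule[OF modC]])
  have hc: "lhit \<phi> d \<in> carrier C" "rhit \<phi> d \<in> carrier C" if "\<phi> \<in> dual" "d \<in> carrier C" for \<phi> d
    using linear_closed[OF lhit_linear[OF that(1)] that(2)] linear_closed[OF rhit_linear[OF that(1)] that(2)]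
    by blast+
  have E: "subcoalgebra K C E"
  proof (rule subcoalgebraI[OF sE])
    fix \<phi> d assume \<phi>: "\<phi> \<in> dual" and "d \<in> E"
    then have d: "d \<in> carrier C" "rhit e d = \<zero>\<^bsub>C\<^esub>" by (auto simp: E_def)
    have "rhit e (lhit \<phi> d) = \<zero>\<^bsub>C\<^esub>"
      using lhit_rhit_commute[OF \<phi> e d(1)] d(2) linear_zero[OF modC modC lhit_linear[OF \<phi>]] by simp
    then show "lhit \<phi> d \<in> E" using hc[OF \<phi> d(1)] by (simp add: E_def)
    \<comment> \<open>Two right actions need not commute. Writing the projection as
      \<open>lhit e'\<close> makes it commute with \<open>rhit \<phi>\<close>, just as
      \<open>rhit e\<close> commutes with \<open>lhit \<phi>\<close>.\<close>
    have "rhit e (rhit \<phi> d) = rhit \<phi> (lhit e' d)"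
      using same[OF hc(2)[OF \<phi> d(1)]] lhit_rhit_commute[OF e' \<phi> d(1)] by simp
    also have "\<dots> = \<zero>\<^bsub>C\<^esub>"
      using same[OF d(1)] d(2) linear_zero[OF modC modC rhit_linear[OF \<phi>]] by simp
    finally show "rhit \<phi> d \<in> E" using hc[OF \<phi> d(1)] by (simp add: E_def)
  qed
  have fix_D: "rhit e d = d" if "d \<in> D" for d by (rule hit_agree_counit(2)[OF D that e e_D])
  have "complementary D E"
    unfolding complementary_def
  proof (intro conjI ballI)
    show "D \<inter> E = {\<zero>\<^bsub>C\<^esub>}"
      using fix_D submodule_zero[OF sD] submodule_zero[OF sE] by (auto simp: E_def)
  next
    fix x assume x: "x \<in> carrier C"
    have p: "rhit e x \<in> D" "rhit e x \<in> carrier C" using rhit_D[OF x] Dc by auto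
    have "rhit e (x \<ominus>\<^bsub>C\<^esub> rhit e x) = \<zero>\<^bsub>C\<^esub>"
      using linear_minus[OF modC modC lin x p(2)] fix_D[OF p(1)] p(2) by (simp add: a_minus_def M.r_neg)
    then have "x \<ominus>\<^bsub>C\<^esub> rhit e x \<in> E" using x p by (simp add: E_def)
    moreover have "x = rhit e x \<oplus>\<^bsub>C\<^esub> (x \<ominus>\<^bsub>C\<^esub> rhit e x)"
      using x p by (simp add: a_minus_def M.a_comm[of x] M.r_neg2)
    ultimately show "\<exists>a\<in>D. \<exists>b\<in>E. x = a \<oplus>\<^bsub>C\<^esub> b" using p by blast
  qed
  with E show ?thesis by blast
qed

end

section \<open>Hopf algebras\<close>

context hopf_algebra
begin

abbreviation mult_H (infixl \<open>\<cdot>\<close> 70) where "x \<cdot> y \<equiv> x \<otimes>\<^bsub>H\<^esub> y"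

lemma ringH: "ring H" by unfold_locales
lemma cringK: "cring K" by unfold_locales

lemmas multH_closed = monoid.m_closed[OF ring.is_monoid[OF ringH]]
lemmas multH_assoc = monoid.m_assoc[OF ring.is_monoid[OF ringH]]
lemmas oneH_closed = monoid.one_closed[OF ring.is_monoid[OF ringH]]
lemmas multH_one = monoid.l_one[OF ring.is_monoid[OF ringH]] monoid.r_one[OF ring.is_monoid[OF ringH]]
lemmas multK_closed = monoid.m_closed[OF ring.is_monoid[OF cring.axioms(1)[OF cringK]]]

lemma mult_bilinear: "(\<lambda>x y. x \<cdot> y) \<in> bilinear_maps K H H H"
  by (intro bilinear_mapsI linear_mapsI)
    (simp_all add: multH_closed ring.ring_simprules[OF ringH] smult_mult_left smult_mult_right)

lemma antipode_closed: "x \<in> carrier H \<Longrightarrow> antipode H x \<in> carrier H"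
  by (rule linear_closed[OF antipode_linear])

lemmas closed = multH_closed oneH_closed antipode_closed counit_closed multK_closed smult_closed

lemmas linear_rules = linear_id linear_comp[OF antipode_linear] linear_comp[OF counit_linear]
  bilinear_right[OF mult_bilinear] bilinear_left[OF mult_bilinear]
  smult_linear_left smult_linear_right mult_linear_self[OF cringK]

text \<open>Multiplicativity of \<Delta> in Sweedler form. The product in H \<otimes> H is a
  \<open>tensor_lift\<close> inside another one; both are first turned into Sweedler sums, then the
  lift of \<beta> is pulled through them.\<close>

lemma sweedler_mult:
  assumes P: "module K P" and \<beta>: "\<beta> \<in> bilinear_maps K H H P" and x: "x \<in> carrier H" and y: "y \<in> carrier H"
  shows "sweedler P (x \<cdot> y) \<beta>
    = sweedler P x (\<lambda>x1 x2. sweedler P y (\<lambda>y1 y2. \<beta> (x1 \<cdot> y1) (x2 \<cdot> y2)))"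
proof -
  let ?T = "tensor K H H" and ?e = "tensor_elem K H H"
  note e = tensor_elem_bilinear[OF modC modC]
  note ec = tensor_elem_closed[OF modC modC]
  have inner: "(\<lambda>y1 y2. ?e (x1 \<cdot> y1) (x2 \<cdot> y2)) \<in> bilinear_maps K H H ?T"
    if "x1 \<in> carrier H" "x2 \<in> carrier H" for x1 x2
    by (rule bilinear_mapsI)
      (use that in \<open>auto intro!: bilinear_right[OF e] bilinear_left[OF e] linear_rules closed\<close>)
  have outer: "(\<lambda>x1 x2. sweedler ?T y (\<lambda>y1 y2. ?e (x1 \<cdot> y1) (x2 \<cdot> y2))) \<in> bilinear_maps K H H ?T"
    by (rule bilinear_mapsI)
      (use y in \<open>auto intro!: sweedler_linear_fun[OF modT] bilinear_right[OF e] bilinear_left[OF e] linear_rules closed\<close>)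
  have outer': "(\<lambda>x1 x2. tensor_lift K ?T (\<lambda>y1 y2. ?e (x1 \<cdot> y1) (x2 \<cdot> y2)) (comult H y)) \<in> bilinear_maps K H H ?T"
  proof (rule bilinear_mapsI)
    fix x1 assume x1: "x1 \<in> carrier H"
    show "(\<lambda>x2. tensor_lift K ?T (\<lambda>y1 y2. ?e (x1 \<cdot> y1) (x2 \<cdot> y2)) (comult H y)) \<in> linear_maps K H ?T"
      by (rule linear_cong[OF bilinear_right[OF outer x1 linear_id] modC])
        (simp add: sweedler_eq_tensor_lift[OF modT inner[OF x1] y])
  next
    fix x2 assume x2: "x2 \<in> carrier H"
    show "(\<lambda>x1. tensor_lift K ?T (\<lambda>y1 y2. ?e (x1 \<cdot> y1) (x2 \<cdot> y2)) (comult H y)) \<in> linear_maps K H ?T"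
      by (rule linear_cong[OF bilinear_left[OF outer x2 linear_id] modC])
        (simp add: sweedler_eq_tensor_lift[OF modT inner[OF _ x2] y])
  qed
  have "comult H (x \<cdot> y)
      = sweedler ?T x (\<lambda>x1 x2. tensor_lift K ?T (\<lambda>y1 y2. ?e (x1 \<cdot> y1) (x2 \<cdot> y2)) (comult H y))"
    using comult_mult[OF x y] sweedler_eq_tensor_lift[OF modT outer' x] by (simp add: tensor_mult_def)
  also have "\<dots> = sweedler ?T x (\<lambda>x1 x2. sweedler ?T y (\<lambda>y1 y2. ?e (x1 \<cdot> y1) (x2 \<cdot> y2)))"
    by (rule sweedler_cong[OF x]) (simp add: sweedler_eq_tensor_lift[OF modT inner y])
  finally have eq: "comult H (x \<cdot> y) = \<dots>" .
  have L: "tensor_lift K P \<beta> \<in> linear_maps K ?T P" by (rule tensor_lift_linear[OF modC modC P \<beta>])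
  have "sweedler P (x \<cdot> y) \<beta> = tensor_lift K P \<beta> (comult H (x \<cdot> y))"
    by (rule sweedler_eq_tensor_lift[OF P \<beta>, symmetric]) (use x y in \<open>simp add: closed\<close>)
  also have "\<dots> = sweedler P x (\<lambda>x1 x2. tensor_lift K P \<beta> (sweedler ?T y (\<lambda>y1 y2. ?e (x1 \<cdot> y1) (x2 \<cdot> y2))))"
    unfolding eq by (rule sweedler_image[OF modT P L x]) (use y in \<open>auto intro!: sweedler_closed[OF modT] ec closed\<close>)
  also have "\<dots> = sweedler P x (\<lambda>x1 x2. sweedler P y (\<lambda>y1 y2. \<beta> (x1 \<cdot> y1) (x2 \<cdot> y2)))"
  proof (rule sweedler_cong[OF x])
    fix x1 x2 assume x12: "x1 \<in> carrier H" "x2 \<in> carrier H"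
    have "tensor_lift K P \<beta> (sweedler ?T y (\<lambda>y1 y2. ?e (x1 \<cdot> y1) (x2 \<cdot> y2)))
      = sweedler P y (\<lambda>y1 y2. tensor_lift K P \<beta> (?e (x1 \<cdot> y1) (x2 \<cdot> y2)))"
      by (rule sweedler_image[OF modT P L y]) (use x12 in \<open>auto intro!: ec closed\<close>)
    also have "\<dots> = sweedler P y (\<lambda>y1 y2. \<beta> (x1 \<cdot> y1) (x2 \<cdot> y2))"
      by (rule sweedler_cong[OF y]) (use x12 in \<open>simp add: tensor_lift_elem[OF modC modC P \<beta>] closed\<close>)
    finally show "tensor_lift K P \<beta> (sweedler ?T y (\<lambda>y1 y2. ?e (x1 \<cdot> y1) (x2 \<cdot> y2)))
      = sweedler P y (\<lambda>y1 y2. \<beta> (x1 \<cdot> y1) (x2 \<cdot> y2))" .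
  qed
  finally show ?thesis .
qed

section \<open>Consequences of the antipode axioms\<close>

lemma sweedler_antipode:
  assumes "x \<in> carrier H"
  shows "sweedler H x (\<lambda>y z. antipode H y \<cdot> z) = counit H x \<odot>\<^bsub>H\<^esub> \<one>\<^bsub>H\<^esub>"
    and "sweedler H x (\<lambda>y z. y \<cdot> antipode H z) = counit H x \<odot>\<^bsub>H\<^esub> \<one>\<^bsub>H\<^esub>"
proof -
  have "(\<lambda>y z. antipode H y \<cdot> z) \<in> bilinear_maps K H H H"
    "(\<lambda>y z. y \<cdot> antipode H z) \<in> bilinear_maps K H H H"
    by (rule bilinear_mapsI; auto intro!: linear_rules closed)+
  then show "sweedler H x (\<lambda>y z. antipode H y \<cdot> z) = counit H x \<odot>\<^bsub>H\<^esub> \<one>\<^bsub>H\<^esub>"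
    "sweedler H x (\<lambda>y z. y \<cdot> antipode H z) = counit H x \<odot>\<^bsub>H\<^esub> \<one>\<^bsub>H\<^esub>"
    using antipode_left[OF assms] antipode_right[OF assms] sweedler_eq_tensor_lift[OF modC _ assms]
    by simp_all
qed

text \<open>This is \<open>\<Sum> S a\<^sub>1 a\<^sub>2 \<otimes> a\<^sub>3 = 1 \<otimes> a\<close>,
  tested against bilinear maps. Regrouping makes the first two factors collapse to a counit, which
  the counit axiom then removes.\<close>

lemma cancel_left:
  assumes P: "module K P" and \<gamma>: "\<gamma> \<in> bilinear_maps K H H P" and a: "a \<in> carrier H"
  shows "sweedler P a (\<lambda>x w. sweedler P w (\<lambda>y z. \<gamma> (antipode H x \<cdot> y) z)) = \<gamma> \<one>\<^bsub>H\<^esub> a"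
proof -
  have "sweedler P a (\<lambda>x w. sweedler P w (\<lambda>y z. \<gamma> (antipode H x \<cdot> y) z))
      = sweedler P a (\<lambda>w z. sweedler P w (\<lambda>x y. \<gamma> (antipode H x \<cdot> y) z))"
    by (rule sweedler_coassoc[OF P a, symmetric])
      (auto intro!: bilinear_right[OF \<gamma>] bilinear_left[OF \<gamma>] linear_rules closed)
  also have "\<dots> = sweedler P a (\<lambda>w z. counit H w \<odot>\<^bsub>P\<^esub> \<gamma> \<one>\<^bsub>H\<^esub> z)"
  proof (rule sweedler_cong[OF a])
    fix w z assume wz: "w \<in> carrier H" "z \<in> carrier H"
    have lin: "(\<lambda>u. \<gamma> u z) \<in> linear_maps K H P" by (rule bilinear_left[OF \<gamma> wz(2) linear_id])
    have "sweedler P w (\<lambda>x y. \<gamma> (antipode H x \<cdot> y) z) = \<gamma> (sweedler H w (\<lambda>x y. antipode H x \<cdot> y)) z"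
      by (rule sweedler_image[OF modC P lin wz(1), symmetric]) (auto intro!: closed)
    also have "\<dots> = counit H w \<odot>\<^bsub>P\<^esub> \<gamma> \<one>\<^bsub>H\<^esub> z"
      using linear_smult[OF lin] wz by (simp add: sweedler_antipode closed)
    finally show "sweedler P w (\<lambda>x y. \<gamma> (antipode H x \<cdot> y) z) = counit H w \<odot>\<^bsub>P\<^esub> \<gamma> \<one>\<^bsub>H\<^esub> z" .
  qed
  also have "\<dots> = \<gamma> \<one>\<^bsub>H\<^esub> a"
    by (rule sweedler_counit_left[OF P bilinear_right[OF \<gamma> oneH_closed linear_id] a])
  finally show ?thesis .
qed

text \<open>This is \<open>\<Sum> a\<^sub>1 \<otimes> a\<^sub>2 S a\<^sub>3 = a \<otimes> 1\<close>.
  Read from right to left, it is the device that inserts a cancelling pair into a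
  computation.\<close>

lemma cancel_right:
  assumes P: "module K P" and \<gamma>: "\<gamma> \<in> bilinear_maps K H H P" and a: "a \<in> carrier H"
  shows "sweedler P a (\<lambda>w z. sweedler P w (\<lambda>x y. \<gamma> x (y \<cdot> antipode H z))) = \<gamma> a \<one>\<^bsub>H\<^esub>"
proof -
  have "sweedler P a (\<lambda>w z. sweedler P w (\<lambda>x y. \<gamma> x (y \<cdot> antipode H z)))
      = sweedler P a (\<lambda>x w. sweedler P w (\<lambda>y z. \<gamma> x (y \<cdot> antipode H z)))"
    by (rule sweedler_coassoc[OF P a])
      (auto intro!: bilinear_right[OF \<gamma>] bilinear_left[OF \<gamma>] linear_rules closed)
  also have "\<dots> = sweedler P a (\<lambda>x w. counit H w \<odot>\<^bsub>P\<^esub> \<gamma> x \<one>\<^bsub>H\<^esub>)"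
  proof (rule sweedler_cong[OF a])
    fix x w assume wz: "x \<in> carrier H" "w \<in> carrier H"
    have lin: "(\<lambda>u. \<gamma> x u) \<in> linear_maps K H P" by (rule bilinear_right[OF \<gamma> wz(1) linear_id])
    have "sweedler P w (\<lambda>y z. \<gamma> x (y \<cdot> antipode H z)) = \<gamma> x (sweedler H w (\<lambda>y z. y \<cdot> antipode H z))"
      by (rule sweedler_image[OF modC P lin wz(2), symmetric]) (auto intro!: closed)
    also have "\<dots> = counit H w \<odot>\<^bsub>P\<^esub> \<gamma> x \<one>\<^bsub>H\<^esub>"
      using linear_smult[OF lin] wz by (simp add: sweedler_antipode closed)
    finally show "sweedler P w (\<lambda>y z. \<gamma> x (y \<cdot> antipode H z)) = counit H w \<odot>\<^bsub>P\<^esub> \<gamma> x \<one>\<^bsub>H\<^esub>" .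
  qed
  also have "\<dots> = \<gamma> a \<one>\<^bsub>H\<^esub>"
    by (rule sweedler_counit_right[OF P bilinear_left[OF \<gamma> oneH_closed linear_id] a])
  finally show ?thesis .
qed

text \<open>\<open>\<epsilon> (S x) = \<Sum> \<epsilon> (S x\<^sub>1) \<epsilon> x\<^sub>2 =
  \<epsilon> (\<Sum> S x\<^sub>1 x\<^sub>2) = \<epsilon> x\<close>.\<close>

lemma counit_antipode:
  assumes x: "x \<in> carrier H"
  shows "counit H (antipode H x) = counit H x"
proof -
  have "counit H (antipode H x)
      = sweedler (self_module K) x (\<lambda>u v. counit H v \<otimes>\<^bsub>K\<^esub> counit H (antipode H u))"
    using sweedler_counit_right[OF modK _ x, of "\<lambda>x. counit H (antipode H x)"]
    by (simp add: linear_rules)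
  also have "\<dots> = sweedler (self_module K) x (\<lambda>u v. counit H (antipode H u \<cdot> v))"
    by (rule sweedler_cong[OF x]) (simp add: counit_mult closed cring.cring_simprules(14)[OF cringK])
  also have "\<dots> = counit H (sweedler H x (\<lambda>u v. antipode H u \<cdot> v))"
    by (rule sweedler_image[OF modC modK counit_linear x, symmetric]) (auto intro!: closed)
  also have "\<dots> = counit H x"
    using linear_smult[OF counit_linear] x
    by (simp add: sweedler_antipode closed counit_one monoid.r_one[OF ring.is_monoid[OF cring.axioms(1)[OF cringK]]])
  finally show ?thesis .
qed

text \<open>\<open>S (x y) = \<Sum> S (x\<^sub>1 y\<^sub>1) x\<^sub>2 y\<^sub>2 S y\<^sub>3 S x\<^sub>3 = S y S x\<close>.\<close>

lemma antipode_mult: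
  assumes x: "x \<in> carrier H" and y: "y \<in> carrier H"
  shows "antipode H (x \<cdot> y) = antipode H y \<cdot> antipode H x"
proof -
  let ?S = "antipode H"
  have b1: "(\<lambda>u v. ?S (u \<cdot> y) \<cdot> v) \<in> bilinear_maps K H H H"
    by (rule bilinear_mapsI) (use y in \<open>auto intro!: linear_rules closed\<close>)
  have b2: "(\<lambda>u v. ?S (x1 \<cdot> u) \<cdot> (x2 \<cdot> (v \<cdot> ?S x3))) \<in> bilinear_maps K H H H"
    if "x1 \<in> carrier H" "x2 \<in> carrier H" "x3 \<in> carrier H" for x1 x2 x3
    by (rule bilinear_mapsI) (use that in \<open>auto intro!: linear_rules closed\<close>)
  have b4: "(\<lambda>s t. (?S s \<cdot> t) \<cdot> z) \<in> bilinear_maps K H H H" if "z \<in> carrier H" for z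
    by (rule bilinear_mapsI) (use that in \<open>auto intro!: linear_rules closed\<close>)
  \<comment> \<open>Reassociated, the two inner sums form the sum of S s t over the comultiplication
    of the product w v, to which the antipode axiom applies.\<close>
  have step: "sweedler H w (\<lambda>x1 x2. sweedler H v (\<lambda>y1 y2. ?S (x1 \<cdot> y1) \<cdot> (x2 \<cdot> ((y2 \<cdot> ?S y3) \<cdot> ?S x3))))
      = counit H w \<odot>\<^bsub>H\<^esub> (counit H v \<odot>\<^bsub>H\<^esub> (?S y3 \<cdot> ?S x3))"
    if c: "w \<in> carrier H" "v \<in> carrier H" "y3 \<in> carrier H" "x3 \<in> carrier H" for w v y3 x3
  proof -
    let ?z = "?S y3 \<cdot> ?S x3"
    have z: "?z \<in> carrier H" using c by (simp add: closed)
    have "sweedler H w (\<lambda>x1 x2. sweedler H v (\<lambda>y1 y2. ?S (x1 \<cdot> y1) \<cdot> (x2 \<cdot> ((y2 \<cdot> ?S y3) \<cdot> ?S x3))))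
      = sweedler H w (\<lambda>x1 x2. sweedler H v (\<lambda>y1 y2. (?S (x1 \<cdot> y1) \<cdot> (x2 \<cdot> y2)) \<cdot> ?z))"
      by (rule sweedler_cong[OF c(1)], rule sweedler_cong[OF c(2)]) (use c in \<open>simp add: closed multH_assoc\<close>)
    also have "\<dots> = sweedler H (w \<cdot> v) (\<lambda>s t. (?S s \<cdot> t) \<cdot> ?z)"
      by (rule sweedler_mult[OF modC b4[OF z] c(1,2), symmetric])
    also have "\<dots> = sweedler H (w \<cdot> v) (\<lambda>s t. ?S s \<cdot> t) \<cdot> ?z"
      by (rule sweedler_image[OF modC modC bilinear_left[OF mult_bilinear z linear_id], symmetric])
        (use c in \<open>auto intro!: closed\<close>)
    also have "\<dots> = counit H w \<odot>\<^bsub>H\<^esub> (counit H v \<odot>\<^bsub>H\<^esub> ?z)"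
      using c z by (simp add: sweedler_antipode closed counit_mult smult_mult_left multH_one smult_assoc1)
    finally show ?thesis .
  qed
  \<comment> \<open>The factor \<open>\<Sum> x\<^sub>2 S x\<^sub>3\<close> is inserted here, the
    factor \<open>\<Sum> y\<^sub>2 S y\<^sub>3\<close> between its two parts in the next
    step.\<close>
  have "?S (x \<cdot> y) = sweedler H x (\<lambda>w x3. sweedler H w (\<lambda>x1 x2. ?S (x1 \<cdot> y) \<cdot> (x2 \<cdot> ?S x3)))"
    using cancel_right[OF modC b1 x] x y by (simp add: multH_one closed)
  also have "\<dots> = sweedler H x (\<lambda>w x3. sweedler H w (\<lambda>x1 x2. sweedler H y (\<lambda>v y3. sweedler H v (\<lambda>y1 y2.
      ?S (x1 \<cdot> y1) \<cdot> (x2 \<cdot> ((y2 \<cdot> ?S y3) \<cdot> ?S x3))))))"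
  proof (rule sweedler_cong[OF x], rule sweedler_cong)
    fix w x3 x1 x2 assume c: "x3 \<in> carrier H" "x1 \<in> carrier H" "x2 \<in> carrier H"
    show "?S (x1 \<cdot> y) \<cdot> (x2 \<cdot> ?S x3) = sweedler H y (\<lambda>v y3. sweedler H v (\<lambda>y1 y2.
      ?S (x1 \<cdot> y1) \<cdot> (x2 \<cdot> ((y2 \<cdot> ?S y3) \<cdot> ?S x3))))"
      using cancel_right[OF modC b2[OF c(2,3,1)] y] c by (simp add: multH_one closed)
  qed
  also have "\<dots> = sweedler H x (\<lambda>w x3. sweedler H y (\<lambda>v y3. sweedler H w (\<lambda>x1 x2. sweedler H v (\<lambda>y1 y2.
      ?S (x1 \<cdot> y1) \<cdot> (x2 \<cdot> ((y2 \<cdot> ?S y3) \<cdot> ?S x3))))))"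
    by (rule sweedler_cong[OF x], rule sweedler_swap[OF modC])
      (use y in \<open>auto intro!: sweedler_closed[OF modC] closed\<close>)
  also have "\<dots> = sweedler H x (\<lambda>w x3. sweedler H y (\<lambda>v y3.
      counit H w \<odot>\<^bsub>H\<^esub> (counit H v \<odot>\<^bsub>H\<^esub> (?S y3 \<cdot> ?S x3))))"
    by (rule sweedler_cong[OF x], rule sweedler_cong[OF y], rule step)
  also have "\<dots> = sweedler H x (\<lambda>w x3. counit H w \<odot>\<^bsub>H\<^esub> (?S y \<cdot> ?S x3))"
  proof (rule sweedler_cong[OF x])
    fix w x3 assume c: "w \<in> carrier H" "x3 \<in> carrier H"
    have "sweedler H y (\<lambda>v y3. counit H w \<odot>\<^bsub>H\<^esub> (counit H v \<odot>\<^bsub>H\<^esub> (?S y3 \<cdot> ?S x3)))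
      = counit H w \<odot>\<^bsub>H\<^esub> sweedler H y (\<lambda>v y3. counit H v \<odot>\<^bsub>H\<^esub> (?S y3 \<cdot> ?S x3))"
      by (rule sweedler_smult[OF modC y, symmetric]) (use c in \<open>auto intro!: closed\<close>)
    also have "sweedler H y (\<lambda>v y3. counit H v \<odot>\<^bsub>H\<^esub> (?S y3 \<cdot> ?S x3)) = ?S y \<cdot> ?S x3"
      by (rule sweedler_counit_left[OF modC _ y]) (use c in \<open>auto intro!: linear_rules closed\<close>)
    finally show "sweedler H y (\<lambda>v y3. counit H w \<odot>\<^bsub>H\<^esub> (counit H v \<odot>\<^bsub>H\<^esub> (?S y3 \<cdot> ?S x3)))
      = counit H w \<odot>\<^bsub>H\<^esub> (?S y \<cdot> ?S x3)" .
  qed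
  also have "\<dots> = ?S y \<cdot> ?S x"
    by (rule sweedler_counit_left[OF modC _ x]) (use y in \<open>auto intro!: linear_rules closed\<close>)
  finally show ?thesis .
qed

end

subsection \<open>The counit of a Hopf subalgebra extended by zero\<close>

text \<open>Fixes one complement and one functional with the properties given by
  \<open>complementary_functional\<close>, so that the form on the quotient can be defined from
  \<open>q\<close> as a constant.\<close>

locale hopf_subalgebra_complement = hopf_algebra K H
  for K :: "('a, 'i) ring_scheme" (structure) and H :: "('a, 'b, 'c) hopf_algebra_scheme" (structure) +
  fixes A B :: "'b set" and q :: "'b \<Rightarrow> 'a"
  assumes hopf_sub: "hopf_subalgebra K H A"
    and B_sub: "subcoalgebra K H B"
    and A_B: "complementary A B"
    and q_dual: "q \<in> dual"
    and q_A: "a \<in> A \<Longrightarrow> q a = counit H a"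
    and q_B: "b \<in> B \<Longrightarrow> q b = \<zero>\<^bsub>K\<^esub>"
    and lhit_A: "x \<in> carrier H \<Longrightarrow> lhit q x \<in> A"
    and rhit_eq_lhit: "x \<in> carrier H \<Longrightarrow> rhit q x = lhit q x"
begin

lemma A_sub: "subcoalgebra K H A" using hopf_sub by (simp add: hopf_subalgebra_def)
lemma A_subring: "subring A H" using hopf_sub by (simp add: hopf_subalgebra_def)
lemma A_antipode: "x \<in> A \<Longrightarrow> antipode H x \<in> A" using hopf_sub by (auto simp: hopf_subalgebra_def)
lemma A_mult: "x \<in> A \<Longrightarrow> y \<in> A \<Longrightarrow> x \<cdot> y \<in> A" by (rule subringE(6)[OF A_subring])
lemma A_one: "\<one>\<^bsub>H\<^esub> \<in> A" by (rule subringE(3)[OF A_subring])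
lemma A_carrier: "x \<in> A \<Longrightarrow> x \<in> carrier H" by (rule subcoalgebra_carrier[OF A_sub])
lemma B_carrier: "x \<in> B \<Longrightarrow> x \<in> carrier H" by (rule subcoalgebra_carrier[OF B_sub])
lemma q_closed: "x \<in> carrier H \<Longrightarrow> q x \<in> carrier K" by (rule dual_closed[OF q_dual])

abbreviation "cq \<equiv> \<lambda>x. counit H x \<ominus>\<^bsub>K\<^esub> q x"

lemma cq_dual: "cq \<in> dual"
  using linear_diff[OF modC modK counit_linear q_dual] by simp

lemma cq_closed: "x \<in> carrier H \<Longrightarrow> cq x \<in> carrier K" by (rule dual_closed[OF cq_dual])

lemma cq_A: "x \<in> A \<Longrightarrow> cq x = \<zero>\<^bsub>K\<^esub>"
  using q_A counit_closed[OF A_carrier] by (simp add: a_minus_def abelian_group.r_neg[OF ring.is_abelian_group[OF cring.axioms(1)[OF cringK]]])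

lemma cq_B: "x \<in> B \<Longrightarrow> cq x = counit H x"
  using q_B counit_closed[OF B_carrier] by (simp add: a_minus_def)

text \<open>Let \<open>\<phi> = \<epsilon> - q\<close>, which vanishes on \<open>A\<close> and equals the counit on \<open>B\<close>. For \<open>a\<close> in \<open>A\<close> and
  \<open>b\<close> in \<open>B\<close>, \<open>q (a b) = \<Sum> \<phi> b\<^sub>1 q (a b\<^sub>2) = \<Sum> \<phi> (S a\<^sub>1 a\<^sub>2 b\<^sub>1) q (a\<^sub>3 b\<^sub>2)\<close>, where the sum over \<open>a\<^sub>2 b\<^sub>1\<close>
  and \<open>a\<^sub>3 b\<^sub>2\<close> produces the component of \<open>a\<^sub>2 b\<close> in \<open>A\<close>, so that the argument of \<open>\<phi>\<close> lies in \<open>A\<close>.\<close>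

lemma q_mult_left_B:
  assumes a: "a \<in> A" and b: "b \<in> B"
  shows "q (a \<cdot> b) = \<zero>\<^bsub>K\<^esub>"
proof -
  let ?S = "antipode H" and ?K = "self_module K"
  note ac = A_carrier[OF a] and bc = B_carrier[OF b]
  note rules = linear_rules linear_comp[OF q_dual] linear_comp[OF cq_dual]
  note cl = closed q_closed cq_closed
  have b1: "(\<lambda>x y. counit H x \<otimes>\<^bsub>K\<^esub> q (a \<cdot> y)) \<in> bilinear_maps K H H ?K"
    "(\<lambda>x y. cq x \<otimes>\<^bsub>K\<^esub> q (a \<cdot> y)) \<in> bilinear_maps K H H ?K"
    by (rule bilinear_mapsI; use ac in \<open>auto intro!: rules cl\<close>)+
  have b2: "(\<lambda>u v. cq (u \<cdot> b1) \<otimes>\<^bsub>K\<^esub> q (v \<cdot> b2)) \<in> bilinear_maps K H H ?K"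
    if "b1 \<in> carrier H" "b2 \<in> carrier H" for b1 b2
    by (rule bilinear_mapsI; use that in \<open>auto intro!: rules cl\<close>)
  have b3: "(\<lambda>u v. cq (x \<cdot> u) \<otimes>\<^bsub>K\<^esub> q v) \<in> bilinear_maps K H H ?K" if "x \<in> carrier H" for x
    by (rule bilinear_mapsI; use that in \<open>auto intro!: rules cl\<close>)
  have b4: "(\<lambda>x w. cq (?S x \<cdot> rhit q (w \<cdot> b))) \<in> bilinear_maps K H H ?K"
    by (rule bilinear_mapsI; use bc in \<open>auto intro!: rules cl linear_comp[OF rhit_linear[OF q_dual]]
      linear_closed[OF rhit_linear[OF q_dual]]\<close>)
  have "q (a \<cdot> b) = sweedler ?K b (\<lambda>x y. counit H x \<otimes>\<^bsub>K\<^esub> q (a \<cdot> y))"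
    using sweedler_counit_left[OF modK _ bc, of "\<lambda>y. q (a \<cdot> y)"] ac by (simp add: rules)
  also have "\<dots> = sweedler ?K b (\<lambda>x y. cq x \<otimes>\<^bsub>K\<^esub> q (a \<cdot> y))"
    by (rule sweedler_subcoalgebra_cong[OF B_sub b modK b1]) (simp add: cq_B)
  also have "\<dots> = sweedler ?K b (\<lambda>b1 b2. sweedler ?K a (\<lambda>x w. sweedler ?K w (\<lambda>y z.
      cq ((?S x \<cdot> y) \<cdot> b1) \<otimes>\<^bsub>K\<^esub> q (z \<cdot> b2))))"
  proof (rule sweedler_cong[OF bc])
    fix b1 b2 assume c: "b1 \<in> carrier H" "b2 \<in> carrier H"
    show "cq b1 \<otimes>\<^bsub>K\<^esub> q (a \<cdot> b2) = sweedler ?K a (\<lambda>x w. sweedler ?K w (\<lambda>y z.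
      cq ((?S x \<cdot> y) \<cdot> b1) \<otimes>\<^bsub>K\<^esub> q (z \<cdot> b2)))"
      using cancel_left[OF modK b2[OF c] ac] c by (simp add: multH_one)
  qed
  also have "\<dots> = sweedler ?K a (\<lambda>x w. sweedler ?K b (\<lambda>b1 b2. sweedler ?K w (\<lambda>y z.
      cq ((?S x \<cdot> y) \<cdot> b1) \<otimes>\<^bsub>K\<^esub> q (z \<cdot> b2))))"
    by (rule sweedler_swap[OF modK bc ac]) (auto intro!: sweedler_closed[OF modK, simplified] cl)
  also have "\<dots> = sweedler ?K a (\<lambda>x w. cq (?S x \<cdot> rhit q (w \<cdot> b)))"
  proof (rule sweedler_cong[OF ac])
    fix x w assume c: "x \<in> carrier H" "w \<in> carrier H"
    have wb: "w \<cdot> b \<in> carrier H" using c bc by (simp add: closed)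
    have "sweedler ?K b (\<lambda>b1 b2. sweedler ?K w (\<lambda>y z. cq ((?S x \<cdot> y) \<cdot> b1) \<otimes>\<^bsub>K\<^esub> q (z \<cdot> b2)))
      = sweedler ?K w (\<lambda>y z. sweedler ?K b (\<lambda>b1 b2. cq ((?S x \<cdot> y) \<cdot> b1) \<otimes>\<^bsub>K\<^esub> q (z \<cdot> b2)))"
      by (rule sweedler_swap[OF modK bc c(2)]) (use c in \<open>auto intro!: cl\<close>)
    also have "\<dots> = sweedler ?K w (\<lambda>y z. sweedler ?K b (\<lambda>b1 b2. cq (?S x \<cdot> (y \<cdot> b1)) \<otimes>\<^bsub>K\<^esub> q (z \<cdot> b2)))"
      by (rule sweedler_cong[OF c(2)], rule sweedler_cong[OF bc]) (use c in \<open>simp add: multH_assoc closed\<close>)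
    also have "\<dots> = sweedler ?K (w \<cdot> b) (\<lambda>u v. cq (?S x \<cdot> u) \<otimes>\<^bsub>K\<^esub> q v)"
      by (rule sweedler_mult[OF modK b3 c(2) bc, symmetric]) (use c in \<open>simp add: closed\<close>)
    \<comment> \<open>The scalar is drawn into the argument in order to assemble
      \<open>rhit q (w \<cdot> b)\<close>, the component of the product in \<open>A\<close>.\<close>
    also have "\<dots> = sweedler ?K (w \<cdot> b) (\<lambda>u v. cq (?S x \<cdot> (q v \<odot>\<^bsub>H\<^esub> u)))"
    proof (rule sweedler_cong[OF wb])
      fix u v assume uv: "u \<in> carrier H" "v \<in> carrier H"
      have "(\<lambda>u. cq (?S x \<cdot> u)) \<in> dual" by (use c in \<open>auto intro!: rules cl\<close>)
      from linear_smult[OF this q_closed[OF uv(2)] uv(1)]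
      show "cq (?S x \<cdot> u) \<otimes>\<^bsub>K\<^esub> q v = cq (?S x \<cdot> (q v \<odot>\<^bsub>H\<^esub> u))"
        using uv c cq_closed[of "?S x \<cdot> u"] q_closed[of v] cring.cring_simprules(14)[OF cringK]
        by (simp add: closed)
    qed
    also have "\<dots> = cq (?S x \<cdot> rhit q (w \<cdot> b))"
      unfolding rhit_def
      by (rule sweedler_image[OF modC modK _ wb, symmetric]) (use c in \<open>auto intro!: rules cl\<close>)
    finally show "sweedler ?K b (\<lambda>b1 b2. sweedler ?K w (\<lambda>y z. cq ((?S x \<cdot> y) \<cdot> b1) \<otimes>\<^bsub>K\<^esub> q (z \<cdot> b2)))
      = cq (?S x \<cdot> rhit q (w \<cdot> b))" .
  qed
  also have "\<dots> \<in> {\<zero>\<^bsub>?K\<^esub>}"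
  proof (rule sweedler_subcoalgebra_mem[OF A_sub a modK b4 zero_submodule[OF modK]])
    fix x y assume "x \<in> A" "y \<in> A"
    then show "cq (?S x \<cdot> rhit q (y \<cdot> b)) \<in> {\<zero>\<^bsub>?K\<^esub>}"
      using cq_A[OF A_mult[OF A_antipode lhit_A]] rhit_eq_lhit A_carrier bc by (simp add: closed)
  qed
  finally show ?thesis by simp
qed

text \<open>The mirror image: \<open>q (b a) = \<Sum> \<phi> (b\<^sub>2 a\<^sub>2 S a\<^sub>3) q
  (b\<^sub>1 a\<^sub>1)\<close> with \<phi> = \<epsilon> - q. Here the sum over the factors
  \<open>b\<^sub>1 a\<^sub>1\<close> and \<open>b\<^sub>2 a\<^sub>2\<close> yields
  \<open>lhit q\<close>, again with values in \<open>A\<close>, where \<phi> vanishes.\<close>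

lemma q_mult_right_B:
  assumes a: "a \<in> A" and b: "b \<in> B"
  shows "q (b \<cdot> a) = \<zero>\<^bsub>K\<^esub>"
proof -
  let ?S = "antipode H" and ?K = "self_module K"
  note ac = A_carrier[OF a] and bc = B_carrier[OF b]
  note rules = linear_rules linear_comp[OF q_dual] linear_comp[OF cq_dual]
  note cl = closed q_closed cq_closed
  have b1: "(\<lambda>x y. counit H y \<otimes>\<^bsub>K\<^esub> q (x \<cdot> a)) \<in> bilinear_maps K H H ?K"
    "(\<lambda>x y. cq y \<otimes>\<^bsub>K\<^esub> q (x \<cdot> a)) \<in> bilinear_maps K H H ?K"
    by (rule bilinear_mapsI; use ac in \<open>auto intro!: rules cl\<close>)+
  have b2: "(\<lambda>u v. cq (b2 \<cdot> v) \<otimes>\<^bsub>K\<^esub> q (b1 \<cdot> u)) \<in> bilinear_maps K H H ?K"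
    if "b1 \<in> carrier H" "b2 \<in> carrier H" for b1 b2
    by (rule bilinear_mapsI; use that in \<open>auto intro!: rules cl\<close>)
  have b3: "(\<lambda>u v. cq (v \<cdot> x) \<otimes>\<^bsub>K\<^esub> q u) \<in> bilinear_maps K H H ?K" if "x \<in> carrier H" for x
    by (rule bilinear_mapsI; use that in \<open>auto intro!: rules cl\<close>)
  have b4: "(\<lambda>w z. cq (lhit q (b \<cdot> w) \<cdot> ?S z)) \<in> bilinear_maps K H H ?K"
    by (rule bilinear_mapsI; use bc in \<open>auto intro!: rules cl linear_comp[OF lhit_linear[OF q_dual]]
      linear_closed[OF lhit_linear[OF q_dual]]\<close>)
  have "q (b \<cdot> a) = sweedler ?K b (\<lambda>x y. counit H y \<otimes>\<^bsub>K\<^esub> q (x \<cdot> a))"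
    using sweedler_counit_right[OF modK _ bc, of "\<lambda>y. q (y \<cdot> a)"] ac by (simp add: rules)
  also have "\<dots> = sweedler ?K b (\<lambda>x y. cq y \<otimes>\<^bsub>K\<^esub> q (x \<cdot> a))"
    by (rule sweedler_subcoalgebra_cong[OF B_sub b modK b1]) (simp add: cq_B)
  also have "\<dots> = sweedler ?K b (\<lambda>b1 b2. sweedler ?K a (\<lambda>w z. sweedler ?K w (\<lambda>x y.
      cq (b2 \<cdot> (y \<cdot> ?S z)) \<otimes>\<^bsub>K\<^esub> q (b1 \<cdot> x))))"
  proof (rule sweedler_cong[OF bc])
    fix b1 b2 assume c: "b1 \<in> carrier H" "b2 \<in> carrier H"
    show "cq b2 \<otimes>\<^bsub>K\<^esub> q (b1 \<cdot> a) = sweedler ?K a (\<lambda>w z. sweedler ?K w (\<lambda>x y.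
      cq (b2 \<cdot> (y \<cdot> ?S z)) \<otimes>\<^bsub>K\<^esub> q (b1 \<cdot> x)))"
      using cancel_right[OF modK b2[OF c] ac] c by (simp add: multH_one)
  qed
  also have "\<dots> = sweedler ?K a (\<lambda>w z. sweedler ?K b (\<lambda>b1 b2. sweedler ?K w (\<lambda>x y.
      cq (b2 \<cdot> (y \<cdot> ?S z)) \<otimes>\<^bsub>K\<^esub> q (b1 \<cdot> x))))"
    by (rule sweedler_swap[OF modK bc ac]) (auto intro!: sweedler_closed[OF modK, simplified] cl)
  also have "\<dots> = sweedler ?K a (\<lambda>w z. cq (lhit q (b \<cdot> w) \<cdot> ?S z))"
  proof (rule sweedler_cong[OF ac])
    fix w z assume c: "w \<in> carrier H" "z \<in> carrier H"
    have bw: "b \<cdot> w \<in> carrier H" using c bc by (simp add: closed)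
    have "sweedler ?K b (\<lambda>b1 b2. sweedler ?K w (\<lambda>x y. cq (b2 \<cdot> (y \<cdot> ?S z)) \<otimes>\<^bsub>K\<^esub> q (b1 \<cdot> x)))
      = sweedler ?K b (\<lambda>b1 b2. sweedler ?K w (\<lambda>x y. cq ((b2 \<cdot> y) \<cdot> ?S z) \<otimes>\<^bsub>K\<^esub> q (b1 \<cdot> x)))"
      by (rule sweedler_cong[OF bc], rule sweedler_cong[OF c(1)]) (use c in \<open>simp add: multH_assoc closed\<close>)
    also have "\<dots> = sweedler ?K (b \<cdot> w) (\<lambda>u v. cq (v \<cdot> ?S z) \<otimes>\<^bsub>K\<^esub> q u)"
      by (rule sweedler_mult[OF modK b3 bc c(1), symmetric]) (use c in \<open>simp add: closed\<close>)
    also have "\<dots> = sweedler ?K (b \<cdot> w) (\<lambda>u v. cq ((q u \<odot>\<^bsub>H\<^esub> v) \<cdot> ?S z))"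
    proof (rule sweedler_cong[OF bw])
      fix u v assume uv: "u \<in> carrier H" "v \<in> carrier H"
      have "(\<lambda>v. cq (v \<cdot> ?S z)) \<in> dual" by (use c in \<open>auto intro!: rules cl\<close>)
      from linear_smult[OF this q_closed[OF uv(1)] uv(2)]
      show "cq (v \<cdot> ?S z) \<otimes>\<^bsub>K\<^esub> q u = cq ((q u \<odot>\<^bsub>H\<^esub> v) \<cdot> ?S z)"
        using uv c cq_closed[of "v \<cdot> ?S z"] q_closed[of u] cring.cring_simprules(14)[OF cringK]
        by (simp add: closed)
    qed
    also have "\<dots> = cq (lhit q (b \<cdot> w) \<cdot> ?S z)"
      unfolding lhit_def
      by (rule sweedler_image[OF modC modK _ bw, symmetric]) (use c in \<open>auto intro!: rules cl\<close>)
    finally show "sweedler ?K b (\<lambda>b1 b2. sweedler ?K w (\<lambda>x y. cq (b2 \<cdot> (y \<cdot> ?S z)) \<otimes>\<^bsub>K\<^esub> q (b1 \<cdot> x)))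
      = cq (lhit q (b \<cdot> w) \<cdot> ?S z)" .
  qed
  also have "\<dots> \<in> {\<zero>\<^bsub>?K\<^esub>}"
  proof (rule sweedler_subcoalgebra_mem[OF A_sub a modK b4 zero_submodule[OF modK]])
    fix x y assume "x \<in> A" "y \<in> A"
    then show "cq (lhit q (b \<cdot> x) \<cdot> ?S y) \<in> {\<zero>\<^bsub>?K\<^esub>}"
      using cq_A[OF A_mult[OF lhit_A A_antipode]] A_carrier bc by (simp add: closed)
  qed
  finally show ?thesis by simp
qed

text \<open>Splitting \<open>h\<close> along \<open>A\<close> and \<open>B\<close>, the part in
  \<open>A\<close> is handled by multiplicativity of the counit and the part in \<open>B\<close> by
  the two preceding lemmas.\<close>

lemma q_mult:
  assumes a: "a \<in> A" and h: "h \<in> carrier H"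
  shows "q (a \<cdot> h) = counit H a \<otimes>\<^bsub>K\<^esub> q h" "q (h \<cdot> a) = q h \<otimes>\<^bsub>K\<^esub> counit H a"
proof -
  note rules = linear_rules linear_comp[OF q_dual]
  obtain a' b where ab: "a' \<in> A" "b \<in> B" "h = a' \<oplus>\<^bsub>H\<^esub> b"
    using A_B h unfolding complementary_def by blast
  note c = A_carrier[OF a] A_carrier[OF ab(1)] B_carrier[OF ab(2)]
  have qh: "q h = counit H a'"
    using linear_add[OF q_dual c(2,3)] q_A[OF ab(1)] q_B[OF ab(2)] counit_closed[OF c(2)] ab(3) by simp
  have l1: "(\<lambda>h. q (a \<cdot> h)) \<in> dual" and l2: "(\<lambda>h. q (h \<cdot> a)) \<in> dual"
    using c by (auto intro!: rules)
  show "q (a \<cdot> h) = counit H a \<otimes>\<^bsub>K\<^esub> q h"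
    using linear_add[OF l1 c(2,3)] q_mult_left_B[OF a ab(2)] q_A[OF A_mult[OF a ab(1)]] qh ab(3) c
    by (simp add: counit_mult closed)
  show "q (h \<cdot> a) = q h \<otimes>\<^bsub>K\<^esub> counit H a"
    using linear_add[OF l2 c(2,3)] q_mult_right_B[OF a ab(2)] q_A[OF A_mult[OF ab(1) a]] qh ab(3) c
    by (simp add: counit_mult closed)
qed

end

section \<open>Quotient coalgebras\<close>

lemma quotient_linear_descend:
  assumes M: "module K M" and N: "submodule N K M" and f: "f \<in> linear_maps K M P"
    and g: "\<And>x. x \<in> carrier M \<Longrightarrow> g (N +>\<^bsub>M\<^esub> x) = f x"
  shows "g \<in> linear_maps K (quotient_module K M N) P"
proof -
  interpret M: module K M by fact
  show ?thesis
    by (rule linear_mapsI)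
      (auto simp: quotient_carrier[OF M N] quotient_add[OF M N] quotient_smult[OF M N] g
        linear_closed[OF f] linear_add[OF f] linear_smult[OF f])
qed

text \<open>The quotient coalgebra and the quotient module are different records with the same
  module components. This and the following lemmas carry linear maps and tensor products from one to
  the other.\<close>

lemma quotient_coalgebra_simps [simp]:
  "carrier (quotient_coalgebra K C I) = carrier (quotient_module K C I)"
  "zero (quotient_coalgebra K C I) = zero (quotient_module K C I)"
  "add (quotient_coalgebra K C I) = add (quotient_module K C I)"
  "smult (quotient_coalgebra K C I) = smult (quotient_module K C I)"
  by (simp_all add: quotient_coalgebra_def Let_def)

lemma linear_maps_quotient_coalgebra [simp]:
  "linear_maps K (quotient_coalgebra K C I) P = linear_maps K (quotient_module K C I) P"
  "linear_maps K P (quotient_coalgebra K C I) = linear_maps K P (quotient_module K C I)"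
  by (simp_all add: linear_maps_def)

lemma bilinear_maps_quotient_coalgebra [simp]:
  "bilinear_maps K (quotient_coalgebra K C I) (quotient_coalgebra K C I) P
    = bilinear_maps K (quotient_module K C I) (quotient_module K C I) P"
  by (simp add: bilinear_maps_def)

lemma tensor_quotient_coalgebra:
  "tensor K (quotient_coalgebra K C I) N = tensor K (quotient_module K C I) N"
  "tensor K N (quotient_coalgebra K C I) = tensor K N (quotient_module K C I)"
  "tensor_elem K (quotient_coalgebra K C I) N = tensor_elem K (quotient_module K C I) N"
  "tensor_elem K N (quotient_coalgebra K C I) = tensor_elem K N (quotient_module K C I)"
  by (simp_all add: fun_eq_iff tensor_def tensor_elem_def tensor_relations_def)

lemma tensor_lift_quotient_coalgebra:
  "tensor_lift K (quotient_coalgebra K C I) = tensor_lift K (quotient_module K C I)"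
  by (simp add: fun_eq_iff tensor_lift_def finsum_def finprod_def)

lemma module_quotient_coalgebra:
  assumes "module K (quotient_module K C I)"
  shows "module K (quotient_coalgebra K C I)"
proof -
  interpret Q: module K "quotient_module K C I" by fact
  show ?thesis
  proof (rule moduleI)
    show "abelian_group (quotient_coalgebra K C I)"
      by (rule abelian_groupI)
        (auto simp: Q.a_ac Q.l_neg intro: bexI[of _ "\<ominus>\<^bsub>quotient_module K C I\<^esub> x" for x])
  qed (auto simp: Q.R.cring_axioms Q.smult_l_distr Q.smult_r_distr Q.smult_assoc1)
qed

context coalgebra
begin

text \<open>The coideal condition \<Delta> I \<subseteq> I \<otimes> C + C \<otimes> I is given in
  the equivalent form that \<pi> \<otimes> \<pi> annihilates \<Delta> I, which is what independence
  of representatives asks for.\<close>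

context
  fixes I
  assumes I: "submodule I K C"
    and counit_I: "\<And>x. x \<in> I \<Longrightarrow> counit C x = \<zero>\<^bsub>K\<^esub>"
    and comult_I: "\<And>x. x \<in> I \<Longrightarrow> sweedler (tensor K (quotient_module K C I) (quotient_module K C I)) x
      (\<lambda>y z. tensor_elem K (quotient_module K C I) (quotient_module K C I) (I +>\<^bsub>C\<^esub> y) (I +>\<^bsub>C\<^esub> z))
      = \<zero>\<^bsub>tensor K (quotient_module K C I) (quotient_module K C I)\<^esub>"
begin

private abbreviation (input) "QI \<equiv> quotient_module K C I"
private abbreviation (input) "CQI \<equiv> quotient_coalgebra K C I"
private abbreviation (input) "pI \<equiv> \<lambda>x. I +>\<^bsub>C\<^esub> x"
private abbreviation (input) "T \<equiv> tensor K QI QI"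
private abbreviation (input) "e \<equiv> tensor_elem K QI QI"

lemma modQ: "module K QI" by (rule quotient_is_module[OF modC I])
lemma modTQ: "module K T" by (rule tensor_module[OF modQ modQ])
lemma proj_linear: "pI \<in> linear_maps K C QI" by (rule quotient_proj_linear[OF modC I])
lemma proj_closed: "x \<in> carrier C \<Longrightarrow> pI x \<in> carrier QI" by (rule linear_closed[OF proj_linear])
lemma proj_surj: "X \<in> carrier QI \<Longrightarrow> \<exists>x\<in>carrier C. X = pI x" by (auto simp: quotient_carrier[OF modC I])

lemma linear_coset_const:
  assumes P: "module K P" and f: "f \<in> linear_maps K C P" and f0: "\<And>x. x \<in> I \<Longrightarrow> f x = \<zero>\<^bsub>P\<^esub>" and x: "x \<in> carrier C"
  shows "the_elem (f ` pI x) = f x"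
proof (rule the_elem_image_eq)
  interpret P: module K P by fact
  show "pI x \<noteq> {}" using coset_self[OF modC I x] by blast
  fix y assume "y \<in> pI x"
  then have y: "y \<in> carrier C" "y \<ominus>\<^bsub>C\<^esub> x \<in> I" using coset_mem_iff[OF modC I x] by blast+
  then have "f y \<ominus>\<^bsub>P\<^esub> f x = \<zero>\<^bsub>P\<^esub>"
    using linear_minus[OF modC P f y(1) x] f0 by simp
  then show "f y = f x" using P.minus_eq_zero_iff linear_closed[OF f] y x by blast
qed

lemma proj_bilinear: "(\<lambda>y z. e (pI y) (pI z)) \<in> bilinear_maps K C C T"
  by (rule bilinear_mapsI)
    (auto intro!: bilinear_right[OF tensor_elem_bilinear[OF modQ modQ]]
      bilinear_left[OF tensor_elem_bilinear[OF modQ modQ]] proj_linear proj_closed)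

lemma counit_quotient: "x \<in> carrier C \<Longrightarrow> counit CQI (pI x) = counit C x"
  using linear_coset_const[OF modK counit_linear] counit_I by (simp add: quotient_coalgebra_def Let_def)

lemma comult_quotient:
  assumes x: "x \<in> carrier C"
  shows "comult CQI (pI x) = sweedler T x (\<lambda>y z. e (pI y) (pI z))"
proof -
  let ?f = "\<lambda>x. tensor_lift K T (\<lambda>y z. e (pI y) (pI z)) (comult C x)"
  have f: "?f \<in> linear_maps K C T"
    by (rule linear_comp[OF tensor_lift_linear[OF modC modC modTQ proj_bilinear] comult_linear])
  have fs: "?f y = sweedler T y (\<lambda>y z. e (pI y) (pI z))" if "y \<in> carrier C" for y
    by (rule sweedler_eq_tensor_lift[OF modTQ proj_bilinear that])
  have "the_elem (?f ` pI x) = ?f x"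
    by (rule linear_coset_const[OF modTQ f _ x]) (use fs comult_I submodule_carrier[OF I] in simp)
  then show ?thesis using fs[OF x] by (simp add: quotient_coalgebra_def Let_def)
qed

lemma comult_quotient_linear: "comult CQI \<in> linear_maps K QI T"
  by (rule quotient_linear_descend[OF modC I sweedler_linear[OF modTQ proj_bilinear linear_id modC] comult_quotient])

lemma counit_quotient_linear: "counit CQI \<in> linear_maps K QI (self_module K)"
  by (rule quotient_linear_descend[OF modC I counit_linear counit_quotient])

text \<open>Computations in the quotient are carried out on representatives: a bilinear map on the
  quotient is pulled back along the projection and summed over \<Delta> x in
  \<open>C\<close>.\<close>

lemma tensor_lift_comult_quotient:
  assumes P: "module K P" and \<beta>: "\<beta> \<in> bilinear_maps K QI QI P" and x: "x \<in> carrier C"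
  shows "tensor_lift K P \<beta> (comult CQI (pI x)) = sweedler P x (\<lambda>y z. \<beta> (pI y) (pI z))"
proof -
  have "tensor_lift K P \<beta> (comult CQI (pI x)) = sweedler P x (\<lambda>y z. tensor_lift K P \<beta> (e (pI y) (pI z)))"
    unfolding comult_quotient[OF x]
    by (rule sweedler_image[OF modTQ P tensor_lift_linear[OF modQ modQ P \<beta>] x])
      (auto intro!: tensor_elem_closed[OF modQ modQ] proj_closed)
  also have "\<dots> = sweedler P x (\<lambda>y z. \<beta> (pI y) (pI z))"
    by (rule sweedler_cong[OF x]) (simp add: tensor_lift_elem[OF modQ modQ P \<beta>] proj_closed)
  finally show ?thesis .
qed

text \<open>On a representative both sides become iterated sums in \<open>C\<close> of the trilinear
  map \<pi> x \<otimes> (\<pi> y \<otimes> \<pi> z), so \<open>sweedler_coassoc\<close>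
  applies.\<close>

lemma quotient_coassoc:
  assumes X: "X \<in> carrier QI"
  shows "tensor_lift K (tensor K QI T) (\<lambda>x y. tensor_lift K (tensor K QI T)
       (\<lambda>x1 x2. tensor_elem K QI T x1 (e x2 y)) (comult CQI x)) (comult CQI X)
     = tensor_lift K (tensor K QI T) (\<lambda>x y. tensor_elem K QI T x (comult CQI y)) (comult CQI X)"
proof -
  obtain c where c: "c \<in> carrier C" "X = pI c" using proj_surj[OF X] by blast
  let ?TT = "tensor K QI T" and ?ee = "tensor_elem K QI T"
  have TT: "module K ?TT" by (rule tensor_module[OF modQ modTQ])
  note eb = tensor_elem_bilinear[OF modQ modQ] and eeb = tensor_elem_bilinear[OF modQ modTQ]
  note ec = tensor_elem_closed[OF modQ modQ]
  note rules = bilinear_right[OF eeb] bilinear_left[OF eeb] bilinear_right[OF eb] bilinear_left[OF eb]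
    linear_id proj_linear ec proj_closed
  have inner: "(\<lambda>x1 x2. ?ee x1 (e x2 y)) \<in> bilinear_maps K QI QI ?TT" if "y \<in> carrier QI" for y
    by (rule bilinear_mapsI) (use that in \<open>auto intro!: rules\<close>)
  have inner_eq: "tensor_lift K ?TT (\<lambda>x1 x2. ?ee x1 (e x2 y)) (comult CQI (pI u))
      = sweedler ?TT u (\<lambda>u1 u2. ?ee (pI u1) (e (pI u2) y))" if "y \<in> carrier QI" "u \<in> carrier C" for y u
    by (rule tensor_lift_comult_quotient[OF TT inner[OF that(1)] that(2)])
  have outer: "(\<lambda>x y. tensor_lift K ?TT (\<lambda>x1 x2. ?ee x1 (e x2 y)) (comult CQI x)) \<in> bilinear_maps K QI QI ?TT"
  proof (rule bilinear_mapsI)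
    fix x assume "x \<in> carrier QI"
    then obtain u where u: "u \<in> carrier C" "x = pI u" using proj_surj by blast
    have "(\<lambda>y. sweedler ?TT u (\<lambda>u1 u2. ?ee (pI u1) (e (pI u2) y))) \<in> linear_maps K QI ?TT"
      by (rule sweedler_linear_fun[OF TT u(1)]) (auto intro!: rules)
    then show "(\<lambda>y. tensor_lift K ?TT (\<lambda>x1 x2. ?ee x1 (e x2 y)) (comult CQI x)) \<in> linear_maps K QI ?TT"
      by (rule linear_cong[OF _ modQ]) (simp add: u inner_eq)
  next
    fix y assume "y \<in> carrier QI"
    then show "(\<lambda>x. tensor_lift K ?TT (\<lambda>x1 x2. ?ee x1 (e x2 y)) (comult CQI x)) \<in> linear_maps K QI ?TT"
      by (intro linear_comp[OF tensor_lift_linear[OF modQ modQ TT inner] comult_quotient_linear])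
  qed
  have right: "(\<lambda>x y. ?ee x (comult CQI y)) \<in> bilinear_maps K QI QI ?TT"
    by (rule bilinear_mapsI)
      (auto intro!: rules comult_quotient_linear linear_closed[OF comult_quotient_linear])
  have "tensor_lift K ?TT (\<lambda>x y. tensor_lift K ?TT (\<lambda>x1 x2. ?ee x1 (e x2 y)) (comult CQI x)) (comult CQI X)
      = sweedler ?TT c (\<lambda>u y. tensor_lift K ?TT (\<lambda>x1 x2. ?ee x1 (e x2 (pI y))) (comult CQI (pI u)))"
    unfolding c(2) by (rule tensor_lift_comult_quotient[OF TT outer c(1)])
  also have "\<dots> = sweedler ?TT c (\<lambda>u z. sweedler ?TT u (\<lambda>x y. ?ee (pI x) (e (pI y) (pI z))))"
    by (rule sweedler_cong[OF c(1)]) (simp add: inner_eq proj_closed)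
  also have "\<dots> = sweedler ?TT c (\<lambda>x w. sweedler ?TT w (\<lambda>y z. ?ee (pI x) (e (pI y) (pI z))))"
    by (rule sweedler_coassoc[OF TT c(1)]) (auto intro!: rules)
  also have "\<dots> = sweedler ?TT c (\<lambda>x w. ?ee (pI x) (comult CQI (pI w)))"
  proof (rule sweedler_cong[OF c(1)])
    fix x w assume xw: "x \<in> carrier C" "w \<in> carrier C"
    show "sweedler ?TT w (\<lambda>y z. ?ee (pI x) (e (pI y) (pI z))) = ?ee (pI x) (comult CQI (pI w))"
      unfolding comult_quotient[OF xw(2)]
      by (rule sweedler_image[OF modTQ TT bilinear_right[OF eeb proj_closed[OF xw(1)] linear_id] xw(2), symmetric])
        (auto intro!: rules)
  qed
  also have "\<dots> = tensor_lift K ?TT (\<lambda>x y. ?ee x (comult CQI y)) (comult CQI X)"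
    unfolding c(2) by (rule tensor_lift_comult_quotient[OF TT right c(1), symmetric])
  finally show ?thesis .
qed

lemma quotient_counit:
  assumes X: "X \<in> carrier QI"
  shows "tensor_lift K QI (\<lambda>x y. counit CQI x \<odot>\<^bsub>QI\<^esub> y) (comult CQI X) = X"
    and "tensor_lift K QI (\<lambda>x y. counit CQI y \<odot>\<^bsub>QI\<^esub> x) (comult CQI X) = X"
proof -
  obtain c where c: "c \<in> carrier C" "X = pI c" using proj_surj[OF X] by blast
  have cl: "counit CQI x \<in> carrier K" if "x \<in> carrier QI" for x
    using linear_closed[OF counit_quotient_linear that] by simp
  have b: "(\<lambda>x y. counit CQI x \<odot>\<^bsub>QI\<^esub> y) \<in> bilinear_maps K QI QI QI" "(\<lambda>x y. counit CQI y \<odot>\<^bsub>QI\<^esub> x) \<in> bilinear_maps K QI QI QI"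
    by (rule bilinear_mapsI;
        auto intro!: smult_linear_left[OF modQ] smult_linear_right[OF modQ] cl linear_id counit_quotient_linear)+
  have "sweedler QI c (\<lambda>y z. counit CQI (pI y) \<odot>\<^bsub>QI\<^esub> pI z) = sweedler QI c (\<lambda>y z. counit C y \<odot>\<^bsub>QI\<^esub> pI z)"
    "sweedler QI c (\<lambda>y z. counit CQI (pI z) \<odot>\<^bsub>QI\<^esub> pI y) = sweedler QI c (\<lambda>y z. counit C z \<odot>\<^bsub>QI\<^esub> pI y)"
    by (rule sweedler_cong[OF c(1)]; simp add: counit_quotient)+
  then show "tensor_lift K QI (\<lambda>x y. counit CQI x \<odot>\<^bsub>QI\<^esub> y) (comult CQI X) = X"
    "tensor_lift K QI (\<lambda>x y. counit CQI y \<odot>\<^bsub>QI\<^esub> x) (comult CQI X) = X"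
    using tensor_lift_comult_quotient[OF modQ b(1) c(1)] tensor_lift_comult_quotient[OF modQ b(2) c(1)]
      sweedler_counit_left[OF modQ proj_linear c(1)] sweedler_counit_right[OF modQ proj_linear c(1)] c(2)
    by simp_all
qed

lemma quotient_is_coalgebra: "coalgebra K CQI"
proof -
  interpret CQI: module K CQI by (rule module_quotient_coalgebra[OF modQ])
  show ?thesis
    by unfold_locales
      (simp_all add: tensor_quotient_coalgebra tensor_lift_quotient_coalgebra comult_quotient_linear
        counit_quotient_linear quotient_coassoc quotient_counit)
qed

end

end

section \<open>The quotient by a Hopf subalgebra\<close>

context hopf_subalgebra_complement
begin

section \<open>The coideal H A^+\<close>

abbreviation "AH \<equiv> gen_left_ideal H (augmentation_part K H A)"
abbreviation "Q \<equiv> quotient_module K H AH"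
abbreviation "CQ \<equiv> quotient_coalgebra K H AH"
abbreviation "p \<equiv> \<lambda>x. AH +>\<^bsub>H\<^esub> x"

text \<open>Serves as induction principle: a property is proved for all of \<open>AH\<close> by
  showing that the elements with this property form a left ideal containing A^+.\<close>

lemma gen_left_ideal_least: "left_ideal J H \<Longrightarrow> augmentation_part K H A \<subseteq> J \<Longrightarrow> x \<in> AH \<Longrightarrow> x \<in> J"
  by (auto simp: gen_left_ideal_def)

lemma augmentation_incl: "x \<in> augmentation_part K H A \<Longrightarrow> x \<in> AH"
  by (auto simp: gen_left_ideal_def)

lemma submodule_left_idealI:
  assumes "submodule J K H" "\<And>r x. r \<in> carrier H \<Longrightarrow> x \<in> J \<Longrightarrow> r \<cdot> x \<in> J"
  shows "left_ideal J H"
  using assms submodule.axioms(1)[OF assms(1)] by (simp add: left_ideal_def additive_subgroup_def)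

lemma AH_mult: "r \<in> carrier H \<Longrightarrow> x \<in> AH \<Longrightarrow> r \<cdot> x \<in> AH"
  by (auto simp: gen_left_ideal_def left_ideal_def)

text \<open>Left ideals are additive subgroups by definition; scalars act as left multiplication by
  multiples of the unit.\<close>

lemma AH_submodule: "submodule AH K H"
proof (rule module.submoduleI'[OF modC])
  have "left_ideal (carrier H) H"
    by (rule submodule_left_idealI[OF module.carrier_is_submodule[OF modC]]) (rule closed)
  then show sub: "AH \<subseteq> carrier H"
    by (intro subsetI) (rule gen_left_ideal_least, auto simp: augmentation_part_def)
  show "\<zero>\<^bsub>H\<^esub> \<in> AH"
    by (auto simp: gen_left_ideal_def left_ideal_def intro: additive_subgroup.zero_closed)
  show "x \<oplus>\<^bsub>H\<^esub> y \<in> AH" if "x \<in> AH" "y \<in> AH" for x y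
    using that by (auto simp: gen_left_ideal_def left_ideal_def intro: additive_subgroup.a_closed)
  show "a \<odot>\<^bsub>H\<^esub> x \<in> AH" if "a \<in> carrier K" "x \<in> AH" for a x
  proof -
    have "x \<in> carrier H" using that(2) sub by blast
    then have "(a \<odot>\<^bsub>H\<^esub> \<one>\<^bsub>H\<^esub>) \<cdot> x = a \<odot>\<^bsub>H\<^esub> x" using that(1) by (simp add: smult_mult_left closed multH_one)
    then show ?thesis using AH_mult[of "a \<odot>\<^bsub>H\<^esub> \<one>\<^bsub>H\<^esub>" x] that by (simp add: closed)
  qed
qed

lemma augmentation_part_D:
  assumes "x \<in> augmentation_part K H A"
  shows "x \<in> A" "x \<in> carrier H" "counit H x = \<zero>\<^bsub>K\<^esub>"
  using assms by (auto simp: augmentation_part_def)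

text \<open>The element lies in \<open>A\<close> and has counit zero. Hence every \<open>a\<close>
  in \<open>A\<close> is congruent to the scalar \<epsilon> a modulo \<open>AH\<close>.\<close>

lemma augmentation_decomp:
  assumes a: "a \<in> A"
  shows "a \<ominus>\<^bsub>H\<^esub> counit H a \<odot>\<^bsub>H\<^esub> \<one>\<^bsub>H\<^esub> \<in> AH"
proof -
  note ac = A_carrier[OF a]
  have "a \<ominus>\<^bsub>H\<^esub> counit H a \<odot>\<^bsub>H\<^esub> \<one>\<^bsub>H\<^esub> \<in> A"
    by (rule submodule_minus[OF modC subcoalgebra_submodule[OF A_sub] a
      submodule_smult[OF subcoalgebra_submodule[OF A_sub] counit_closed[OF ac] A_one]])
  moreover have "counit H (a \<ominus>\<^bsub>H\<^esub> counit H a \<odot>\<^bsub>H\<^esub> \<one>\<^bsub>H\<^esub>) = \<zero>\<^bsub>K\<^esub>"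
    using linear_minus[OF modC modK counit_linear ac, of "counit H a \<odot>\<^bsub>H\<^esub> \<one>\<^bsub>H\<^esub>"]
      linear_smult[OF counit_linear counit_closed[OF ac] oneH_closed] ac counit_closed[OF ac]
    by (simp add: closed counit_one)
  ultimately show "a \<ominus>\<^bsub>H\<^esub> counit H a \<odot>\<^bsub>H\<^esub> \<one>\<^bsub>H\<^esub> \<in> AH"
    using A_carrier by (intro augmentation_incl) (simp add: augmentation_part_def)
qed

lemma counit_AH:
  assumes x: "x \<in> AH" shows "counit H x = \<zero>\<^bsub>K\<^esub>"
proof -
  let ?J = "{x \<in> carrier H. counit H x \<in> {\<zero>\<^bsub>self_module K\<^esub>}}"
  have "x \<in> ?J"
  proof (rule gen_left_ideal_least[OF submodule_left_idealI _ x])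
    show "submodule ?J K H" by (rule linear_kernel_submodule[OF modC modK counit_linear zero_submodule[OF modK]])
    show "r \<cdot> x \<in> ?J" if "r \<in> carrier H" "x \<in> ?J" for r x
      using that by (simp add: counit_mult closed)
    show "augmentation_part K H A \<subseteq> ?J" using augmentation_part_D by auto
  qed
  then show ?thesis by simp
qed

text \<open>The coideal property of \<open>AH\<close>, tested against bilinear maps. Left
  multiplication by \<open>r\<close> replaces \<beta> by translates of \<beta> in both arguments, so
  the left ideal \<open>J\<close> has to quantify over the whole class \<open>W\<close> of
  admissible maps, which is closed under such translates.\<close>

lemma sweedler_AH:
  assumes P: "module K P" and x: "x \<in> AH" and \<beta>: "\<beta> \<in> bilinear_maps K H H P"
    and \<beta>0: "\<And>u v. \<lbrakk>u \<in> AH; v \<in> carrier H\<rbrakk> \<Longrightarrow> \<beta> u v = \<zero>\<^bsub>P\<^esub>" "\<And>u v. \<lbrakk>u \<in> carrier H; v \<in> AH\<rbrakk> \<Longrightarrow> \<beta> u v = \<zero>\<^bsub>P\<^esub>"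
  shows "sweedler P x \<beta> = \<zero>\<^bsub>P\<^esub>"
proof -
  interpret P: module K P by fact
  define W where "W = {\<beta> \<in> bilinear_maps K H H P. (\<forall>u\<in>AH. \<forall>v\<in>carrier H. \<beta> u v = \<zero>\<^bsub>P\<^esub>) \<and>
    (\<forall>u\<in>carrier H. \<forall>v\<in>AH. \<beta> u v = \<zero>\<^bsub>P\<^esub>)}"
  define J where "J = {x \<in> carrier H. \<forall>\<beta>\<in>W. sweedler P x \<beta> = \<zero>\<^bsub>P\<^esub>}"
  have lin: "(\<lambda>x. sweedler P x \<beta>) \<in> linear_maps K H P" if "\<beta> \<in> W" for \<beta>
    by (rule sweedler_linear[OF P _ linear_id modC]) (use that in \<open>simp add: W_def\<close>)
  have sJ: "submodule J K H"
    by (rule module.submoduleI'[OF modC])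
      (auto simp: J_def linear_zero[OF modC P lin] linear_add[OF lin] linear_smult[OF lin])
  have "x \<in> J"
  proof (rule gen_left_ideal_least[OF submodule_left_idealI[OF sJ] _ x])
    fix r x assume r: "r \<in> carrier H" and "x \<in> J"
    then have x: "x \<in> carrier H" "\<And>\<beta>. \<beta> \<in> W \<Longrightarrow> sweedler P x \<beta> = \<zero>\<^bsub>P\<^esub>" by (auto simp: J_def)
    have "sweedler P (r \<cdot> x) \<beta> = \<zero>\<^bsub>P\<^esub>" if \<beta>: "\<beta> \<in> W" for \<beta>
    proof -
      have b: "\<beta> \<in> bilinear_maps K H H P" using \<beta> by (simp add: W_def)
      have "(\<lambda>x1 x2. \<beta> (r1 \<cdot> x1) (r2 \<cdot> x2)) \<in> W" if "r1 \<in> carrier H" "r2 \<in> carrier H" for r1 r2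
      proof -
        have "(\<lambda>x1 x2. \<beta> (r1 \<cdot> x1) (r2 \<cdot> x2)) \<in> bilinear_maps K H H P"
          by (rule bilinear_mapsI)
            (use that in \<open>auto intro!: bilinear_right[OF b] bilinear_left[OF b] linear_rules closed\<close>)
        then show ?thesis using \<beta> that AH_mult by (simp add: W_def closed)
      qed
      then show ?thesis
        unfolding sweedler_mult[OF P b r x(1)] by (intro sweedler_zero[OF P r] x(2))
    qed
    then show "r \<cdot> x \<in> J" using r x by (simp add: J_def closed)
  next
    show "augmentation_part K H A \<subseteq> J"
    proof
      fix a assume "a \<in> augmentation_part K H A"
      note a = augmentation_part_D[OF this]
      have "sweedler P a \<beta> = \<zero>\<^bsub>P\<^esub>" if \<beta>: "\<beta> \<in> W" for \<beta>
      proof -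
        have b: "\<beta> \<in> bilinear_maps K H H P" using \<beta> by (simp add: W_def)
        have lin1: "(\<lambda>v. \<beta> \<one>\<^bsub>H\<^esub> v) \<in> linear_maps K H P" by (rule bilinear_right[OF b oneH_closed linear_id])
        have b': "(\<lambda>u v. counit H u \<odot>\<^bsub>P\<^esub> \<beta> \<one>\<^bsub>H\<^esub> v) \<in> bilinear_maps K H H P"
          by (rule bilinear_mapsI)
            (auto intro!: smult_linear_right[OF P] smult_linear_left[OF P] lin1 linear_closed[OF lin1] counit_linear closed)
        \<comment> \<open>Inside \<open>A\<close> the first factor may be replaced by its counit.
          The sum then collapses to the value of \<beta> at the unit and \<open>a\<close>, which is
          zero as \<open>a\<close> belongs to A^+.\<close>
        have "sweedler P a \<beta> = sweedler P a (\<lambda>u v. counit H u \<odot>\<^bsub>P\<^esub> \<beta> \<one>\<^bsub>H\<^esub> v)"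
        proof (rule sweedler_subcoalgebra_cong[OF A_sub a(1) P b b'])
          fix u v assume uv: "u \<in> A" "v \<in> A"
          note uc = A_carrier[OF uv(1)] and vc = A_carrier[OF uv(2)]
          note lin2 = bilinear_left[OF b vc linear_id]
          have "\<beta> (u \<ominus>\<^bsub>H\<^esub> counit H u \<odot>\<^bsub>H\<^esub> \<one>\<^bsub>H\<^esub>) v = \<zero>\<^bsub>P\<^esub>"
            using \<beta> vc augmentation_decomp[OF uv(1)] by (simp add: W_def)
          then have "\<beta> u v \<ominus>\<^bsub>P\<^esub> counit H u \<odot>\<^bsub>P\<^esub> \<beta> \<one>\<^bsub>H\<^esub> v = \<zero>\<^bsub>P\<^esub>"
            using linear_minus[OF modC P lin2 uc, of "counit H u \<odot>\<^bsub>H\<^esub> \<one>\<^bsub>H\<^esub>"]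
              linear_smult[OF lin2 counit_closed[OF uc] oneH_closed] counit_closed[OF uc]
            by (simp add: closed)
          then show "\<beta> u v = counit H u \<odot>\<^bsub>P\<^esub> \<beta> \<one>\<^bsub>H\<^esub> v"
            using P.minus_eq_zero_iff bilinear_closed[OF b uc vc] linear_closed[OF lin1 vc] counit_closed[OF uc] by blast
        qed
        also have "\<dots> = \<beta> \<one>\<^bsub>H\<^esub> a" by (rule sweedler_counit_left[OF P lin1 a(2)])
        also have "\<dots> = \<zero>\<^bsub>P\<^esub>" using \<beta> augmentation_incl[OF \<open>a \<in> augmentation_part K H A\<close>] oneH_closed by (simp add: W_def)
        finally show ?thesis .
      qed
      then show "a \<in> J" using a by (simp add: J_def)
    qed
  qed
  moreover have "\<beta> \<in> W" using \<beta> \<beta>0 by (simp add: W_def)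
  ultimately show ?thesis by (simp add: J_def)
qed

lemmas modQ' = quotient_is_module[OF modC AH_submodule]
lemmas p_linear = quotient_proj_linear[OF modC AH_submodule]
lemmas p_closed = linear_closed[OF p_linear]
lemmas p_zero = quotient_proj_zero[OF modC AH_submodule]

lemma comult_AH:
  assumes x: "x \<in> AH"
  shows "sweedler (tensor K Q Q) x (\<lambda>y z. tensor_elem K Q Q (p y) (p z)) = \<zero>\<^bsub>tensor K Q Q\<^esub>"
proof -
  note T = tensor_module[OF modQ' modQ'] and eb = tensor_elem_bilinear[OF modQ' modQ']
  show ?thesis
  proof (rule sweedler_AH[OF T x])
    show "(\<lambda>y z. tensor_elem K Q Q (p y) (p z)) \<in> bilinear_maps K H H (tensor K Q Q)"
      by (rule bilinear_mapsI) (auto intro!: bilinear_right[OF eb] bilinear_left[OF eb] p_linear p_closed)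
    show "tensor_elem K Q Q (p u) (p v) = \<zero>\<^bsub>tensor K Q Q\<^esub>" if "u \<in> AH" "v \<in> carrier H" for u v
      using linear_zero[OF modQ' T bilinear_left[OF eb p_closed[OF that(2)] linear_id]] p_zero[OF that(1)] by simp
    show "tensor_elem K Q Q (p u) (p v) = \<zero>\<^bsub>tensor K Q Q\<^esub>" if "u \<in> carrier H" "v \<in> AH" for u v
      using linear_zero[OF modQ' T bilinear_right[OF eb p_closed[OF that(1)] linear_id]] p_zero[OF that(2)] by simp
  qed
qed

section \<open>The form on the quotient and its balance\<close>

lemmas coideal = AH_submodule counit_AH comult_AH

lemma quotient_coalgebra_CQ: "coalgebra K CQ"
  by (rule quotient_is_coalgebra[OF coideal])

text \<open>The product of \<open>w\<close> with a - \<epsilon> a 1 lies in \<open>AH\<close>, so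
  right multiplication by \<open>A\<close> becomes multiplication by the counit in the
  quotient.\<close>

lemma p_mult_A:
  assumes w: "w \<in> carrier H" and a: "a \<in> A"
  shows "p (w \<cdot> a) = counit H a \<odot>\<^bsub>Q\<^esub> p w"
proof -
  note ac = A_carrier[OF a]
  have "w \<cdot> (a \<ominus>\<^bsub>H\<^esub> counit H a \<odot>\<^bsub>H\<^esub> \<one>\<^bsub>H\<^esub>) \<in> AH"
    by (rule AH_mult[OF w augmentation_decomp[OF a]])
  moreover have "w \<cdot> (a \<ominus>\<^bsub>H\<^esub> counit H a \<odot>\<^bsub>H\<^esub> \<one>\<^bsub>H\<^esub>) = w \<cdot> a \<ominus>\<^bsub>H\<^esub> counit H a \<odot>\<^bsub>H\<^esub> w"
    using linear_minus[OF modC modC bilinear_right[OF mult_bilinear w linear_id] ac, of "counit H a \<odot>\<^bsub>H\<^esub> \<one>\<^bsub>H\<^esub>"]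
      w ac by (simp add: closed smult_mult_right multH_one)
  ultimately have "p (w \<cdot> a) = p (counit H a \<odot>\<^bsub>H\<^esub> w)"
    using w ac by (subst coset_eq_iff[OF modC AH_submodule]) (simp_all add: closed)
  then show ?thesis using w ac by (simp add: quotient_smult[OF modC AH_submodule] closed)
qed

text \<open>Quantifying over all \<open>x\<close> makes \<open>J\<close> a left ideal, since x (r y)
  = (x r) y; on A^+ the rule for q (h a) applies.\<close>

lemma q_AH_right:
  assumes y: "y \<in> AH" and x: "x \<in> carrier H" shows "q (x \<cdot> y) = \<zero>\<^bsub>K\<^esub>"
proof -
  let ?J = "{y \<in> carrier H. \<forall>x\<in>carrier H. q (x \<cdot> y) = \<zero>\<^bsub>K\<^esub>}"
  have lin: "(\<lambda>y. q (x \<cdot> y)) \<in> dual" if "x \<in> carrier H" for x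
    using that by (auto intro!: linear_rules linear_comp[OF q_dual])
  have "y \<in> ?J"
  proof (rule gen_left_ideal_least[OF submodule_left_idealI _ y])
    show "submodule ?J K H"
      by (rule module.submoduleI'[OF modC])
        (auto simp: closed linear_zero[OF modC modK lin, simplified] linear_zero[OF modC modK q_dual, simplified] linear_add[OF lin, simplified] linear_smult[OF lin, simplified])
    show "r \<cdot> y \<in> ?J" if "r \<in> carrier H" "y \<in> ?J" for r y
      using that by (simp add: closed flip: multH_assoc)
    show "augmentation_part K H A \<subseteq> ?J"
      using augmentation_part_D q_closed by (auto simp: q_mult)
  qed
  then show ?thesis using x by simp
qed

text \<open>As S reverses products, S (r x) y = S x (S r y), and so \<open>J\<close> is again a left
  ideal. Generators are sent by S into \<open>A\<close> with counit zero, where the rule for q (a h)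
  applies.\<close>

lemma q_AH_left:
  assumes x: "x \<in> AH" and y: "y \<in> carrier H" shows "q (antipode H x \<cdot> y) = \<zero>\<^bsub>K\<^esub>"
proof -
  let ?J = "{x \<in> carrier H. \<forall>y\<in>carrier H. q (antipode H x \<cdot> y) = \<zero>\<^bsub>K\<^esub>}"
  have lin: "(\<lambda>x. q (antipode H x \<cdot> y)) \<in> dual" if "y \<in> carrier H" for y
    using that by (auto intro!: linear_rules linear_comp[OF q_dual])
  have "x \<in> ?J"
  proof (rule gen_left_ideal_least[OF submodule_left_idealI _ x])
    show "submodule ?J K H"
      by (rule module.submoduleI'[OF modC])
        (auto simp: closed linear_zero[OF modC modK lin, simplified] linear_zero[OF modC modK q_dual, simplified] linear_add[OF lin, simplified] linear_smult[OF lin, simplified])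
    show "r \<cdot> x \<in> ?J" if "r \<in> carrier H" "x \<in> ?J" for r x
      using that by (simp add: closed antipode_mult multH_assoc)
    show "augmentation_part K H A \<subseteq> ?J"
      using augmentation_part_D q_closed by (auto simp: q_mult A_antipode counit_antipode)
  qed
  then show ?thesis using y by simp
qed

text \<open>The instance of \<open>functional_rhit\<close> in which the counit acts as the
  identity.\<close>

lemma counit_lhit: "x \<in> carrier H \<Longrightarrow> counit H (lhit q x) = q x"
  using functional_rhit[OF q_dual counit_linear] hit_counit(2) by simp

text \<open>Writing \<open>R x y\<close> for the right-hand side of \<open>balanced\<close> below, this says
  \<open>\<Sum> R w\<^sub>1 (w\<^sub>2 t) = q t \<pi> w\<close>, and \<open>R x y = \<Sum> R x\<^sub>1 (x\<^sub>2 S x\<^sub>3 y)\<close> reduces the general case to it.\<close>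

lemma balanced_mult:
  assumes w: "w \<in> carrier H" and t: "t \<in> carrier H"
  shows "sweedler Q w (\<lambda>u v. sweedler Q (v \<cdot> t) (\<lambda>r s. q (antipode H u \<cdot> r) \<odot>\<^bsub>Q\<^esub> p s)) = q t \<odot>\<^bsub>Q\<^esub> p w"
proof -
  let ?S = "antipode H"
  interpret Q: module K Q by (rule modQ')
  note rules = linear_rules linear_comp[OF q_dual] linear_comp[OF p_linear] modQ'
  note cl = closed q_closed p_closed Q.smult_closed
  have b1: "(\<lambda>r s. q (?S u \<cdot> r) \<odot>\<^bsub>Q\<^esub> p s) \<in> bilinear_maps K H H Q" if "u \<in> carrier H" for u
    by (rule bilinear_mapsI) (use that in \<open>auto intro!: rules cl\<close>)
  have b2: "(\<lambda>e f. sweedler Q t (\<lambda>t1 t2. q (e \<cdot> t1) \<odot>\<^bsub>Q\<^esub> p (f \<cdot> t2))) \<in> bilinear_maps K H H Q"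
    by (rule bilinear_mapsI) (use t in \<open>auto intro!: sweedler_linear_fun rules cl\<close>)
  have "sweedler Q w (\<lambda>u v. sweedler Q (v \<cdot> t) (\<lambda>r s. q (?S u \<cdot> r) \<odot>\<^bsub>Q\<^esub> p s))
    = sweedler Q w (\<lambda>u v. sweedler Q v (\<lambda>y z. sweedler Q t (\<lambda>t1 t2. q ((?S u \<cdot> y) \<cdot> t1) \<odot>\<^bsub>Q\<^esub> p (z \<cdot> t2))))"
  proof (rule sweedler_cong[OF w])
    fix u v assume uv: "u \<in> carrier H" "v \<in> carrier H"
    have "sweedler Q (v \<cdot> t) (\<lambda>r s. q (?S u \<cdot> r) \<odot>\<^bsub>Q\<^esub> p s)
      = sweedler Q v (\<lambda>y z. sweedler Q t (\<lambda>t1 t2. q (?S u \<cdot> (y \<cdot> t1)) \<odot>\<^bsub>Q\<^esub> p (z \<cdot> t2)))"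
      by (rule sweedler_mult[OF modQ' b1[OF uv(1)] uv(2) t])
    also have "\<dots> = sweedler Q v (\<lambda>y z. sweedler Q t (\<lambda>t1 t2. q ((?S u \<cdot> y) \<cdot> t1) \<odot>\<^bsub>Q\<^esub> p (z \<cdot> t2)))"
      by (rule sweedler_cong[OF uv(2)], rule sweedler_cong[OF t]) (use uv in \<open>simp add: multH_assoc closed\<close>)
    finally show "sweedler Q (v \<cdot> t) (\<lambda>r s. q (?S u \<cdot> r) \<odot>\<^bsub>Q\<^esub> p s)
      = sweedler Q v (\<lambda>y z. sweedler Q t (\<lambda>t1 t2. q ((?S u \<cdot> y) \<cdot> t1) \<odot>\<^bsub>Q\<^esub> p (z \<cdot> t2)))" .
  qed
  also have "\<dots> = sweedler Q t (\<lambda>t1 t2. q (\<one>\<^bsub>H\<^esub> \<cdot> t1) \<odot>\<^bsub>Q\<^esub> p (w \<cdot> t2))"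
    by (rule cancel_left[OF modQ' b2 w])
  also have "\<dots> = sweedler Q t (\<lambda>t1 t2. p (w \<cdot> (q t1 \<odot>\<^bsub>H\<^esub> t2)))"
    by (rule sweedler_cong[OF t])
      (use w in \<open>simp add: multH_one cl smult_mult_right quotient_smult[OF modC AH_submodule]\<close>)
  also have "\<dots> = p (w \<cdot> lhit q t)"
    unfolding lhit_def
    by (rule sweedler_image[OF modC modQ' _ t, symmetric]) (use w in \<open>auto intro!: rules cl\<close>)
  \<comment> \<open>The projection \<open>lhit q t\<close> of \<open>t\<close> to \<open>A\<close>
    has counit \<open>q t\<close>, and right multiplication by it is this scalar on the
    quotient.\<close>
  also have "\<dots> = q t \<odot>\<^bsub>Q\<^esub> p w"
    using p_mult_A[OF w lhit_A[OF t]] counit_lhit[OF t] by simp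
  finally show ?thesis .
qed

lemma balanced:
  assumes x: "x \<in> carrier H" and y: "y \<in> carrier H"
  shows "sweedler Q x (\<lambda>u v. q (antipode H v \<cdot> y) \<odot>\<^bsub>Q\<^esub> p u)
    = sweedler Q y (\<lambda>u v. q (antipode H x \<cdot> u) \<odot>\<^bsub>Q\<^esub> p v)"
proof -
  let ?S = "antipode H"
  interpret Q: module K Q by (rule modQ')
  note rules = linear_rules linear_comp[OF q_dual] linear_comp[OF p_linear] modQ'
  note cl = closed q_closed p_closed Q.smult_closed
  have b1: "(\<lambda>r s. q (?S u \<cdot> r) \<odot>\<^bsub>Q\<^esub> p s) \<in> bilinear_maps K H H Q" if "u \<in> carrier H" for u
    by (rule bilinear_mapsI) (use that in \<open>auto intro!: rules cl\<close>)
  have b2: "(\<lambda>u v. sweedler Q (v \<cdot> y) (\<lambda>r s. q (?S u \<cdot> r) \<odot>\<^bsub>Q\<^esub> p s)) \<in> bilinear_maps K H H Q"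
    by (rule bilinear_mapsI)
      (use y in \<open>auto intro!: sweedler_linear[OF modQ' b1] sweedler_linear_fun modC rules cl\<close>)
  have "sweedler Q y (\<lambda>u v. q (?S x \<cdot> u) \<odot>\<^bsub>Q\<^esub> p v)
    = sweedler Q x (\<lambda>w z. sweedler Q w (\<lambda>u v. sweedler Q ((v \<cdot> ?S z) \<cdot> y) (\<lambda>r s. q (?S u \<cdot> r) \<odot>\<^bsub>Q\<^esub> p s)))"
    using cancel_right[OF modQ' b2 x] y by (simp add: multH_one)
  also have "\<dots> = sweedler Q x (\<lambda>w z. sweedler Q w (\<lambda>u v. sweedler Q (v \<cdot> (?S z \<cdot> y)) (\<lambda>r s. q (?S u \<cdot> r) \<odot>\<^bsub>Q\<^esub> p s)))"
    by (rule sweedler_cong[OF x], rule sweedler_cong) (use y in \<open>simp_all add: multH_assoc closed\<close>)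
  \<comment> \<open>\<open>balanced_mult\<close> is used with t = S z y.\<close>
  also have "\<dots> = sweedler Q x (\<lambda>w z. q (?S z \<cdot> y) \<odot>\<^bsub>Q\<^esub> p w)"
    by (rule sweedler_cong[OF x], rule balanced_mult) (use y in \<open>simp_all add: closed\<close>)
  finally show ?thesis by simp
qed

text \<open>The choice of representatives is immaterial by \<open>\<tau>_proj\<close>.\<close>

definition \<tau> :: "'b set \<Rightarrow> 'b set \<Rightarrow> 'a" where
  "\<tau> X Y = q (antipode H (SOME x. x \<in> carrier H \<and> X = p x) \<cdot> (SOME y. y \<in> carrier H \<and> Y = p y))"

text \<open>Replacing \<open>x\<close> by the chosen \<open>x'\<close> changes the value by q (S (x
  - x') y), and then replacing \<open>y\<close> by \<open>y'\<close> changes it by q (S x' (y -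
  y')); the two vanishing lemmas for \<open>AH\<close> remove both.\<close>

lemma \<tau>_proj:
  assumes x: "x \<in> carrier H" and y: "y \<in> carrier H"
  shows "\<tau> (p x) (p y) = q (antipode H x \<cdot> y)"
proof -
  define x' where "x' = (SOME z. z \<in> carrier H \<and> p x = p z)"
  define y' where "y' = (SOME z. z \<in> carrier H \<and> p y = p z)"
  have x': "x' \<in> carrier H" "p x = p x'"
    unfolding x'_def using someI[of "\<lambda>z. z \<in> carrier H \<and> p x = p z" x] x by auto
  have y': "y' \<in> carrier H" "p y = p y'"
    unfolding y'_def using someI[of "\<lambda>z. z \<in> carrier H \<and> p y = p z" y] y by auto
  have xx: "x \<ominus>\<^bsub>H\<^esub> x' \<in> AH" using coset_eq_iff[OF modC AH_submodule x x'(1)] x'(2) by blast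
  have yy: "y \<ominus>\<^bsub>H\<^esub> y' \<in> AH" using coset_eq_iff[OF modC AH_submodule y y'(1)] y'(2) by blast
  have l1: "(\<lambda>x. q (antipode H x \<cdot> y)) \<in> dual" and l2: "(\<lambda>y. q (antipode H x' \<cdot> y)) \<in> dual"
    using x' y by (auto intro!: linear_rules linear_comp[OF q_dual] closed)
  interpret S: module K "self_module K" by (rule modK)
  have "q (antipode H x \<cdot> y) \<ominus>\<^bsub>self_module K\<^esub> q (antipode H x' \<cdot> y) = \<zero>\<^bsub>self_module K\<^esub>"
    using linear_minus[OF modC modK l1 x x'(1)] q_AH_left[OF xx y] by simp
  from iffD1[OF S.minus_eq_zero_iff[OF linear_closed[OF l1 x] linear_closed[OF l1 x'(1)]] this]
  have "q (antipode H x \<cdot> y) = q (antipode H x' \<cdot> y)" .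
  moreover have "q (antipode H x' \<cdot> y) \<ominus>\<^bsub>self_module K\<^esub> q (antipode H x' \<cdot> y') = \<zero>\<^bsub>self_module K\<^esub>"
    using linear_minus[OF modC modK l2 y y'(1)] q_AH_right[OF yy antipode_closed[OF x'(1)]] by simp
  from iffD1[OF S.minus_eq_zero_iff[OF linear_closed[OF l2 y] linear_closed[OF l2 y'(1)]] this]
  have "q (antipode H x' \<cdot> y) = q (antipode H x' \<cdot> y')" .
  ultimately show ?thesis by (simp add: \<tau>_def x'_def y'_def)
qed

lemma \<tau>_bilinear: "\<tau> \<in> bilinear_maps K Q Q (self_module K)"
proof (rule bilinear_mapsI)
  fix X assume "X \<in> carrier Q"
  then obtain x where x: "x \<in> carrier H" "X = p x" by (auto simp: quotient_carrier[OF modC AH_submodule])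
  show "(\<lambda>Y. \<tau> X Y) \<in> linear_maps K Q (self_module K)"
    by (rule quotient_linear_descend[OF modC AH_submodule, of "\<lambda>y. q (antipode H x \<cdot> y)"])
      (use x in \<open>auto simp: \<tau>_proj intro!: linear_rules linear_comp[OF q_dual] closed\<close>)
next
  fix Y assume "Y \<in> carrier Q"
  then obtain y where y: "y \<in> carrier H" "Y = p y" by (auto simp: quotient_carrier[OF modC AH_submodule])
  show "(\<lambda>X. \<tau> X Y) \<in> linear_maps K Q (self_module K)"
    by (rule quotient_linear_descend[OF modC AH_submodule, of "\<lambda>x. q (antipode H x \<cdot> y)"])
      (use y in \<open>auto simp: \<tau>_proj intro!: linear_rules linear_comp[OF q_dual] closed\<close>)
qed

lemma cosemisimple_quotient: "cosemisimple K CQ"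
proof -
  interpret C: coalgebra K CQ by (rule quotient_coalgebra_CQ)
  have modCQ: "module K CQ" by (rule C.modC)
  \<comment> \<open>The presentation chosen in the quotient for the class of \<open>x\<close> is
    unrelated to the one chosen in \<open>H\<close> for \<open>x\<close>; the two sums are compared
    through \<open>tensor_lift\<close>.\<close>
  have sw: "C.sweedler P (p x) \<beta> = sweedler P x (\<lambda>y z. \<beta> (p y) (p z))"
    if "module K P" "\<beta> \<in> bilinear_maps K Q Q P" "x \<in> carrier H" for P :: "('a, 'x, 'y) module_scheme" and \<beta> x
  proof -
    have "C.sweedler P (p x) \<beta> = tensor_lift K P \<beta> (comult CQ (p x))"
      by (rule C.sweedler_eq_tensor_lift[symmetric]) (use that p_closed in simp_all)
    also have "\<dots> = sweedler P x (\<lambda>y z. \<beta> (p y) (p z))"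
      by (rule tensor_lift_comult_quotient[OF coideal that])
    finally show ?thesis .
  qed
  \<comment> \<open>The balance condition takes its values in the coalgebra record
    \<open>CQ\<close>, whereas \<open>balanced\<close> is stated in \<open>Q\<close>. A Sweedler sum
    involves only the addition and the zero of its target, which agree.\<close>
  have sw_CQ: "C.sweedler CQ (p x) \<beta> = sweedler Q x (\<lambda>y z. \<beta> (p y) (p z))"
    if "\<beta> \<in> bilinear_maps K Q Q Q" "x \<in> carrier H" for \<beta> x
  proof -
    have "C.sweedler CQ (p x) \<beta> = sweedler CQ x (\<lambda>y z. \<beta> (p y) (p z))"
      by (rule sw[OF modCQ _ that(2)]) (use that in \<open>simp add: bilinear_maps_def\<close>)
    then show ?thesis by (simp add: sweedler_def lsum_def)
  qed
  have "\<exists>E. subcoalgebra K CQ E \<and> C.complementary D E" if D: "subcoalgebra K CQ D" for D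
  proof (rule C.coseparable_complement[OF _ _ _ D])
    show "\<tau> \<in> bilinear_maps K CQ CQ (self_module K)" using \<tau>_bilinear by simp
  next
    fix X assume "X \<in> carrier CQ"
    then obtain x where x: "x \<in> carrier H" "X = p x" by (auto simp: quotient_carrier[OF modC AH_submodule])
    have "C.sweedler (self_module K) X \<tau> = sweedler (self_module K) x (\<lambda>y z. \<tau> (p y) (p z))"
      unfolding x(2) by (rule sw[OF modK \<tau>_bilinear x(1)])
    also have "\<dots> = sweedler (self_module K) x (\<lambda>y z. q (antipode H y \<cdot> z))"
      by (rule sweedler_cong[OF x(1)]) (rule \<tau>_proj)
    also have "\<dots> = q (sweedler H x (\<lambda>y z. antipode H y \<cdot> z))"
      by (rule sweedler_image[OF modC modK q_dual x(1), symmetric]) (simp add: closed)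
    \<comment> \<open>The antipode axiom leaves the factor \<open>q\<close> of the unit, which is 1
      because the unit belongs to \<open>A\<close>.\<close>
    also have "\<dots> = counit H x"
      using linear_smult[OF q_dual counit_closed[OF x(1)] oneH_closed] q_A[OF A_one] x counit_closed
      by (simp add: sweedler_antipode counit_one monoid.r_one[OF ring.is_monoid[OF cring.axioms(1)[OF cringK]]])
    also have "\<dots> = counit CQ X" unfolding x(2) by (rule counit_quotient[OF coideal x(1), symmetric])
    finally show "C.sweedler (self_module K) X \<tau> = counit CQ X" .
  next
    fix X Y assume "X \<in> carrier CQ" "Y \<in> carrier CQ"
    then obtain x y where x: "x \<in> carrier H" "X = p x" and y: "y \<in> carrier H" "Y = p y"
      by (auto simp: quotient_carrier[OF modC AH_submodule])
    interpret Q: module K Q by (rule modQ')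
    have \<tau>c: "\<tau> U V \<in> carrier K" if "U \<in> carrier Q" "V \<in> carrier Q" for U V
      using bilinear_closed[OF \<tau>_bilinear that] by simp
    note XY = p_closed[OF x(1), folded x(2)] p_closed[OF y(1), folded y(2)]
    note rules = smult_linear_left[OF modQ'] smult_linear_right[OF modQ'] bilinear_right[OF \<tau>_bilinear]
      bilinear_left[OF \<tau>_bilinear] \<tau>c linear_id
    have b: "(\<lambda>u v. \<tau> v Y \<odot>\<^bsub>Q\<^esub> u) \<in> bilinear_maps K Q Q Q" "(\<lambda>u v. \<tau> X u \<odot>\<^bsub>Q\<^esub> v) \<in> bilinear_maps K Q Q Q"
      by (rule bilinear_mapsI; use XY in \<open>auto intro!: rules\<close>)+
    have "C.sweedler CQ X (\<lambda>u v. \<tau> v Y \<odot>\<^bsub>Q\<^esub> u) = sweedler Q x (\<lambda>u v. \<tau> (p v) Y \<odot>\<^bsub>Q\<^esub> p u)"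
      unfolding x(2) by (rule sw_CQ[OF b(1) x(1)])
    also have "\<dots> = sweedler Q x (\<lambda>u v. q (antipode H v \<cdot> y) \<odot>\<^bsub>Q\<^esub> p u)"
      unfolding y(2) by (rule sweedler_cong[OF x(1)]) (simp add: \<tau>_proj y(1))
    also have "\<dots> = sweedler Q y (\<lambda>u v. q (antipode H x \<cdot> u) \<odot>\<^bsub>Q\<^esub> p v)"
      by (rule balanced[OF x(1) y(1)])
    also have "\<dots> = sweedler Q y (\<lambda>u v. \<tau> X (p u) \<odot>\<^bsub>Q\<^esub> p v)"
      unfolding x(2) by (rule sweedler_cong[OF y(1)]) (simp add: \<tau>_proj x(1))
    also have "\<dots> = C.sweedler CQ Y (\<lambda>u v. \<tau> X u \<odot>\<^bsub>Q\<^esub> v)"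
      unfolding y(2) by (rule sw_CQ[OF b(2) y(1), symmetric])
    finally show "C.sweedler CQ X (\<lambda>u v. \<tau> v Y \<odot>\<^bsub>CQ\<^esub> u) = C.sweedler CQ Y (\<lambda>u v. \<tau> X u \<odot>\<^bsub>CQ\<^esub> v)" by simp
  qed
  from C.complemented_imp_direct_sum[OF this] show ?thesis
    unfolding cosemisimple_def using C.coalgebra_axioms by blast
qed

end

theorem theorem2p5:
  fixes K :: "('a, 'i) ring_scheme"
    and H :: "('a, 'b, 'j) hopf_algebra_scheme"
    and A :: "'b set"
  assumes "Ring.field K"
    and "hopf_algebra K H"
    and "cosemisimple K H"
    and "hopf_subalgebra K H A"
  shows "cosemisimple K (quotient_coalgebra K H (gen_left_ideal H (augmentation_part K H A)))"
proof -
  interpret H: hopf_algebra K H by fact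
  have A: "subcoalgebra K H A" using assms(4) by (simp add: hopf_subalgebra_def)
  obtain B where B: "subcoalgebra K H B" "H.complementary A B"
    using H.cosemisimple_complement[OF _ A] assms(3) unfolding cosemisimple_def by blast
  obtain q where "q \<in> H.dual" "\<forall>a\<in>A. q a = counit H a" "\<forall>b\<in>B. q b = \<zero>\<^bsub>K\<^esub>"
    "\<forall>c\<in>carrier H. H.lhit q c \<in> A \<and> H.rhit q c = H.lhit q c"
    using H.complementary_functional[OF A B] by blast
  then interpret hopf_subalgebra_complement K H A B q
    by unfold_locales (use assms(4) B in auto)
  show ?thesis by (rule cosemisimple_quotient)
qed

end
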